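(* Assume the Ultrapower Axiom. Suppose $U$ and $W$ are countably complete ultrafilters. Then the following are equivalent: (1) $U\mathrel{I}W$ and $W\mathrel{I}U$; (2) $j_U(j_W)=j_W\restriction M_U$ and $j_W(j_U)=j_U\restriction M_W$.
   Context: For a countably complete ultrafilter $U$, $j_U:V\to M_U$ is its ultrapower embedding. For a definable class embedding $k$ and an elementary $j:V\to M$, $j(k)$ denotes the image of $k$ under $j$ (so e.g. $j_U(j_W)=j^{M_U}_{j_U(W)}:M_U\to j_U(M_W)$). The internal relation is defined by $U\mathrel{I}W$ iff $j_U\restriction x\in M_W$ for every set $x\in M_W$. An internal ultrapower embedding of an inner model $M$ is an embedding of the form $j^M_Z:M\to M^M_Z$ for some $Z\in M$ that is a countably complete ultrafilter in $M$. A comparison of a pair $(j_0,j_1)$ with $j_0:V\to M_0$, $j_1:V\to M_1$ is a pair of internal ultrapower embeddings $i_0:M_0\to N$, $i_1:M_1\to N$ with $i_0\circ j_0=i_1\circ j_1$. The Ultrapower Axiom (UA) states that every pair $(j_U,j_W)$ of ultrapower embeddings by countably complete ultrafilters admits a comparison. *)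

theory Defs
  imports Main "HOL-Library.FuncSet"
begin

text \<open>
  The set-theoretic universe is an arbitrary model \<open>(V, \<epsilon>)\<close> of first-order ZFC, carried by a type
  \<open>'v\<close>; so a theorem about all such models is precisely a theorem of ZFC.  The model need not
  be well-founded from the outside, hence proper classes are always classes definable over it
  with parameters, never arbitrary HOL sets.

  Every notion is relativised to a class \<open>M\<close> with the membership relation of the universe.
  Taking \<open>M = UNIV\<close> gives its meaning in \<open>V\<close>; taking an inner model \<open>M\<close> gives its
  meaning as computed inside \<open>M\<close>.
\<close>

section \<open>First-order formulas, definable class functions, and ZFC\<close>

datatype fm = Mem nat nat | Eq nat nat | Neg fm | And fm fm | Ex nat fm

context
  fixes M :: "'v set" and E :: "'v \<Rightarrow> 'v \<Rightarrow> bool"  (infix "\<epsilon>" 50)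
begin

primrec sat :: "fm \<Rightarrow> (nat \<Rightarrow> 'v) \<Rightarrow> bool" where
  "sat (Mem m n) e \<longleftrightarrow> e m \<epsilon> e n"
| "sat (Eq m n) e \<longleftrightarrow> e m = e n"
| "sat (Neg \<phi>) e \<longleftrightarrow> \<not> sat \<phi> e"
| "sat (And \<phi> \<psi>) e \<longleftrightarrow> sat \<phi> e \<and> sat \<psi> e"
| "sat (Ex n \<phi>) e \<longleftrightarrow> (\<exists>x\<in>M. sat \<phi> (e(n := x)))"

text \<open>
  The variables 0 and 1 of \<open>\<phi>\<close> stand for argument and value; all other variables are
  parameters, interpreted by \<open>e\<close>.
\<close>

definition defines_fun :: "fm \<Rightarrow> (nat \<Rightarrow> 'v) \<Rightarrow> 'v set \<Rightarrow> ('v \<Rightarrow> 'v) \<Rightarrow> bool" where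
  "defines_fun \<phi> e D k \<longleftrightarrow> range e \<subseteq> M \<and>
     (\<forall>x\<in>M. \<forall>y\<in>M. sat \<phi> (e(0 := x, 1 := y)) \<longleftrightarrow> x \<in> D \<and> k x = y)"

definition definable_fun :: "'v set \<Rightarrow> ('v \<Rightarrow> 'v) \<Rightarrow> bool" where
  "definable_fun D k \<longleftrightarrow> k \<in> D \<rightarrow>\<^sub>E M \<and> D \<subseteq> M \<and> (\<exists>\<phi> e. defines_fun \<phi> e D k)"

definition is_empty :: "'v \<Rightarrow> bool" where
  "is_empty a \<longleftrightarrow> (\<forall>x\<in>M. \<not> x \<epsilon> a)"

definition is_subset :: "'v \<Rightarrow> 'v \<Rightarrow> bool" where
  "is_subset a b \<longleftrightarrow> (\<forall>x\<in>M. x \<epsilon> a \<longrightarrow> x \<epsilon> b)"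

definition is_succ :: "'v \<Rightarrow> 'v \<Rightarrow> bool" where
  "is_succ a b \<longleftrightarrow> (\<forall>x\<in>M. x \<epsilon> b \<longleftrightarrow> x \<epsilon> a \<or> x = a)"

definition is_inductive :: "'v \<Rightarrow> bool" where
  "is_inductive a \<longleftrightarrow> (\<exists>x\<in>M. is_empty x \<and> x \<epsilon> a) \<and>
     (\<forall>x\<in>M. x \<epsilon> a \<longrightarrow> (\<exists>y\<in>M. is_succ x y \<and> y \<epsilon> a))"

definition is_omega :: "'v \<Rightarrow> bool" where
  "is_omega w \<longleftrightarrow> is_inductive w \<and> (\<forall>a\<in>M. is_inductive a \<longrightarrow> is_subset w a)"

definition ZFC :: bool where
  "ZFC \<longleftrightarrow>
     \<comment> \<open>Extensionality\<close>
     (\<forall>a\<in>M. \<forall>b\<in>M. (\<forall>x\<in>M. x \<epsilon> a \<longleftrightarrow> x \<epsilon> b) \<longrightarrow> a = b) \<and>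
     \<comment> \<open>Foundation\<close>
     (\<forall>a\<in>M. \<not> is_empty a \<longrightarrow> (\<exists>x\<in>M. x \<epsilon> a \<and> (\<forall>y\<in>M. y \<epsilon> x \<longrightarrow> \<not> y \<epsilon> a))) \<and>
     \<comment> \<open>Pairing\<close>
     (\<forall>a\<in>M. \<forall>b\<in>M. \<exists>c\<in>M. \<forall>x\<in>M. x \<epsilon> c \<longleftrightarrow> x = a \<or> x = b) \<and>
     \<comment> \<open>Union\<close>
     (\<forall>a\<in>M. \<exists>b\<in>M. \<forall>x\<in>M. x \<epsilon> b \<longleftrightarrow> (\<exists>y\<in>M. x \<epsilon> y \<and> y \<epsilon> a)) \<and>
     \<comment> \<open>Power set\<close>
     (\<forall>a\<in>M. \<exists>b\<in>M. \<forall>x\<in>M. x \<epsilon> b \<longleftrightarrow> is_subset x a) \<and>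
     \<comment> \<open>Infinity\<close>
     (\<exists>a\<in>M. is_inductive a) \<and>
     \<comment> \<open>Separation schema\<close>
     (\<forall>\<phi> e. range e \<subseteq> M \<longrightarrow>
        (\<forall>a\<in>M. \<exists>b\<in>M. \<forall>x\<in>M. x \<epsilon> b \<longleftrightarrow> x \<epsilon> a \<and> sat \<phi> (e(0 := x)))) \<and>
     \<comment> \<open>Replacement schema\<close>
     (\<forall>\<phi> e. range e \<subseteq> M \<longrightarrow>
        (\<forall>a\<in>M. (\<forall>x\<in>M. x \<epsilon> a \<longrightarrow> (\<exists>!y. y \<in> M \<and> sat \<phi> (e(0 := x, 1 := y)))) \<longrightarrow>
          (\<exists>b\<in>M. \<forall>y\<in>M. y \<epsilon> b \<longleftrightarrow> (\<exists>x\<in>M. x \<epsilon> a \<and> sat \<phi> (e(0 := x, 1 := y)))))) \<and>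
     \<comment> \<open>Choice\<close>
     (\<forall>a\<in>M. (\<forall>x\<in>M. x \<epsilon> a \<longrightarrow> \<not> is_empty x) \<and>
        (\<forall>x\<in>M. \<forall>y\<in>M. x \<epsilon> a \<and> y \<epsilon> a \<and> x \<noteq> y \<longrightarrow> \<not> (\<exists>z\<in>M. z \<epsilon> x \<and> z \<epsilon> y)) \<longrightarrow>
        (\<exists>c\<in>M. \<forall>x\<in>M. x \<epsilon> a \<longrightarrow> (\<exists>!z. z \<in> M \<and> z \<epsilon> x \<and> z \<epsilon> c)))"


section \<open>Functions as sets\<close>

definition is_upair :: "'v \<Rightarrow> 'v \<Rightarrow> 'v \<Rightarrow> bool" where
  "is_upair x y p \<longleftrightarrow> (\<forall>z\<in>M. z \<epsilon> p \<longleftrightarrow> z = x \<or> z = y)"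

definition is_opair :: "'v \<Rightarrow> 'v \<Rightarrow> 'v \<Rightarrow> bool" where
  "is_opair x y p \<longleftrightarrow> (\<exists>a\<in>M. \<exists>b\<in>M. is_upair x x a \<and> is_upair x y b \<and> is_upair a b p)"

definition maps_to :: "'v \<Rightarrow> 'v \<Rightarrow> 'v \<Rightarrow> bool" where
  "maps_to f x y \<longleftrightarrow> (\<exists>p\<in>M. is_opair x y p \<and> p \<epsilon> f)"

definition is_fun_on :: "'v \<Rightarrow> 'v \<Rightarrow> bool" where
  "is_fun_on X f \<longleftrightarrow>
     (\<forall>p\<in>M. p \<epsilon> f \<longrightarrow> (\<exists>x\<in>M. \<exists>y\<in>M. x \<epsilon> X \<and> is_opair x y p)) \<and>
     (\<forall>x\<in>M. x \<epsilon> X \<longrightarrow> (\<exists>!y. y \<in> M \<and> maps_to f x y))"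

text \<open>\<open>f\<close> is the set \<open>k \<restriction> x\<close>, for a class function \<open>k\<close>.\<close>

definition is_restriction :: "('v \<Rightarrow> 'v) \<Rightarrow> 'v \<Rightarrow> 'v \<Rightarrow> bool" where
  "is_restriction k x f \<longleftrightarrow> (\<forall>p\<in>M. p \<epsilon> f \<longleftrightarrow> (\<exists>y\<in>M. y \<epsilon> x \<and> is_opair y (k y) p))"


section \<open>Countably complete ultrafilters\<close>

definition ultrafilter_on :: "'v \<Rightarrow> 'v \<Rightarrow> bool" where
  "ultrafilter_on X U \<longleftrightarrow>
     (\<forall>A\<in>M. A \<epsilon> U \<longrightarrow> is_subset A X) \<and>
     X \<epsilon> U \<and>
     (\<forall>A\<in>M. A \<epsilon> U \<longrightarrow> \<not> is_empty A) \<and>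
     (\<forall>A\<in>M. \<forall>B\<in>M. A \<epsilon> U \<and> is_subset A B \<and> is_subset B X \<longrightarrow> B \<epsilon> U) \<and>
     (\<forall>A\<in>M. \<forall>B\<in>M. \<forall>C\<in>M. A \<epsilon> U \<and> B \<epsilon> U \<and> (\<forall>x\<in>M. x \<epsilon> C \<longleftrightarrow> x \<epsilon> A \<and> x \<epsilon> B) \<longrightarrow> C \<epsilon> U) \<and>
     (\<forall>A\<in>M. \<forall>B\<in>M. is_subset A X \<and> (\<forall>x\<in>M. x \<epsilon> B \<longleftrightarrow> x \<epsilon> X \<and> \<not> x \<epsilon> A) \<longrightarrow> A \<epsilon> U \<or> B \<epsilon> U)"

definition countably_complete :: "'v \<Rightarrow> 'v \<Rightarrow> bool" where
  "countably_complete X U \<longleftrightarrow>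
     (\<forall>w\<in>M. \<forall>F\<in>M. is_omega w \<and> is_fun_on w F \<and>
        (\<forall>n\<in>M. \<forall>A\<in>M. maps_to F n A \<longrightarrow> A \<epsilon> U) \<longrightarrow>
        (\<exists>B\<in>M. B \<epsilon> U \<and>
          (\<forall>x\<in>M. x \<epsilon> B \<longleftrightarrow> x \<epsilon> X \<and> (\<forall>n\<in>M. \<forall>A\<in>M. maps_to F n A \<longrightarrow> x \<epsilon> A))))"

definition cc_ultrafilter :: "'v \<Rightarrow> bool" where
  "cc_ultrafilter U \<longleftrightarrow>
     U \<in> M \<and> (\<exists>X\<in>M. ultrafilter_on X U \<and> countably_complete X U)"


section \<open>Ultrapowers\<close>

definition uf_space :: "'v \<Rightarrow> 'v" where
  "uf_space U = (THE X. X \<in> M \<and> ultrafilter_on X U)"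

definition uf_funs :: "'v \<Rightarrow> 'v set" where
  "uf_funs U = {f \<in> M. is_fun_on (uf_space U) f}"

definition eq_mod :: "'v \<Rightarrow> 'v \<Rightarrow> 'v \<Rightarrow> bool" where
  "eq_mod U f g \<longleftrightarrow>
     (\<exists>A\<in>M. A \<epsilon> U \<and> (\<forall>x\<in>M. x \<epsilon> A \<longleftrightarrow> x \<epsilon> uf_space U \<and>
        (\<exists>y\<in>M. \<exists>z\<in>M. maps_to f x y \<and> maps_to g x z \<and> y = z)))"

definition mem_mod :: "'v \<Rightarrow> 'v \<Rightarrow> 'v \<Rightarrow> bool" where
  "mem_mod U f g \<longleftrightarrow>
     (\<exists>A\<in>M. A \<epsilon> U \<and> (\<forall>x\<in>M. x \<epsilon> A \<longleftrightarrow> x \<epsilon> uf_space U \<and>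
        (\<exists>y\<in>M. \<exists>z\<in>M. maps_to f x y \<and> maps_to g x z \<and> y \<epsilon> z)))"

text \<open>
  The map \<open>f \<mapsto> [f]\<^sub>U\<close>, where the ultrapower of \<open>M\<close> by \<open>U\<close> (formed from the functions in \<open>M\<close>)
  is identified with its transitive collapse.  Definability over \<open>M\<close> is what makes the collapse
  unique when \<open>\<epsilon>\<close> is not well-founded from the outside.
\<close>

definition is_collapse :: "'v \<Rightarrow> ('v \<Rightarrow> 'v) \<Rightarrow> bool" where
  "is_collapse U \<pi> \<longleftrightarrow>
     definable_fun (uf_funs U) \<pi> \<and>
     (\<forall>f\<in>uf_funs U. \<forall>g\<in>uf_funs U. \<pi> f = \<pi> g \<longleftrightarrow> eq_mod U f g) \<and>
     (\<forall>f\<in>uf_funs U. \<forall>g\<in>uf_funs U. \<pi> f \<epsilon> \<pi> g \<longleftrightarrow> mem_mod U f g) \<and>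
     (\<forall>f\<in>uf_funs U. \<forall>z\<in>M. z \<epsilon> \<pi> f \<longrightarrow> z \<in> \<pi> ` uf_funs U)"

definition ult_class :: "'v \<Rightarrow> 'v \<Rightarrow> 'v" where
  "ult_class U = (THE \<pi>. is_collapse U \<pi>)"

definition const_fun :: "'v \<Rightarrow> 'v \<Rightarrow> 'v" where
  "const_fun U x =
     (THE f. f \<in> uf_funs U \<and> (\<forall>i\<in>M. i \<epsilon> uf_space U \<longrightarrow> maps_to f i x))"

definition ult :: "'v \<Rightarrow> 'v set" where
  "ult U = ult_class U ` uf_funs U"

definition ult_emb :: "'v \<Rightarrow> 'v \<Rightarrow> 'v" where
  "ult_emb U = (\<lambda>x\<in>M. ult_class U (const_fun U x))"

definition internal_ult_emb :: "('v \<Rightarrow> 'v) \<Rightarrow> 'v set \<Rightarrow> bool" where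
  "internal_ult_emb i N \<longleftrightarrow> (\<exists>Z. cc_ultrafilter Z \<and> i = ult_emb Z \<and> N = ult Z)"

end


section \<open>Images of classes, the internal relation, and the Ultrapower Axiom\<close>

text \<open>
  \<open>j(k)\<close> for \<open>j : M \<rightarrow> N\<close> elementary and \<open>k : M \<rightarrow> M\<close> definable over \<open>M\<close>: any formula with
  parameters \<open>e\<close> defining \<open>k\<close> over \<open>M\<close> defines \<open>j(k)\<close> over \<open>N\<close> with parameters \<open>j \<circ> e\<close>.
\<close>

definition image_fun ::
    "('v \<Rightarrow> 'v \<Rightarrow> bool) \<Rightarrow> 'v set \<Rightarrow> 'v set \<Rightarrow> ('v \<Rightarrow> 'v) \<Rightarrow> ('v \<Rightarrow> 'v) \<Rightarrow> 'v \<Rightarrow> 'v" where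
  "image_fun E M N j k =
     (THE k'. k' \<in> N \<rightarrow>\<^sub>E N \<and>
        (\<forall>\<phi> e. defines_fun M E \<phi> e M k \<longrightarrow> defines_fun N E \<phi> (j \<circ> e) N k'))"

definition internal_rel :: "('v \<Rightarrow> 'v \<Rightarrow> bool) \<Rightarrow> 'v \<Rightarrow> 'v \<Rightarrow> bool" where
  "internal_rel E U W \<longleftrightarrow>
     (\<forall>x \<in> ult UNIV E W. \<exists>f \<in> ult UNIV E W. is_restriction UNIV E (ult_emb UNIV E U) x f)"

definition comparison ::
    "('v \<Rightarrow> 'v \<Rightarrow> bool) \<Rightarrow> ('v \<Rightarrow> 'v) \<Rightarrow> 'v set \<Rightarrow> ('v \<Rightarrow> 'v) \<Rightarrow> 'v set \<Rightarrow>
     ('v \<Rightarrow> 'v) \<Rightarrow> ('v \<Rightarrow> 'v) \<Rightarrow> 'v set \<Rightarrow> bool" where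
  "comparison E j\<^sub>0 M\<^sub>0 j\<^sub>1 M\<^sub>1 i\<^sub>0 i\<^sub>1 N \<longleftrightarrow>
     internal_ult_emb M\<^sub>0 E i\<^sub>0 N \<and> internal_ult_emb M\<^sub>1 E i\<^sub>1 N \<and> i\<^sub>0 \<circ> j\<^sub>0 = i\<^sub>1 \<circ> j\<^sub>1"

definition UA :: "('v \<Rightarrow> 'v \<Rightarrow> bool) \<Rightarrow> bool" where
  "UA E \<longleftrightarrow>
     (\<forall>U W. cc_ultrafilter UNIV E U \<and> cc_ultrafilter UNIV E W \<longrightarrow>
        (\<exists>i\<^sub>0 i\<^sub>1 N. comparison E (ult_emb UNIV E U) (ult UNIV E U)
                                (ult_emb UNIV E W) (ult UNIV E W) i\<^sub>0 i\<^sub>1 N))"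

end

theory Submission
  imports Defs
begin

text \<open>
  Write \<open>i = j\<^sub>U(j\<^sub>W) : M\<^sub>U \<rightarrow> N\<close> and \<open>i' = j\<^sub>W(j\<^sub>U) : M\<^sub>W \<rightarrow> N'\<close>.  By elementarity
  \<open>i \<circ> j\<^sub>U = j\<^sub>U \<circ> j\<^sub>W\<close>, and \<open>N\<close> is generated over the range of \<open>j\<^sub>U \<restriction> M\<^sub>W\<close> by the single point \<open>i(s\<^sub>U)\<close>,
  where \<open>s\<^sub>U = [id]\<^sub>U\<close>.  If \<open>U\<close> is internal to \<open>W\<close>, the ultrafilter derived from this point lies in
  \<open>M\<^sub>W\<close>, so \<open>j\<^sub>U \<restriction> M\<^sub>W\<close> is an internal ultrapower embedding of \<open>M\<^sub>W\<close>.  If also \<open>W\<close> is internal to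
  \<open>U\<close>, then \<open>(i, j\<^sub>U \<restriction> M\<^sub>W)\<close> and \<open>(j\<^sub>W \<restriction> M\<^sub>U, i')\<close> are both comparisons of \<open>(j\<^sub>U, j\<^sub>W)\<close>.
  \<open>N\<close> and \<open>N'\<close> are ultrapowers of \<open>V\<close>, so the Ultrapower Axiom provides internal ultrapowers
  \<open>k : N \<rightarrow> P\<close> and \<open>k' : N' \<rightarrow> P\<close> with \<open>k \<circ> i \<circ> j\<^sub>U = k' \<circ> i' \<circ> j\<^sub>W\<close>.

  The embeddings \<open>k \<circ> i\<close> and \<open>k' \<circ> j\<^sub>W\<close> are internal ultrapower embeddings of \<open>M\<^sub>U\<close> into the same
  \<open>P\<close>, and they agree on the range of \<open>j\<^sub>U\<close>.  They agree everywhere: otherwise let \<open>S\<close> be the set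
  of points of the underlying set at which two such embeddings can differ, and let \<open>x\<close> be its
  element selected by a choice function \<open>c\<close> in the range of \<open>j\<^sub>U\<close>; then \<open>x\<close> is definable from
  \<open>c\<close>, so no two embeddings that agree on \<open>c\<close> differ at \<open>x\<close>.  The same holds over \<open>M\<^sub>W\<close>.  Since
  \<open>N\<close> and \<open>N'\<close> are generated by corresponding points, \<open>k[N] = k'[N']\<close>; both being transitive,
  \<open>N = N'\<close>, \<open>k = k'\<close> and \<open>i = j\<^sub>W \<restriction> M\<^sub>U\<close>.

  Conversely, \<open>j\<^sub>W(j\<^sub>U)\<close> is definable over \<open>M\<^sub>W\<close>, so its restrictions to sets are in \<open>M\<^sub>W\<close> by
  replacement.
\<close>

section \<open>First-order definability\<close>

text \<open>Three obstacles shape the development. The model may be ill-founded from outside, so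
  induction and recursion along \<epsilon> are available only for classes definable with parameters;
  \<open>dpred\<close> and \<open>dterm\<close> keep track of this, and the collapse of an
  ultrapower is obtained by a recursion carried out in the model. Elementary embeddings transfer
  single formulas, whereas \<open>ult_emb\<close> is given by a description over HOL functions;
  \<open>uemb\<close> and \<open>umem\<close> express the same by formulas, and \<open>fo\<close>
  certifies that one formula serves all structures. Finally, ultrapowers must be formed inside inner
  models: rather than relativising every argument, an inner model is required to be equinumerous
  with the type, so that results about models on the whole type carry over along a bijection. In the
  agreement argument one usually takes the least ordinal at which two embeddings differ; a choice
  function in the range of \<open>j\<^sub>U\<close> takes the place of the well-order.\<close>

primrec vars :: "fm \<Rightarrow> nat set" where
  "vars (Mem m n) = {m, n}"
| "vars (Eq m n) = {m, n}"
| "vars (Neg \<phi>) = vars \<phi>"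
| "vars (And \<phi> \<psi>) = vars \<phi> \<union> vars \<psi>"
| "vars (Ex n \<phi>) = insert n (vars \<phi>)"

lemma finite_vars [simp]: "finite (vars \<phi>)"
  by (induction \<phi>) auto

lemma sat_cong: "(\<And>n. n \<in> vars \<phi> \<Longrightarrow> e n = e' n) \<Longrightarrow> sat M E \<phi> e \<longleftrightarrow> sat M E \<phi> e'"
proof (induction \<phi> arbitrary: e e')
  case (Ex n \<phi>)
  have "sat M E \<phi> (e(n := x)) \<longleftrightarrow> sat M E \<phi> (e'(n := x))" for x
    by (rule Ex.IH) (use Ex.prems in auto)
  then show ?case by simp
next
  case (And \<phi> \<psi>)
  have "sat M E \<phi> e \<longleftrightarrow> sat M E \<phi> e'" "sat M E \<psi> e \<longleftrightarrow> sat M E \<psi> e'"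
    by (rule And.IH, use And.prems in simp)+
  then show ?case by simp
next
  case (Neg \<phi>)
  have "sat M E \<phi> e \<longleftrightarrow> sat M E \<phi> e'"
    by (rule Neg.IH, use Neg.prems in simp)
  then show ?case by simp
qed simp_all

lemma fresh_var:
  fixes S :: "nat set" assumes "finite S" obtains m where "m \<notin> S"
  using assms ex_new_if_finite infinite_UNIV_nat by blast

text \<open>The formula is found before the structure and the environment, so that one renaming
  serves source and target of an embedding alike. Since \<open>f\<close> may identify variables, a
  quantifier gets a new bound variable outside the image under \<open>f\<close> of the variables of
  its body.\<close>

lemma sat_rename:
  "\<exists>\<psi>. \<forall>(M :: 'v set) E e. sat M E \<psi> e \<longleftrightarrow> sat M E \<phi> (\<lambda>n. e (f n))"
proof (induction \<phi> arbitrary: f)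
  case (Mem m n)
  show ?case by (rule exI[of _ "Mem (f m) (f n)"]) simp
next
  case (Eq m n)
  show ?case by (rule exI[of _ "Eq (f m) (f n)"]) simp
next
  case (Neg \<phi>)
  then obtain \<psi> where "\<forall>(M :: 'v set) E e. sat M E \<psi> e \<longleftrightarrow> sat M E \<phi> (\<lambda>n. e (f n))" by blast
  then show ?case by (intro exI[of _ "Neg \<psi>"]) simp
next
  case (And \<phi> \<phi>')
  obtain \<psi> where "\<forall>(M :: 'v set) E e. sat M E \<psi> e \<longleftrightarrow> sat M E \<phi> (\<lambda>n. e (f n))"
    using And(1) by blast
  moreover obtain \<psi>' where "\<forall>(M :: 'v set) E e. sat M E \<psi>' e \<longleftrightarrow> sat M E \<phi>' (\<lambda>n. e (f n))"
    using And(2) by blast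
  ultimately show ?case by (intro exI[of _ "And \<psi> \<psi>'"]) simp
next
  case (Ex n \<phi>)
  obtain m where m: "m \<notin> f ` vars \<phi>" using fresh_var[of "f ` vars \<phi>"] by auto
  obtain \<psi> where \<psi>: "\<forall>(M :: 'v set) E e. sat M E \<psi> e \<longleftrightarrow> sat M E \<phi> (\<lambda>k. e ((f(n := m)) k))"
    using Ex by blast
  have "sat M E (Ex m \<psi>) e \<longleftrightarrow> sat M E (Ex n \<phi>) (\<lambda>k. e (f k))"
    for M :: "'v set" and E and e :: "nat \<Rightarrow> 'v"
  proof -
    have "sat M E \<psi> (e(m := x)) \<longleftrightarrow> sat M E \<phi> ((\<lambda>k. e (f k))(n := x))" for x
      unfolding \<psi>[rule_format] by (rule sat_cong) (use m in auto)
    then show ?thesis by simp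
  qed
  then show ?case by blast
qed

lemma sat_renameE:
  obtains \<psi> where "\<forall>(M :: 'v set) E e. sat M E \<psi> e \<longleftrightarrow> sat M E \<phi> (\<lambda>n. e (f n))"
proof -
  obtain \<psi> where "\<forall>(M :: 'v set) E e. sat M E \<psi> e \<longleftrightarrow> sat M E \<phi> (\<lambda>n. e (f n))"
    using sat_rename ..
  then show ?thesis by (intro that[of \<psi>]) simp
qed

text \<open>Passes from named variables to de Bruijn style shifting: slot 0 is the bound variable
  and slot \<open>n + 1\<close> the old slot \<open>n\<close>. The bound name \<open>m\<close>
  avoids the predecessors of the variables of \<open>\<psi>\<close>, because those are the slots
  read after the shift.\<close>

lemma sat_Ex_shiftE:
  obtains \<chi> where
    "\<forall>(M :: 'v set) E e. sat M E \<chi> e \<longleftrightarrow> (\<exists>x\<in>M. sat M E \<psi> (case_nat x e))"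
proof -
  obtain m where m: "m \<notin> vars \<psi>" "m \<notin> (\<lambda>n. n - 1) ` vars \<psi>"
    using fresh_var[of "vars \<psi> \<union> (\<lambda>n. n - 1) ` vars \<psi>"] by auto
  obtain \<psi>' where \<psi>': "\<forall>(M :: 'v set) E e. sat M E \<psi>' e \<longleftrightarrow> sat M E \<psi> (\<lambda>n. e (case_nat m id n))"
    by (rule sat_renameE[of \<psi> "case_nat m id"])
  have "sat M E \<psi>' (e(m := x)) \<longleftrightarrow> sat M E \<psi> (case_nat x e)"
    for M :: "'v set" and E and e :: "nat \<Rightarrow> 'v" and x
    unfolding \<psi>'[rule_format]
  proof (rule sat_cong)
    fix n assume n: "n \<in> vars \<psi>"
    show "(e(m := x)) (case_nat m id n) = case_nat x e n"
    proof (cases n)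
      case (Suc k)
      then have "k \<noteq> m" using m(2) n by force
      with Suc show ?thesis by simp
    qed simp
  qed
  then show ?thesis by (intro that[of "Ex m \<psi>'"]) simp
qed

text \<open>One formula has to work in all structures at once, since a predicate is transferred by
  evaluating that formula both in \<open>M\<close> and in \<open>N\<close>. Environments range over
  the structure only, as they do in elementarity.\<close>

definition fo :: "('v set \<Rightarrow> ('v \<Rightarrow> 'v \<Rightarrow> bool) \<Rightarrow> (nat \<Rightarrow> 'v) \<Rightarrow> bool) \<Rightarrow> bool" where
  "fo Q \<longleftrightarrow> (\<exists>\<phi>. \<forall>M E e. range e \<subseteq> M \<longrightarrow> (Q M E e \<longleftrightarrow> sat M E \<phi> e))"

lemma foI: "(\<And>M E e. range e \<subseteq> M \<Longrightarrow> Q M E e \<longleftrightarrow> sat M E \<phi> e) \<Longrightarrow> fo Q"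
  unfolding fo_def by (intro exI[of _ \<phi>] allI impI)

lemma foE:
  assumes "fo Q"
  obtains \<phi> where "\<forall>M E e. range e \<subseteq> M \<longrightarrow> (Q M E e \<longleftrightarrow> sat M E \<phi> e)"
proof -
  obtain \<phi> where "\<forall>M E e. range e \<subseteq> M \<longrightarrow> (Q M E e \<longleftrightarrow> sat M E \<phi> e)"
    using assms[unfolded fo_def] ..
  then show ?thesis by (intro that[of \<phi>]) simp
qed

lemma fo_mem: "fo (\<lambda>M E e. E (e m) (e n))"
  unfolding fo_def by (rule exI[of _ "Mem m n"]) simp

lemma fo_eq: "fo (\<lambda>M E e. e m = e n)"
  unfolding fo_def by (rule exI[of _ "Eq m n"]) simp

lemma fo_not: assumes "fo Q" shows "fo (\<lambda>M E e. \<not> Q M E e)"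
  by (rule foE[OF assms], rule foI[where \<phi> = "Neg _"]) simp

lemma fo_conj: assumes "fo Q" "fo R" shows "fo (\<lambda>M E e. Q M E e \<and> R M E e)"
  by (rule foE[OF assms(1)], rule foE[OF assms(2)], rule foI[where \<phi> = "And _ _"]) simp

lemma fo_disj: assumes "fo Q" "fo R" shows "fo (\<lambda>M E e. Q M E e \<or> R M E e)"
  using fo_not[OF fo_conj[OF fo_not[OF assms(1)] fo_not[OF assms(2)]]]
  by (simp only: de_Morgan_conj not_not)

lemma fo_imp: assumes "fo Q" "fo R" shows "fo (\<lambda>M E e. Q M E e \<longrightarrow> R M E e)"
  using fo_disj[OF fo_not[OF assms(1)] assms(2)] by (simp only: imp_conv_disj)

lemma fo_iff: assumes "fo Q" "fo R" shows "fo (\<lambda>M E e. Q M E e \<longleftrightarrow> R M E e)"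
  using fo_conj[OF fo_imp[OF assms] fo_imp[OF assms(2,1)]] by (simp only: iff_conv_conj_imp)

text \<open>The premise puts the quantified variable into slot 0 and shifts the rest, so that
  unification decomposes nested quantifiers without choosing names.\<close>

lemma fo_bex:
  assumes "fo (\<lambda>M E e. Q M E (\<lambda>n. e (Suc n)) (e 0))"
  shows "fo (\<lambda>M E e. \<exists>x\<in>M. Q M E e x)"
proof -
  obtain \<phi> where \<phi>: "\<forall>(M :: 'a set) E e. range e \<subseteq> M \<longrightarrow>
      (Q M E (\<lambda>n. e (Suc n)) (e 0) \<longleftrightarrow> sat M E \<phi> e)"
    by (rule foE[OF assms])
  obtain \<chi> where \<chi>: "\<forall>(M :: 'a set) E e. sat M E \<chi> e \<longleftrightarrow> (\<exists>x\<in>M. sat M E \<phi> (case_nat x e))"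
    by (rule sat_Ex_shiftE)
  show ?thesis
  proof (rule foI[where \<phi> = \<chi>])
    fix M :: "'a set" and E and e :: "nat \<Rightarrow> 'a" assume e: "range e \<subseteq> M"
    have "Q M E e x \<longleftrightarrow> sat M E \<phi> (case_nat x e)" if "x \<in> M" for x
      using \<phi>[rule_format, of "case_nat x e" M E] e that by (simp add: image_subset_iff split: nat.split)
    then show "(\<exists>x\<in>M. Q M E e x) \<longleftrightarrow> sat M E \<chi> e" by (simp add: \<chi>)
  qed
qed

lemma fo_ball:
  assumes "fo (\<lambda>M E e. Q M E (\<lambda>n. e (Suc n)) (e 0))"
  shows "fo (\<lambda>M E e. \<forall>x\<in>M. Q M E e x)"
  using fo_not[OF fo_bex[where Q = "\<lambda>M E e x. \<not> Q M E e x", OF fo_not[OF assms]]] by simp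

lemma Ex1_bounded: "(\<exists>!y. y \<in> M \<and> P y) \<longleftrightarrow> (\<exists>y\<in>M. P y \<and> (\<forall>z\<in>M. P z \<longrightarrow> z = y))"
  by auto

lemmas fo_intros = fo_mem fo_eq fo_not fo_conj fo_disj fo_imp fo_iff fo_bex fo_ball

lemma fo_is_empty: "fo (\<lambda>M E e. is_empty M E (e a))"
  unfolding is_empty_def by (intro fo_intros)

lemma fo_is_subset: "fo (\<lambda>M E e. is_subset M E (e a) (e b))"
  unfolding is_subset_def by (intro fo_intros)

lemma fo_is_succ: "fo (\<lambda>M E e. is_succ M E (e a) (e b))"
  unfolding is_succ_def by (intro fo_intros)

lemma fo_is_inductive: "fo (\<lambda>M E e. is_inductive M E (e a))"
  unfolding is_inductive_def by (intro fo_intros fo_is_empty fo_is_succ)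

lemma fo_is_omega: "fo (\<lambda>M E e. is_omega M E (e a))"
  unfolding is_omega_def by (intro fo_intros fo_is_inductive fo_is_subset)

lemma fo_is_upair: "fo (\<lambda>M E e. is_upair M E (e a) (e b) (e c))"
  unfolding is_upair_def by (intro fo_intros)

lemma fo_is_opair: "fo (\<lambda>M E e. is_opair M E (e a) (e b) (e c))"
  unfolding is_opair_def by (intro fo_intros fo_is_upair)

lemma fo_maps_to: "fo (\<lambda>M E e. maps_to M E (e a) (e b) (e c))"
  unfolding maps_to_def by (intro fo_intros fo_is_opair)

lemma fo_is_fun_on: "fo (\<lambda>M E e. is_fun_on M E (e a) (e b))"
  unfolding is_fun_on_def Ex1_bounded by (intro fo_intros fo_is_opair fo_maps_to)

lemma fo_ultrafilter_on: "fo (\<lambda>M E e. ultrafilter_on M E (e a) (e b))"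
  unfolding ultrafilter_on_def by (intro fo_intros fo_is_subset fo_is_empty)

lemma fo_countably_complete: "fo (\<lambda>M E e. countably_complete M E (e a) (e b))"
  unfolding countably_complete_def by (intro fo_intros fo_is_omega fo_is_fun_on fo_maps_to)

lemmas fo_basic = fo_is_empty fo_is_subset fo_is_succ fo_is_inductive fo_is_omega fo_is_upair
  fo_is_opair fo_maps_to fo_is_fun_on fo_ultrafilter_on fo_countably_complete

section \<open>Classes definable with parameters\<close>

definition the_or_junk :: "('a \<Rightarrow> bool) \<Rightarrow> 'a" where
  "the_or_junk P = (if \<exists>!x. P x then THE x. P x else undefined)"

lemma the_or_junk_eq: "P x \<Longrightarrow> (\<And>y. P y \<Longrightarrow> y = x) \<Longrightarrow> the_or_junk P = x"
  unfolding the_or_junk_def by (metis the_equality)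

locale zfc =
  fixes E :: "'v \<Rightarrow> 'v \<Rightarrow> bool"  (infix "\<epsilon>" 50)
  assumes zfc: "ZFC UNIV (\<epsilon>)"
begin

text \<open>Even slots of the environment carry the arguments and odd slots the parameters. The
  interleaving leaves every argument index free while providing for arbitrarily many
  parameters.\<close>

definition dpred :: "((nat \<Rightarrow> 'v) \<Rightarrow> bool) \<Rightarrow> bool" where
  "dpred P \<longleftrightarrow> (\<exists>\<phi> p. \<forall>e. P e \<longleftrightarrow>
     sat UNIV (\<epsilon>) \<phi> (\<lambda>n. if even n then e (n div 2) else p (n div 2)))"

definition dterm :: "((nat \<Rightarrow> 'v) \<Rightarrow> 'v) \<Rightarrow> bool" where
  "dterm t \<longleftrightarrow> dpred (\<lambda>e. t (\<lambda>n. e (Suc n)) = e 0)"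

lemma dpredI:
  assumes "\<And>e. P e \<longleftrightarrow> sat UNIV (\<epsilon>) \<phi> (\<lambda>n. if even n then e (n div 2) else p (n div 2))"
  shows "dpred P"
  unfolding dpred_def by (intro exI[of _ \<phi>] exI[of _ p] allI assms)

lemma dpredE:
  assumes "dpred P"
  obtains \<phi> p where "\<forall>e. P e \<longleftrightarrow> sat UNIV (\<epsilon>) \<phi> (\<lambda>n. if even n then e (n div 2) else p (n div 2))"
proof -
  from assms[unfolded dpred_def] obtain \<phi> p where
    "\<forall>e. P e \<longleftrightarrow> sat UNIV (\<epsilon>) \<phi> (\<lambda>n. if even n then e (n div 2) else p (n div 2))"
    by (elim exE)
  then show ?thesis by (intro that[of \<phi> p]) simp
qed

lemma dpredI_rename:
  assumes "\<And>e. P e \<longleftrightarrow> sat UNIV (\<epsilon>) \<phi> (\<lambda>n. if even (f n) then e (f n div 2) else p (f n div 2))"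
  shows "dpred P"
proof -
  obtain \<psi> where "\<forall>(M :: 'v set) E e. sat M E \<psi> e \<longleftrightarrow> sat M E \<phi> (\<lambda>n. e (f n))"
    by (rule sat_renameE)
  then show ?thesis using assms by (intro dpredI[of _ \<psi> p]) simp
qed

lemma dpred_rename:
  assumes "dpred P" shows "dpred (\<lambda>e. P (\<lambda>n. e (f n)))"
proof -
  obtain \<phi> p where *: "\<forall>e. P e \<longleftrightarrow> sat UNIV (\<epsilon>) \<phi> (\<lambda>n. if even n then e (n div 2) else p (n div 2))"
    by (rule dpredE[OF assms])
  show ?thesis
    by (rule dpredI_rename[where f = "\<lambda>n. if even n then 2 * f (n div 2) else n" and \<phi> = \<phi> and p = p],
        unfold *[rule_format], rule arg_cong[where f = "sat UNIV (\<epsilon>) \<phi>"], auto)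
qed

lemma dpred_mem0: "dpred (\<lambda>e. e m \<epsilon> e n)"
  by (rule dpredI_rename[where \<phi> = "Mem 0 1" and f = "\<lambda>k. if k = 0 then 2 * m else 2 * n"]) simp

lemma dpred_eq0: "dpred (\<lambda>e. e m = e n)"
  by (rule dpredI_rename[where \<phi> = "Eq 0 1" and f = "\<lambda>k. if k = 0 then 2 * m else 2 * n"]) simp

lemma dpred_not: assumes "dpred P" shows "dpred (\<lambda>e. \<not> P e)"
  by (rule dpredE[OF assms], rule dpredI[where \<phi> = "Neg _"]) simp

lemma dpred_conj:
  assumes "dpred P" "dpred Q" shows "dpred (\<lambda>e. P e \<and> Q e)"
proof -
  obtain \<phi> p where P: "\<forall>e. P e \<longleftrightarrow> sat UNIV (\<epsilon>) \<phi> (\<lambda>n. if even n then e (n div 2) else p (n div 2))"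
    by (rule dpredE[OF assms(1)])
  obtain \<psi> q where Q: "\<forall>e. Q e \<longleftrightarrow> sat UNIV (\<epsilon>) \<psi> (\<lambda>n. if even n then e (n div 2) else q (n div 2))"
    by (rule dpredE[OF assms(2)])
  \<comment> \<open>The parameters of both predicates are packed into one sequence, those of
    \<open>P\<close> at even and those of \<open>Q\<close> at odd positions; the two renamings below
    read them back.\<close>
  define r where "r n = (if even n then p (n div 2) else q (n div 2))" for n
  obtain \<phi>' where \<phi>': "\<forall>(M :: 'v set) E e. sat M E \<phi>' e \<longleftrightarrow>
      sat M E \<phi> (\<lambda>n. e (if even n then n else 2 * (2 * (n div 2)) + 1))"
    by (rule sat_renameE)
  obtain \<psi>' where \<psi>': "\<forall>(M :: 'v set) E e. sat M E \<psi>' e \<longleftrightarrow>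
      sat M E \<psi> (\<lambda>n. e (if even n then n else 2 * (2 * (n div 2) + 1) + 1))"
    by (rule sat_renameE)
  have "(P e \<and> Q e) \<longleftrightarrow> sat UNIV (\<epsilon>) (And \<phi>' \<psi>') (\<lambda>n. if even n then e (n div 2) else r (n div 2))" for e
  proof -
    have "sat UNIV (\<epsilon>) \<phi>' (\<lambda>n. if even n then e (n div 2) else r (n div 2)) \<longleftrightarrow> P e"
      unfolding \<phi>'[rule_format] P[rule_format]
      by (rule arg_cong[where f = "sat UNIV (\<epsilon>) \<phi>"]) (auto simp: r_def fun_eq_iff elim!: oddE)
    moreover have "sat UNIV (\<epsilon>) \<psi>' (\<lambda>n. if even n then e (n div 2) else r (n div 2)) \<longleftrightarrow> Q e"
      unfolding \<psi>'[rule_format] Q[rule_format]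
      by (rule arg_cong[where f = "sat UNIV (\<epsilon>) \<psi>"]) (auto simp: r_def fun_eq_iff elim!: oddE)
    ultimately show ?thesis by simp
  qed
  then show ?thesis by (rule dpredI)
qed

lemma dpred_ex:
  assumes "dpred (\<lambda>e. Q (\<lambda>n. e (Suc n)) (e 0))" shows "dpred (\<lambda>e. \<exists>x. Q e x)"
proof -
  obtain \<phi> p where Q: "\<forall>e. Q (\<lambda>n. e (Suc n)) (e 0) \<longleftrightarrow>
      sat UNIV (\<epsilon>) \<phi> (\<lambda>n. if even n then e (n div 2) else p (n div 2))"
    by (rule dpredE[OF assms])
  \<comment> \<open>After the bound variable is put in front, argument \<open>k + 1\<close> of the
    body (slot \<open>2k + 2\<close>) is found at slot \<open>2k + 1\<close>, and the parameter in
    slot \<open>2k + 1\<close> at slot \<open>2k + 2\<close>.\<close>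
  define f :: "nat \<Rightarrow> nat" where "f n = (if n = 0 then 0 else if even n then n - 1 else Suc n)" for n
  obtain \<psi> where \<psi>: "\<forall>(M :: 'v set) E e. sat M E \<psi> e \<longleftrightarrow> sat M E \<phi> (\<lambda>n. e (f n))"
    by (rule sat_renameE)
  obtain \<chi> where \<chi>: "\<forall>(M :: 'v set) E e. sat M E \<chi> e \<longleftrightarrow> (\<exists>x\<in>M. sat M E \<psi> (case_nat x e))"
    by (rule sat_Ex_shiftE)
  have "Q e x \<longleftrightarrow> sat UNIV (\<epsilon>) \<psi> (case_nat x (\<lambda>n. if even n then e (n div 2) else p (n div 2)))" for e x
  proof -
    have "Q e x \<longleftrightarrow> sat UNIV (\<epsilon>) \<phi> (\<lambda>n. if even n then (case_nat x e) (n div 2) else p (n div 2))"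
      using Q[rule_format, of "case_nat x e"] by simp
    also have "(\<lambda>n. if even n then (case_nat x e) (n div 2) else p (n div 2)) =
        (\<lambda>n. case_nat x (\<lambda>n. if even n then e (n div 2) else p (n div 2)) (f n))"
    proof
      fix n show "(if even n then (case_nat x e) (n div 2) else p (n div 2)) =
        case_nat x (\<lambda>n. if even n then e (n div 2) else p (n div 2)) (f n)"
      proof (cases "even n \<and> n \<noteq> 0")
        case True
        then obtain k where "n = 2 * k" "k \<noteq> 0" by auto
        then obtain j where "n = Suc (Suc (2 * j))" by (cases k) auto
        then show ?thesis by (simp add: f_def)
      qed (auto simp: f_def)
    qed
    finally show ?thesis using \<psi> by simp
  qed
  then have "(\<exists>x. Q e x) \<longleftrightarrow> sat UNIV (\<epsilon>) \<chi> (\<lambda>n. if even n then e (n div 2) else p (n div 2))" for e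
    by (simp add: \<chi>)
  then show ?thesis by (rule dpredI)
qed

lemma dpred_disj: assumes "dpred Q" "dpred R" shows "dpred (\<lambda>e. Q e \<or> R e)"
  using dpred_not[OF dpred_conj[OF dpred_not[OF assms(1)] dpred_not[OF assms(2)]]]
  by (simp only: de_Morgan_conj not_not)

lemma dpred_imp: assumes "dpred Q" "dpred R" shows "dpred (\<lambda>e. Q e \<longrightarrow> R e)"
  using dpred_disj[OF dpred_not[OF assms(1)] assms(2)] by (simp only: imp_conv_disj)

lemma dpred_iff: assumes "dpred Q" "dpred R" shows "dpred (\<lambda>e. Q e \<longleftrightarrow> R e)"
  using dpred_conj[OF dpred_imp[OF assms] dpred_imp[OF assms(2,1)]] by (simp only: iff_conv_conj_imp)

lemma dpred_all:
  assumes "dpred (\<lambda>e. Q (\<lambda>n. e (Suc n)) (e 0))" shows "dpred (\<lambda>e. \<forall>x. Q e x)"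
  using dpred_not[OF dpred_ex[where Q = "\<lambda>e x. \<not> Q e x", OF dpred_not[OF assms]]] by simp

lemma dterm_var: "dterm (\<lambda>e. e n)"
  unfolding dterm_def by (rule dpred_eq0)

lemma dterm_const: "dterm (\<lambda>e. c)"
  unfolding dterm_def
  by (rule dpredI_rename[where \<phi> = "Eq 0 1" and f = "\<lambda>k. if k = 0 then 1 else 0" and p = "\<lambda>_. c"]) simp

lemma dpred_const: "dpred (\<lambda>e. b)"
proof (cases b)
  case True
  have "dpred (\<lambda>e. e 0 = e 0)" by (rule dpred_eq0)
  with True show ?thesis by simp
next
  case False
  have "dpred (\<lambda>e. \<not> e 0 = e 0)" by (rule dpred_not[OF dpred_eq0])
  with False show ?thesis by simp
qed

lemma dterm_shift: "dterm t \<Longrightarrow> dterm (\<lambda>e. t (\<lambda>n. e (f n)))"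
  unfolding dterm_def
  by (drule dpred_rename[where f = "case_nat 0 (\<lambda>n. Suc (f n))"]) simp

lemma dpred_subst:
  assumes "dpred (\<lambda>e. Q (\<lambda>n. e (Suc n)) (e 0))" "dterm t"
  shows "dpred (\<lambda>e. Q e (t e))"
proof -
  have "dpred (\<lambda>e. \<exists>y. t e = y \<and> Q e y)"
    by (intro dpred_ex dpred_conj assms(1)) (use assms(2) in \<open>simp add: dterm_def\<close>)
  then show ?thesis by simp
qed

lemma dpred_mem:
  assumes "dterm t" "dterm s" shows "dpred (\<lambda>e. t e \<epsilon> s e)"
proof -
  have "dpred (\<lambda>e. e 0 \<epsilon> s (\<lambda>n. e (Suc n)))"
    by (rule dpred_subst[where Q = "\<lambda>e y. e 0 \<epsilon> y"]) (rule dpred_mem0, rule dterm_shift[OF assms(2)])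
  from dpred_subst[where Q = "\<lambda>e x. x \<epsilon> s e", OF this assms(1)] show ?thesis .
qed

lemma dpred_eq:
  assumes "dterm t" "dterm s" shows "dpred (\<lambda>e. t e = s e)"
proof -
  have "dpred (\<lambda>e. e 0 = s (\<lambda>n. e (Suc n)))"
    by (rule dpred_subst[where Q = "\<lambda>e y. e 0 = y"]) (rule dpred_eq0, rule dterm_shift[OF assms(2)])
  from dpred_subst[where Q = "\<lambda>e x. x = s e", OF this assms(1)] show ?thesis .
qed

lemma dterm_the:
  assumes "dpred (\<lambda>e. P (\<lambda>n. e (Suc n)) (e 0))" shows "dterm (\<lambda>e. the_or_junk (P e))"
proof -
  \<comment> \<open>The graph must also describe the default case; this is a formula because
    \<open>undefined\<close> is one fixed parameter.\<close>
  have 1: "the_or_junk (P e) = z \<longleftrightarrow> (P e z \<and> (\<forall>y. P e y \<longrightarrow> y = z)) \<or>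
      (\<not> (\<exists>y. P e y \<and> (\<forall>x. P e x \<longrightarrow> x = y)) \<and> z = undefined)" for e z
  proof (cases "\<exists>!y. P e y")
    case True
    then obtain y where y: "P e y" "\<And>x. P e x \<Longrightarrow> x = y" by blast
    then have "the_or_junk (P e) = y" using the_or_junk_eq[of "P e" y] by blast
    with y show ?thesis by metis
  next
    case False
    then have "the_or_junk (P e) = undefined" by (simp add: the_or_junk_def)
    with False show ?thesis by metis
  qed
  have 2: "dpred (\<lambda>e. P (\<lambda>n. e (Suc (f n))) (e k))" for f k
    using dpred_rename[OF assms, of "case_nat k (\<lambda>n. Suc (f n))"] by simp
  show ?thesis unfolding dterm_def 1
    by (intro dpred_conj dpred_disj dpred_not dpred_all dpred_ex dpred_imp dpred_eq dterm_var
        dterm_const 2)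
qed

definition dfun :: "('v \<Rightarrow> 'v) \<Rightarrow> bool" where "dfun F \<longleftrightarrow> dterm (\<lambda>e. F (e 0))"
definition dcls :: "('v \<Rightarrow> bool) \<Rightarrow> bool" where "dcls P \<longleftrightarrow> dpred (\<lambda>e. P (e 0))"
definition drel :: "('v \<Rightarrow> 'v \<Rightarrow> bool) \<Rightarrow> bool" where "drel R \<longleftrightarrow> dpred (\<lambda>e. R (e 0) (e 1))"

lemma dpred_cls: assumes "dcls P" "dterm t" shows "dpred (\<lambda>e. P (t e))"
  using assms(1)[unfolded dcls_def] assms(2) by (rule dpred_subst)

lemma dpred_rel: assumes "drel R" "dterm t" "dterm s" shows "dpred (\<lambda>e. R (t e) (s e))"
proof -
  have "dpred (\<lambda>e. R (t (\<lambda>n. e (Suc n))) (e 0))"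
    by (rule dpred_subst[where Q = "\<lambda>e x. R x (e 0)"])
       (use dpred_rename[OF assms(1)[unfolded drel_def], of "case_nat 0 (\<lambda>_. 1)"] in simp,
         rule dterm_shift[OF assms(2)])
  then show ?thesis using assms(3) by (rule dpred_subst[where Q = "\<lambda>e y. R (t e) y"])
qed

lemma dterm_fun: assumes "dfun F" "dterm t" shows "dterm (\<lambda>e. F (t e))"
proof -
  have "drel (\<lambda>x y. F x = y)"
    using dpred_rename[OF assms(1)[unfolded dfun_def dterm_def], of "case_nat 1 (\<lambda>_. 0)"]
    unfolding drel_def by simp
  then show ?thesis unfolding dterm_def
    by (rule dpred_rel) (rule dterm_shift[OF assms(2)], rule dterm_var)
qed

section \<open>Sets of the model, and the axioms in class form\<close>

definition small :: "'v set \<Rightarrow> bool" where "small S \<longleftrightarrow> (\<exists>a. \<forall>x. x \<epsilon> a \<longleftrightarrow> x \<in> S)"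
text \<open>
  Junk values must be one fixed element to be definable; \<open>THE\<close> on a non-unique predicate
  would depend on the predicate.
\<close>

definition mk :: "'v set \<Rightarrow> 'v" where "mk S = the_or_junk (\<lambda>a. \<forall>x. x \<epsilon> a \<longleftrightarrow> x \<in> S)"

lemma dterm_mk:
  assumes "dpred (\<lambda>e. P (\<lambda>n. e (Suc n)) (e 0))"
  shows "dterm (\<lambda>e. mk {x. P e x})"
proof -
  have 2: "dpred (\<lambda>e. P (\<lambda>n. e (Suc (f n))) (e k))" for f k
    using dpred_rename[OF assms, of "case_nat k (\<lambda>n. Suc (f n))"] by simp
  show ?thesis unfolding mk_def mem_Collect_eq
    by (intro dterm_the dpred_all dpred_iff dpred_mem dterm_var 2)
qed

lemmas d_intros = dpred_const dterm_const dterm_var dpred_mem dpred_eq dpred_not dpred_conj dpred_disj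
  dpred_imp dpred_iff dpred_ex dpred_all dterm_mk

lemma ext: "(\<And>x. x \<epsilon> a \<longleftrightarrow> x \<epsilon> b) \<Longrightarrow> a = b"
  using zfc[unfolded ZFC_def, THEN conjunct1] by simp

lemma foundation: "x \<epsilon> a \<Longrightarrow> \<exists>x. x \<epsilon> a \<and> (\<forall>y. y \<epsilon> x \<longrightarrow> \<not> y \<epsilon> a)"
  using zfc[unfolded ZFC_def, THEN conjunct2, THEN conjunct1] unfolding is_empty_def by simp metis

lemma mem_mk: assumes "small S" shows "x \<epsilon> mk S \<longleftrightarrow> x \<in> S"
proof -
  obtain a where a: "\<forall>x. x \<epsilon> a \<longleftrightarrow> x \<in> S" using assms small_def by auto
  have "mk S = a" unfolding mk_def
    by (rule the_or_junk_eq) (simp add: a, rule ext, simp add: a)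
  with a show ?thesis by simp
qed

lemma mk_eqI: "(\<And>x. x \<epsilon> a \<longleftrightarrow> x \<in> S) \<Longrightarrow> mk S = a"
  by (rule ext) (metis mem_mk small_def)

lemma sep: assumes "dcls P" shows "\<exists>b. \<forall>x. x \<epsilon> b \<longleftrightarrow> x \<epsilon> a \<and> P x"
proof -
  obtain \<phi> p where P: "\<forall>e. P (e 0) \<longleftrightarrow> sat UNIV (\<epsilon>) \<phi> (\<lambda>n. if even n then e (n div 2) else p (n div 2))"
    by (rule dpredE[OF assms[unfolded dcls_def]])
  let ?e = "\<lambda>n. if even n then a else p (n div 2)"
  have sep: "\<forall>\<phi> e. \<forall>a. \<exists>b. \<forall>x. x \<epsilon> b \<longleftrightarrow> x \<epsilon> a \<and> sat UNIV (\<epsilon>) \<phi> (e(0 := x))"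
    using zfc[unfolded ZFC_def, THEN conjunct2, THEN conjunct2, THEN conjunct2, THEN conjunct2, THEN conjunct2, THEN conjunct2, THEN conjunct1] by simp
  have *: "P x \<longleftrightarrow> sat UNIV (\<epsilon>) \<phi> (?e(0 := x))" for x
  proof -
    have "(\<lambda>n. if even n then ((\<lambda>_. a)(0 := x)) (n div 2) else p (n div 2)) = ?e(0 := x)"
      by (auto simp: fun_eq_iff elim!: evenE)
    then show ?thesis using P[rule_format, of "(\<lambda>_. a)(0 := x)"] by simp
  qed
  show ?thesis using sep[rule_format, of a \<phi> ?e] by (simp only: *)
qed

lemma small_sub: assumes "dcls P" "\<And>x. P x \<Longrightarrow> x \<epsilon> a" shows "small {x. P x}"
  using sep[OF assms(1), of a] assms(2) unfolding small_def by auto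

lemma small_subset: assumes "small S" "dcls (\<lambda>x. x \<in> T)" "T \<subseteq> S" shows "small T"
  using small_sub[of "\<lambda>x. x \<in> T" "mk S"] assms mem_mk by auto

lemma repl: assumes "dfun F" shows "\<exists>b. \<forall>y. y \<epsilon> b \<longleftrightarrow> (\<exists>x. x \<epsilon> a \<and> y = F x)"
proof -
  obtain \<phi> p where P: "\<forall>e. F (e (Suc 0)) = e 0 \<longleftrightarrow> sat UNIV (\<epsilon>) \<phi> (\<lambda>n. if even n then e (n div 2) else p (n div 2))"
    by (rule dpredE[OF assms[unfolded dfun_def dterm_def]])
  \<comment> \<open>In the interleaved convention the value sits in slot 0, the argument in slot 2
    and the parameters at odd slots. The axiom expects the argument in 0 and the value in 1, hence
    the renaming and the shifted parameters.\<close>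
  obtain \<psi> where \<psi>: "\<forall>(M :: 'v set) E e. sat M E \<psi> e \<longleftrightarrow>
      sat M E \<phi> (\<lambda>n. e (if n = 0 then 1 else if n = 2 then 0 else n + 1))"
    by (rule sat_renameE)
  let ?e = "\<lambda>n::nat. if odd n then a else p ((n - 1) div 2)"
  have repl: "\<forall>\<phi> e. \<forall>a. (\<forall>x. x \<epsilon> a \<longrightarrow> (\<exists>!y. sat UNIV (\<epsilon>) \<phi> (e(0 := x, 1 := y)))) \<longrightarrow>
          (\<exists>b. \<forall>y. y \<epsilon> b \<longleftrightarrow> (\<exists>x. x \<epsilon> a \<and> sat UNIV (\<epsilon>) \<phi> (e(0 := x, 1 := y))))"
    using zfc[unfolded ZFC_def, THEN conjunct2, THEN conjunct2, THEN conjunct2, THEN conjunct2, THEN conjunct2, THEN conjunct2, THEN conjunct2, THEN conjunct1] by simp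
  have *: "sat UNIV (\<epsilon>) \<psi> (?e(0 := x, 1 := y)) \<longleftrightarrow> y = F x" for x y
  proof -
    have "(\<lambda>n. if even n then (case_nat y (case_nat x (\<lambda>_. a))) (n div 2) else p (n div 2)) =
       (\<lambda>n. (?e(0 := x, 1 := y)) (if n = 0 then 1 else if n = 2 then 0 else n + 1))"
    proof
      fix n
      consider "n = 0" | "n = 2" | "odd n" | k where "n = 2 * Suc (Suc k)"
        by (metis even_Suc nat_mult_div_cancel_disj not0_implies_Suc dvd_def mult_0_right mult.right_neutral One_nat_def)
      then show "(if even n then (case_nat y (case_nat x (\<lambda>_. a))) (n div 2) else p (n div 2)) =
       (?e(0 := x, 1 := y)) (if n = 0 then 1 else if n = 2 then 0 else n + 1)"
        by cases (auto simp: split: nat.split)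
    qed
    then show ?thesis using P[rule_format, of "case_nat y (case_nat x (\<lambda>_. a))"] \<psi> by auto
  qed
  show ?thesis using repl[rule_format, of a \<psi> ?e] by (simp only: *) simp
qed

lemma small_repl: assumes "dfun F" shows "small {y. \<exists>x. x \<epsilon> a \<and> y = F x}"
  using repl[OF assms] unfolding small_def by auto

lemma small_UN: assumes "dfun F" shows "small {z. \<exists>x. x \<epsilon> a \<and> z \<epsilon> F x}"
proof -
  obtain b where b: "\<forall>y. y \<epsilon> b \<longleftrightarrow> (\<exists>x. x \<epsilon> a \<and> y = F x)" using repl[OF assms] by blast
  have "\<exists>c. \<forall>x. x \<epsilon> c \<longleftrightarrow> (\<exists>y. x \<epsilon> y \<and> y \<epsilon> b)"
    using zfc[unfolded ZFC_def, THEN conjunct2, THEN conjunct2, THEN conjunct2, THEN conjunct1] by simp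
  then obtain c where "\<forall>x. x \<epsilon> c \<longleftrightarrow> (\<exists>y. x \<epsilon> y \<and> y \<epsilon> b)" ..
  with b show ?thesis unfolding small_def by (intro exI[of _ c]) auto
qed

lemma small_Union: "small {z. \<exists>x. x \<epsilon> a \<and> z \<epsilon> x}"
  by (rule small_UN) (unfold dfun_def, intro d_intros)

lemma small_Pow: "small {z. \<forall>x. x \<epsilon> z \<longrightarrow> x \<epsilon> a}"
  using zfc[unfolded ZFC_def, THEN conjunct2, THEN conjunct2, THEN conjunct2, THEN conjunct2, THEN conjunct1]
  unfolding small_def is_subset_def by simp

lemma small_pair: "small {z. z = x \<or> z = y}"
  using zfc[unfolded ZFC_def, THEN conjunct2, THEN conjunct2, THEN conjunct1]
  unfolding small_def by simp

lemma small_sing: "small {z. z = x}"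
  using small_pair[of x x] by simp

lemma small_Un: "small {z. z \<epsilon> a \<or> z \<epsilon> b}"
proof -
  have "{z. z \<epsilon> a \<or> z \<epsilon> b} = {z. \<exists>x. x \<epsilon> mk {z. z = a \<or> z = b} \<and> z \<epsilon> x}"
    using mem_mk[OF small_pair] by auto
  then show ?thesis using small_Union by simp
qed

lemma small_empty: "small {}"
  using small_sub[of "\<lambda>x. False"] by (simp add: dcls_def dpred_const)

definition zero :: 'v where "zero = mk {}"
lemma not_mem_zero [simp]: "\<not> x \<epsilon> zero" using mem_mk[OF small_empty] zero_def by simp

lemma eq_zero_iff: "a = zero \<longleftrightarrow> (\<forall>x. \<not> x \<epsilon> a)"
  using ext[of a zero] by auto

subsection \<open>Ordered pairs and functions\<close>

definition opr :: "'v \<Rightarrow> 'v \<Rightarrow> 'v" where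
  "opr x y = mk {z. z = mk {z. z = x} \<or> z = mk {z. z = x \<or> z = y}}"

lemma dterm_opr: "dterm t \<Longrightarrow> dterm s \<Longrightarrow> dterm (\<lambda>e. opr (t e) (s e))"
  unfolding opr_def by (intro d_intros; rule dterm_shift; rule dterm_shift | intro d_intros; rule dterm_shift)

lemma dterm_fun2:
  assumes "dterm (\<lambda>e. F (e 0) (e 1))" "dterm t" "dterm s" shows "dterm (\<lambda>e. F (t e) (s e))"
proof -
  have 0: "dpred (\<lambda>e. F (e a) (e b) = e c)" for a b c
    using dpred_rename[OF assms(1)[unfolded dterm_def], of "case_nat c (case_nat a (\<lambda>_. b))"]
    by simp
  have 1: "dpred (\<lambda>e. F (e a) (s (\<lambda>n. e (f n))) = e c)" for a c f
    by (rule dpred_subst[where Q = "\<lambda>e x. F (e a) x = e c"]) (rule 0, rule dterm_shift[OF assms(3)])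
  show ?thesis unfolding dterm_def
    by (rule dpred_subst[where Q = "\<lambda>e x. F x (s (\<lambda>n. e (Suc n))) = e 0"])
       (rule 1, rule dterm_shift[OF assms(2)])
qed

lemma mem_opr: "z \<epsilon> opr x y \<longleftrightarrow> z = mk {z. z = x} \<or> z = mk {z. z = x \<or> z = y}"
  unfolding opr_def by (simp add: mem_mk[OF small_pair])

lemma mem_sing [simp]: "z \<epsilon> mk {z. z = x} \<longleftrightarrow> z = x"
  using mem_mk[OF small_sing] by simp

lemma mem_sing' [simp]: "z \<epsilon> mk {x} \<longleftrightarrow> z = x"
  using mem_sing by simp

lemma mem_upair [simp]: "z \<epsilon> mk {z. z = x \<or> z = y} \<longleftrightarrow> z = x \<or> z = y"
  using mem_mk[OF small_pair] by simp

lemma opr_inj [simp]: "opr x y = opr x' y' \<longleftrightarrow> x = x' \<and> y = y'"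
proof
  assume eq: "opr x y = opr x' y'"
  have 1: "z \<epsilon> opr a b \<Longrightarrow> w \<epsilon> z \<Longrightarrow> w = a \<or> w = b" for z w a b by (auto simp: mem_opr)
  have 2: "(\<forall>z. z \<epsilon> opr a b \<longrightarrow> w \<epsilon> z) \<longleftrightarrow> w = a" for a b w by (auto simp: mem_opr)
  have x: "x = x'" using 2[of x y x] 2[of x' y' x] eq by simp
  have 3: "(\<exists>z. z \<epsilon> opr a b \<and> w \<epsilon> z) \<longleftrightarrow> w = a \<or> w = b" for a b w by (auto simp: mem_opr)
  have "w = x \<or> w = y \<longleftrightarrow> w = x \<or> w = y'" for w using 3[of x y w] 3[of x' y' w] eq x by simp
  with x show "x = x' \<and> y = y'" by metis
qed simp

lemma is_opair_iff: "is_opair UNIV (\<epsilon>) x y p \<longleftrightarrow> p = opr x y"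
proof -
  have u: "is_upair UNIV (\<epsilon>) a b c \<longleftrightarrow> c = mk {z. z = a \<or> z = b}" for a b c
    unfolding is_upair_def by (auto intro: ext)
  show ?thesis unfolding is_opair_def u opr_def by simp
qed

lemma maps_to_iff: "maps_to UNIV (\<epsilon>) f x y \<longleftrightarrow> opr x y \<epsilon> f"
  unfolding maps_to_def is_opair_iff by simp

abbreviation fn :: "'v \<Rightarrow> 'v \<Rightarrow> bool" where "fn \<equiv> is_fun_on UNIV (\<epsilon>)"

lemma fn_iff: "fn X f \<longleftrightarrow> (\<forall>p. p \<epsilon> f \<longrightarrow> (\<exists>x y. x \<epsilon> X \<and> p = opr x y)) \<and>
    (\<forall>x. x \<epsilon> X \<longrightarrow> (\<exists>y. opr x y \<epsilon> f \<and> (\<forall>z. opr x z \<epsilon> f \<longrightarrow> z = y)))"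
  unfolding is_fun_on_def is_opair_iff maps_to_iff Ex1_def by simp

definition app :: "'v \<Rightarrow> 'v \<Rightarrow> 'v" where "app f x = the_or_junk (\<lambda>y. opr x y \<epsilon> f)"

lemma opr_mem_fn: assumes "fn X f" "x \<epsilon> X" shows "opr x y \<epsilon> f \<longleftrightarrow> y = app f x"
proof -
  obtain z where z: "opr x z \<epsilon> f" "\<And>y. opr x y \<epsilon> f \<Longrightarrow> y = z" using assms unfolding fn_iff by metis
  then have "app f x = z" unfolding app_def by (rule the_or_junk_eq[where P = "\<lambda>y. opr x y \<epsilon> f"])
  with z show ?thesis by metis
qed

lemma fn_pair: assumes "fn X f" "p \<epsilon> f" obtains x y where "x \<epsilon> X" "p = opr x y"
  using assms(1)[unfolded fn_iff, THEN conjunct1, rule_format, OF assms(2)]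
  by (elim exE conjE) (rule that)

lemma fn_dom: assumes "fn X f" "opr x y \<epsilon> f" shows "x \<epsilon> X"
  by (rule fn_pair[OF assms]) simp

lemma mem_fn_iff: assumes "fn X f" shows "p \<epsilon> f \<longleftrightarrow> (\<exists>x. x \<epsilon> X \<and> p = opr x (app f x))"
proof
  assume p: "p \<epsilon> f"
  then obtain x y where xy: "x \<epsilon> X" "p = opr x y" using fn_pair[OF assms] by metis
  with p opr_mem_fn[OF assms] show "\<exists>x. x \<epsilon> X \<and> p = opr x (app f x)" by auto
next
  assume "\<exists>x. x \<epsilon> X \<and> p = opr x (app f x)"
  with opr_mem_fn[OF assms] show "p \<epsilon> f" by auto
qed

lemma fn_ext: assumes "fn X f" "fn X g" "\<And>x. x \<epsilon> X \<Longrightarrow> app f x = app g x" shows "f = g"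
  by (rule ext) (use assms(3) in \<open>auto simp: mem_fn_iff[OF assms(1)] mem_fn_iff[OF assms(2)]\<close>)

definition lam :: "'v \<Rightarrow> ('v \<Rightarrow> 'v) \<Rightarrow> 'v" where
  "lam X F = mk {p. \<exists>x. x \<epsilon> X \<and> p = opr x (F x)}"

lemma drel_fn: "drel fn"
  unfolding drel_def fn_iff by (intro d_intros dterm_opr)

lemma dterm_app0: "dterm (\<lambda>e. app (e 0) (e 1))"
  unfolding app_def by (intro d_intros dterm_the dterm_opr)

lemmas dterm_app = dterm_fun2[OF dterm_app0]
lemmas dpred_fn = dpred_rel[OF drel_fn]
lemmas d_rules = d_intros dterm_opr dterm_app dpred_fn

lemma dfun_opr: "dfun F \<Longrightarrow> dfun (\<lambda>x. opr x (F x))"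
  unfolding dfun_def by (intro d_rules)

lemma mem_lam: "dfun F \<Longrightarrow> p \<epsilon> lam X F \<longleftrightarrow> (\<exists>x. x \<epsilon> X \<and> p = opr x (F x))"
  unfolding lam_def using mem_mk[OF small_repl[OF dfun_opr]] by simp

lemma fn_lam: "dfun F \<Longrightarrow> fn X (lam X F)"
  unfolding fn_iff by (auto simp: mem_lam)

lemma app_lam: assumes "dfun F" "x \<epsilon> X" shows "app (lam X F) x = F x"
  using opr_mem_fn[OF fn_lam[OF assms(1)] assms(2), of "F x"] assms by (simp add: mem_lam)

lemma small_prod: "small {p. \<exists>x y. x \<epsilon> X \<and> y \<epsilon> Y \<and> p = opr x y}"
proof -
  have 1: "dfun (\<lambda>x. opr a x)" for a unfolding dfun_def by (intro d_rules)
  have 2: "dfun (\<lambda>x. mk {p. \<exists>y. y \<epsilon> Y \<and> p = opr x y})" unfolding dfun_def by (intro d_rules)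
  show ?thesis using small_UN[OF 2, of X] by (simp add: mem_mk[OF small_repl[OF 1]] conj_ac ex_simps[symmetric] del: ex_simps)
qed

lemma small_fns: "small {f. fn X f \<and> (\<forall>x. x \<epsilon> X \<longrightarrow> app f x \<epsilon> T)}"
proof (rule small_sub)
  show "dcls (\<lambda>f. fn X f \<and> (\<forall>x. x \<epsilon> X \<longrightarrow> app f x \<epsilon> T))" unfolding dcls_def by (intro d_rules)
  fix f assume f: "fn X f \<and> (\<forall>x. x \<epsilon> X \<longrightarrow> app f x \<epsilon> T)"
  have "p \<epsilon> mk {p. \<exists>x y. x \<epsilon> X \<and> y \<epsilon> T \<and> p = opr x y}" if p: "p \<epsilon> f" for p
  proof -
    obtain x where "x \<epsilon> X" "p = opr x (app f x)" using f p mem_fn_iff[of X f p] by auto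
    then show ?thesis unfolding mem_mk[OF small_prod] using f by auto
  qed
  then show "f \<epsilon> mk {z. \<forall>x. x \<epsilon> z \<longrightarrow> x \<epsilon> mk {p. \<exists>x y. x \<epsilon> X \<and> y \<epsilon> T \<and> p = opr x y}}"
    unfolding mem_mk[OF small_Pow] by simp
qed

subsection \<open>The natural numbers\<close>

definition suc :: "'v \<Rightarrow> 'v" where "suc x = mk {z. z \<epsilon> x \<or> z = x}"

lemma mem_suc [simp]: "z \<epsilon> suc x \<longleftrightarrow> z \<epsilon> x \<or> z = x"
proof -
  have "small {z. z \<epsilon> x \<or> z = x}" using small_Un[of x "mk {z. z = x}"] by simp
  from mem_mk[OF this] show ?thesis unfolding suc_def by simp
qed

lemma dfun_suc: "dfun suc"
  unfolding dfun_def suc_def by (intro d_rules)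

lemma not_mem_cycle: "x \<epsilon> y \<Longrightarrow> \<not> y \<epsilon> x"
  using foundation[of x "mk {z. z = x \<or> z = y}"] by auto

lemma suc_inj: "suc x = suc y \<Longrightarrow> x = y"
  by (metis mem_suc not_mem_cycle)

lemma is_succ_iff: "is_succ UNIV (\<epsilon>) x y \<longleftrightarrow> y = suc x"
  unfolding is_succ_def by (auto intro: ext)

lemma is_empty_iff: "is_empty UNIV (\<epsilon>) x \<longleftrightarrow> x = zero"
  unfolding is_empty_def by (simp add: eq_zero_iff)

definition ind :: "'v \<Rightarrow> bool" where "ind a \<longleftrightarrow> zero \<epsilon> a \<and> (\<forall>x. x \<epsilon> a \<longrightarrow> suc x \<epsilon> a)"

lemma is_inductive_iff: "is_inductive UNIV (\<epsilon>) a \<longleftrightarrow> ind a"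
  unfolding is_inductive_def ind_def is_succ_iff is_empty_iff by simp

lemma dcls_ind: "dcls ind"
  unfolding dcls_def ind_def by (intro d_rules dterm_fun[OF dfun_suc])

definition om :: 'v where "om = mk {n. \<forall>a. ind a \<longrightarrow> n \<epsilon> a}"

lemma mem_om: "n \<epsilon> om \<longleftrightarrow> (\<forall>a. ind a \<longrightarrow> n \<epsilon> a)"
proof -
  have "\<exists>a. ind a"
    using zfc[unfolded ZFC_def, THEN conjunct2, THEN conjunct2, THEN conjunct2, THEN conjunct2,
        THEN conjunct2, THEN conjunct1] by (simp add: is_inductive_iff)
  then obtain a where a: "ind a" ..
  have "small {n. \<forall>a. ind a \<longrightarrow> n \<epsilon> a}"
    by (rule small_sub[of _ a]) (unfold dcls_def, intro d_rules dpred_cls[OF dcls_ind], use a in blast)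
  from mem_mk[OF this] show ?thesis unfolding om_def by simp
qed

lemma ind_om: "ind om"
  by (simp add: ind_def mem_om)

lemma zero_om [simp]: "zero \<epsilon> om" and suc_om [simp]: "n \<epsilon> om \<Longrightarrow> suc n \<epsilon> om"
  using ind_om by (auto simp: ind_def)

lemma is_omega_iff: "is_omega UNIV (\<epsilon>) w \<longleftrightarrow> w = om"
proof
  assume "is_omega UNIV (\<epsilon>) w"
  then have w: "ind w" "\<And>a x. ind a \<Longrightarrow> x \<epsilon> w \<Longrightarrow> x \<epsilon> a"
    unfolding is_omega_def is_inductive_iff is_subset_def by simp_all
  show "w = om"
    by (rule ext) (meson ind_om mem_om w)
next
  assume "w = om"
  then show "is_omega UNIV (\<epsilon>) w"
    unfolding is_omega_def is_inductive_iff is_subset_def by (simp add: ind_om mem_om)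
qed

text \<open>Induction is an instance of separation on \<open>om\<close>. It covers definable
  properties, since seen from outside \<open>om\<close> may have nonstandard members.\<close>

lemma om_induct:
  assumes "dcls P" "P zero" "\<And>n. n \<epsilon> om \<Longrightarrow> P n \<Longrightarrow> P (suc n)" "n \<epsilon> om"
  shows "P n"
proof -
  obtain a where a: "\<forall>x. x \<epsilon> a \<longleftrightarrow> x \<epsilon> om \<and> P x" using sep[OF assms(1)] by blast
  then have "ind a" using assms(2,3) by (simp add: ind_def)
  with assms(4) a show ?thesis by (meson mem_om)
qed

subsection \<open>Choice\<close>

text \<open>The axiom concerns disjoint families of nonempty sets. Empty values of \<open>F\<close>
  are discarded, and the others are made disjoint by tagging each element of \<open>F x\<close> with
  \<open>x\<close>.\<close>

lemma choice:
  assumes "dfun F"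
  obtains c where "fn X c" "\<And>x. x \<epsilon> X \<Longrightarrow> \<exists>y. y \<epsilon> F x \<Longrightarrow> app c x \<epsilon> F x"
proof -
  define fam where "fam x = mk {p. \<exists>y. y \<epsilon> F x \<and> p = opr y x}" for x
  have 1: "dfun (\<lambda>y. opr y x)" for x unfolding dfun_def by (intro d_rules)
  have fam: "p \<epsilon> fam x \<longleftrightarrow> (\<exists>y. y \<epsilon> F x \<and> p = opr y x)" for p x
    unfolding fam_def by (simp add: mem_mk[OF small_repl[OF 1]])
  have dfam: "dfun fam" unfolding fam_def dfun_def by (intro d_rules dterm_fun[OF assms])
  have dX: "dcls (\<lambda>x. x \<epsilon> X \<and> (\<exists>y. y \<epsilon> F x))" unfolding dcls_def
    by (intro d_rules dterm_fun[OF assms])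
  obtain X' where X': "\<forall>x. x \<epsilon> X' \<longleftrightarrow> x \<epsilon> X \<and> (\<exists>y. y \<epsilon> F x)" using sep[OF dX, of X] by auto
  obtain A where A: "\<forall>y. y \<epsilon> A \<longleftrightarrow> (\<exists>x. x \<epsilon> X' \<and> y = fam x)" using repl[OF dfam] by blast
  have ac: "(\<forall>x. x \<epsilon> A \<longrightarrow> (\<exists>z. z \<epsilon> x)) \<and>
        (\<forall>x y. x \<epsilon> A \<and> y \<epsilon> A \<and> x \<noteq> y \<longrightarrow> \<not> (\<exists>z. z \<epsilon> x \<and> z \<epsilon> y)) \<longrightarrow>
        (\<exists>c. \<forall>x. x \<epsilon> A \<longrightarrow> (\<exists>!z. z \<epsilon> x \<and> z \<epsilon> c))"
    using zfc[unfolded ZFC_def, THEN conjunct2, THEN conjunct2, THEN conjunct2, THEN conjunct2,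
        THEN conjunct2, THEN conjunct2, THEN conjunct2, THEN conjunct2]
    by (simp only: is_empty_def ball_UNIV bex_UNIV UNIV_I simp_thms not_all not_not) (erule spec)
  have "\<exists>c. \<forall>x. x \<epsilon> A \<longrightarrow> (\<exists>!z. z \<epsilon> x \<and> z \<epsilon> c)"
    by (rule ac[THEN mp]) (use A X' fam in fastforce)
  then obtain c where c: "\<And>x. x \<epsilon> A \<Longrightarrow> \<exists>!z. z \<epsilon> x \<and> z \<epsilon> c" by blast
  define G where "G x = the_or_junk (\<lambda>y. opr y x \<epsilon> c \<and> y \<epsilon> F x)" for x
  have G: "G x \<epsilon> F x" if x: "x \<epsilon> X" "\<exists>y. y \<epsilon> F x" for x
  proof -
    have "fam x \<epsilon> A" using x A X' by auto
    then obtain z where z: "z \<epsilon> fam x" "z \<epsilon> c" and u: "\<And>z'. z' \<epsilon> fam x \<Longrightarrow> z' \<epsilon> c \<Longrightarrow> z' = z"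
      using c by blast
    from z(1) obtain y where y: "y \<epsilon> F x" "z = opr y x" using fam by auto
    have "G x = y" unfolding G_def
    proof (rule the_or_junk_eq)
      show "opr y x \<epsilon> c \<and> y \<epsilon> F x" using y z by simp
      fix y' assume "opr y' x \<epsilon> c \<and> y' \<epsilon> F x"
      then have "opr y' x = z" using u[of "opr y' x"] fam[of "opr y' x" x] by blast
      then show "y' = y" using y by simp
    qed
    with y show ?thesis by simp
  qed
  have dG: "dfun G" unfolding G_def dfun_def by (intro d_rules dterm_the dterm_fun[OF assms])
  show thesis by (rule that[of "lam X G"]) (auto simp: fn_lam[OF dG] app_lam[OF dG] G)
qed

subsection \<open>Recursion along definable well-founded relations\<close>

definition closed :: "('v \<Rightarrow> 'v \<Rightarrow> bool) \<Rightarrow> 'v \<Rightarrow> bool" where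
  "closed r D \<longleftrightarrow> (\<forall>x y. x \<epsilon> D \<longrightarrow> r y x \<longrightarrow> y \<epsilon> D)"

text \<open>A set-sized approximation to the recursion, on a set closed under predecessors. The step
  function receives just the set of earlier values, which is the form in which the collapse and the
  rank hierarchy use them.\<close>

definition attempt :: "('v \<Rightarrow> 'v \<Rightarrow> bool) \<Rightarrow> ('v \<Rightarrow> 'v) \<Rightarrow> 'v \<Rightarrow> 'v \<Rightarrow> bool" where
  "attempt r F D h \<longleftrightarrow> closed r D \<and> fn D h \<and>
     (\<forall>x. x \<epsilon> D \<longrightarrow> app h x = F (mk {z. \<exists>y. r y x \<and> z = app h y}))"

definition wrec :: "('v \<Rightarrow> 'v \<Rightarrow> bool) \<Rightarrow> ('v \<Rightarrow> 'v) \<Rightarrow> 'v \<Rightarrow> 'v" where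
  "wrec r F x = the_or_junk (\<lambda>v. \<exists>D h. attempt r F D h \<and> x \<epsilon> D \<and> v = app h x)"

text \<open>Minimal elements are demanded of sets; definable classes are treated by intersecting
  them with a closed set.\<close>

definition wfr :: "('v \<Rightarrow> 'v \<Rightarrow> bool) \<Rightarrow> bool" where
  "wfr r \<longleftrightarrow> (\<forall>B x. x \<epsilon> B \<longrightarrow> (\<exists>x. x \<epsilon> B \<and> (\<forall>y. y \<epsilon> B \<longrightarrow> \<not> r y x)))"

lemma dfun_wrec: assumes r: "drel r" and F: "dfun F" shows "dfun (wrec r F)"
  unfolding dfun_def wrec_def attempt_def closed_def
  by (intro d_rules dterm_the dpred_rel[OF r] dterm_fun[OF F])

lemma attempt_agree:
  assumes r: "drel r" and wf: "wfr r" and h: "attempt r F D h" and h': "attempt r F D' h'"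
    and x: "x \<epsilon> D" "x \<epsilon> D'"
  shows "app h x = app h' x"
proof (rule ccontr)
  assume ne: "app h x \<noteq> app h' x"
  have "dcls (\<lambda>x. x \<epsilon> D' \<and> app h x \<noteq> app h' x)" unfolding dcls_def by (intro d_rules)
  from sep[OF this, of D] obtain B where
    B: "\<forall>x. x \<epsilon> B \<longleftrightarrow> x \<epsilon> D \<and> x \<epsilon> D' \<and> app h x \<noteq> app h' x" by auto
  then have "x \<epsilon> B" using x ne by blast
  then obtain m where m: "m \<epsilon> B" "\<And>y. y \<epsilon> B \<Longrightarrow> \<not> r y m" using wf unfolding wfr_def by metis
  then have mD: "m \<epsilon> D" "m \<epsilon> D'" "app h m \<noteq> app h' m" using B by auto
  have "app h y = app h' y" if "r y m" for y
    using m(2)[of y] B that h h' mD unfolding attempt_def closed_def by blast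
  then have "{z. \<exists>y. r y m \<and> z = app h y} = {z. \<exists>y. r y m \<and> z = app h' y}" by auto
  then have "app h m = app h' m" using h h' mD unfolding attempt_def by simp
  with mD show False by simp
qed

lemma wrec_attempt:
  assumes "drel r" "wfr r" "attempt r F D h" "x \<epsilon> D"
  shows "wrec r F x = app h x"
  unfolding wrec_def
proof (rule the_or_junk_eq)
  show "\<exists>D h'. attempt r F D h' \<and> x \<epsilon> D \<and> app h x = app h' x" using assms by blast
qed (use assms attempt_agree in metis)

text \<open>The equation is local: it holds wherever \<open>x\<close> lies in a set closed under
  predecessors. The points of \<open>D\<close> covered by some attempt form a closed set
  \<open>D0\<close>; an attempt could be extended to a minimal uncovered point, so no point is
  uncovered.\<close>

lemma wrec:
  assumes r: "drel r" and F: "dfun F" and wf: "wfr r" and D: "closed r D" "x \<epsilon> D"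
  shows "wrec r F x = F (mk {z. \<exists>y. r y x \<and> z = wrec r F y})"
proof -
  let ?G = "wrec r F"
  have G: "dfun ?G" by (rule dfun_wrec[OF r F])
  have "dcls (\<lambda>x. \<exists>D h. attempt r F D h \<and> x \<epsilon> D)"
    unfolding dcls_def attempt_def closed_def by (intro d_rules dpred_rel[OF r] dterm_fun[OF F])
  from sep[OF this, of D] obtain D0 where
    D0: "\<forall>x. x \<epsilon> D0 \<longleftrightarrow> x \<epsilon> D \<and> (\<exists>D h. attempt r F D h \<and> x \<epsilon> D)" by blast
  have eq: "?G z = F (mk {w. \<exists>y. r y z \<and> w = ?G y})" if h: "attempt r F D' h" "z \<epsilon> D'" for z D' h
  proof -
    have "?G y = app h y" if "y \<epsilon> D'" for y by (rule wrec_attempt[OF r wf h(1) that])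
    moreover have "y \<epsilon> D'" if "r y z" for y using h that unfolding attempt_def closed_def by blast
    ultimately have "{w. \<exists>y. r y z \<and> w = app h y} = {w. \<exists>y. r y z \<and> w = ?G y}" by auto
    then show ?thesis using h \<open>z \<epsilon> D' \<Longrightarrow> ?G z = app h z\<close> unfolding attempt_def by simp
  qed
  have clD0: "closed r D0"
    using D0 D(1) unfolding closed_def attempt_def by blast
  have "x \<epsilon> D0"
  proof (rule ccontr)
    assume nx: "\<not> x \<epsilon> D0"
    have "dcls (\<lambda>x. \<not> x \<epsilon> D0)" unfolding dcls_def by (intro d_rules)
    from sep[OF this, of D] obtain B where B: "\<forall>x. x \<epsilon> B \<longleftrightarrow> x \<epsilon> D \<and> \<not> x \<epsilon> D0" by blast
    then have "x \<epsilon> B" using D(2) nx by blast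
    then obtain m where m: "m \<epsilon> B" "\<And>y. y \<epsilon> B \<Longrightarrow> \<not> r y m" using wf unfolding wfr_def by metis
    have sub: "y \<epsilon> D0" if "r y m" for y using that m B D(1) unfolding closed_def by blast
    have nm: "\<not> m \<epsilon> D0" "m \<epsilon> D" using m(1) B by auto
    define v where "v = F (mk {w. \<exists>y. r y m \<and> w = ?G y})"
    \<comment> \<open>The case distinction is written through members, so that \<open>H\<close> is
      visibly definable and \<open>lam\<close> turns it into a set.\<close>
    define H where "H y = mk {z. (y = m \<and> z \<epsilon> v) \<or> (y \<noteq> m \<and> z \<epsilon> ?G y)}" for y
    have dH: "dfun H" unfolding H_def dfun_def by (intro d_rules dterm_fun[OF G])
    have H: "H y = (if y = m then v else ?G y)" for y
      unfolding H_def by (rule mk_eqI) simp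
    have "small {y. y \<epsilon> D0 \<or> y = m}" using small_Un[of D0 "mk {z. z = m}"] by simp
    then obtain D1 where D1: "\<forall>y. y \<epsilon> D1 \<longleftrightarrow> y \<epsilon> D0 \<or> y = m" unfolding small_def by auto
    have cl1: "closed r D1" using D1 clD0 sub unfolding closed_def by blast
    have a: "app (lam D1 H) y = (if y = m then v else ?G y)" if "y \<epsilon> D1" for y
      using app_lam[OF dH that] H by simp
    have "attempt r F D1 (lam D1 H)"
      unfolding attempt_def
    proof (intro conjI allI impI)
      fix z assume z: "z \<epsilon> D1"
      have ne: "y \<noteq> m" "y \<epsilon> D1" if "r y z" for y
        using that z sub nm clD0 D1 unfolding closed_def by blast+
      have s: "{w. \<exists>y. r y z \<and> w = app (lam D1 H) y} = {w. \<exists>y. r y z \<and> w = ?G y}"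
        using ne a by auto
      show "app (lam D1 H) z = F (mk {w. \<exists>y. r y z \<and> w = app (lam D1 H) y})"
      proof (cases "z = m")
        case True
        then show ?thesis unfolding s using a[OF z] by (simp add: v_def)
      next
        case False
        then have "z \<epsilon> D0" using z D1 by blast
        then obtain D' h where "attempt r F D' h" "z \<epsilon> D'" using D0 by blast
        from eq[OF this] show ?thesis unfolding s using a[OF z] False by simp
      qed
    qed (use cl1 fn_lam[OF dH] in auto)
    moreover have "m \<epsilon> D1" using D1 by blast
    ultimately have "m \<epsilon> D0" using D0 nm(2) by blast
    with nm show False by blast
  qed
  then obtain D' h where "attempt r F D' h" "x \<epsilon> D'" using D0 by blast
  from eq[OF this] show ?thesis .
qed

lemma small_image:
  assumes "drel r" "dfun G" "closed r D" "x \<epsilon> D"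
  shows "small {z. \<exists>y. r y x \<and> z = G y}"
proof -
  have "small {z. \<exists>y. y \<epsilon> D \<and> z = G y}" by (rule small_repl[OF assms(2)])
  moreover have "dcls (\<lambda>z. z \<in> {z. \<exists>y. r y x \<and> z = G y})"
    unfolding dcls_def mem_Collect_eq by (intro d_rules dpred_rel[OF assms(1)] dterm_fun[OF assms(2)])
  ultimately show ?thesis
    by (rule small_subset) (use assms(3,4) in \<open>auto simp: closed_def\<close>)
qed

lemma omega_rec:
  assumes F: "dfun F"
  obtains g where "fn om g" "app g zero = a" "\<And>n. n \<epsilon> om \<Longrightarrow> app g (suc n) = F (app g n)"
proof -
  define r where "r y x \<longleftrightarrow> y \<epsilon> om \<and> x = suc y" for y x
  define U where "U s = mk {z. \<exists>x. x \<epsilon> s \<and> z \<epsilon> x}" for s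
  \<comment> \<open>The recursion passes on the set of values at predecessors, which is empty at
    \<open>zero\<close> and the singleton of the previous value at a successor; \<open>U\<close>
    unwraps that singleton.\<close>
  define F' where "F' s = mk {z. (s = zero \<and> z \<epsilon> a) \<or> (s \<noteq> zero \<and> z \<epsilon> F (U s))}" for s
  have dr: "drel r" unfolding drel_def r_def by (intro d_rules dterm_fun[OF dfun_suc])
  have dU: "dfun U" unfolding dfun_def U_def by (intro d_rules)
  have dF: "dfun F'" unfolding dfun_def F'_def by (intro d_rules dterm_fun[OF F] dterm_fun[OF dU])
  have F': "F' s = (if s = zero then a else F (U s))" for s
    unfolding F'_def by (rule mk_eqI) simp
  have wf: "wfr r" unfolding wfr_def
  proof (intro allI impI)
    fix B x assume "x \<epsilon> B"
    from foundation[OF this] show "\<exists>x. x \<epsilon> B \<and> (\<forall>y. y \<epsilon> B \<longrightarrow> \<not> r y x)"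
      unfolding r_def by (metis mem_suc)
  qed
  have cl: "closed r om" unfolding closed_def r_def by simp
  let ?G = "wrec r F'"
  have G: "?G x = F' (mk {z. \<exists>y. r y x \<and> z = ?G y})" if "x \<epsilon> om" for x
    by (rule wrec[OF dr dF wf cl that])
  have dG: "dfun ?G" by (rule dfun_wrec[OF dr dF])
  have 0: "?G zero = a"
  proof -
    have "zero \<noteq> suc y" for y by (metis mem_suc not_mem_zero)
    then have "{z. \<exists>y. r y zero \<and> z = ?G y} = {}" unfolding r_def by auto
    then have "?G zero = F' zero" using G[OF zero_om] by (simp only: zero_def)
    then show ?thesis by (simp add: F')
  qed
  have S: "?G (suc n) = F (?G n)" if n: "n \<epsilon> om" for n
  proof -
    have "{z. \<exists>y. r y (suc n) \<and> z = ?G y} = {z. z = ?G n}" unfolding r_def using n suc_inj by auto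
    then have "?G (suc n) = F' (mk {z. z = ?G n})" using G[OF suc_om[OF n]] by simp
    moreover have "mk {z. z = ?G n} \<noteq> zero" by (metis mem_sing not_mem_zero)
    moreover have "U (mk {z. z = ?G n}) = ?G n" unfolding U_def by (rule mk_eqI) simp
    ultimately show ?thesis by (simp add: F')
  qed
  show thesis
    by (rule that[of "lam om ?G"]) (simp_all add: fn_lam[OF dG] app_lam[OF dG] 0 S)
qed

subsection \<open>Transitive closures and \<open>\<epsilon>\<close>-induction\<close>

definition trans :: "'v \<Rightarrow> bool" where "trans T \<longleftrightarrow> (\<forall>x y. x \<epsilon> T \<longrightarrow> y \<epsilon> x \<longrightarrow> y \<epsilon> T)"

text \<open>The union of the iterates of the union operation, started at the singleton of
  \<open>x\<close> and indexed by the internal \<open>om\<close>.\<close>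

lemma trcl: obtains T where "trans T" "x \<epsilon> T"
proof -
  define U where "U s = mk {z. \<exists>x. x \<epsilon> s \<and> z \<epsilon> x}" for s
  have dU: "dfun U" unfolding dfun_def U_def by (intro d_rules)
  obtain g where g: "fn om g" "app g zero = mk {z. z = x}" "\<And>n. n \<epsilon> om \<Longrightarrow> app g (suc n) = U (app g n)"
    using omega_rec[OF dU] by metis
  have "dfun (app g)" unfolding dfun_def by (intro d_rules)
  from mem_mk[OF small_UN[OF this, of om]]
  have T: "z \<epsilon> mk {z. \<exists>n. n \<epsilon> om \<and> z \<epsilon> app g n} \<longleftrightarrow> (\<exists>n. n \<epsilon> om \<and> z \<epsilon> app g n)" for z by simp
  have U: "z \<epsilon> U s \<longleftrightarrow> (\<exists>x. x \<epsilon> s \<and> z \<epsilon> x)" for z s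
    unfolding U_def using mem_mk[OF small_Union] by simp
  show thesis
  proof (rule that)
    show "x \<epsilon> mk {z. \<exists>n. n \<epsilon> om \<and> z \<epsilon> app g n}" unfolding T using g(2) zero_om by (metis mem_sing)
    show "trans (mk {z. \<exists>n. n \<epsilon> om \<and> z \<epsilon> app g n})" unfolding trans_def T using g(3) suc_om U by metis
  qed
qed

text \<open>Foundation speaks of sets, so the definable class of counterexamples is first cut down
  to a transitive set containing one of them.\<close>

lemma eps_induct:
  assumes "dcls P" "\<And>x. (\<And>y. y \<epsilon> x \<Longrightarrow> P y) \<Longrightarrow> P x" shows "P x"
proof (rule ccontr)
  assume nx: "\<not> P x"
  obtain T where T: "trans T" "x \<epsilon> T" by (rule trcl)
  have "dcls (\<lambda>x. \<not> P x)" using assms(1) unfolding dcls_def by (rule dpred_not)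
  from sep[OF this, of T] obtain B where B: "\<forall>x. x \<epsilon> B \<longleftrightarrow> x \<epsilon> T \<and> \<not> P x" by blast
  then have "x \<epsilon> B" using T nx by blast
  from foundation[OF this] obtain m where m: "m \<epsilon> B" "\<forall>y. y \<epsilon> m \<longrightarrow> \<not> y \<epsilon> B" by blast
  then have "P m" using assms(2)[of m] B T(1) unfolding trans_def by blast
  with m B show False by blast
qed

subsection \<open>Ranks and class choice\<close>

text \<open>\<open>lev x\<close> is the level \<open>V\<^sub>\<alpha>\<close> for \<open>\<alpha>\<close> the rank of \<open>x\<close>, obtained without ordinals.\<close>

definition lev :: "'v \<Rightarrow> 'v" where
  "lev = wrec (\<epsilon>) (\<lambda>s. mk {z. \<exists>u. u \<epsilon> s \<and> (\<forall>w. w \<epsilon> z \<longrightarrow> w \<epsilon> u)})"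

lemma drel_mem: "drel (\<epsilon>)" unfolding drel_def by (intro d_rules)

lemma wfr_mem: "wfr (\<epsilon>)"
  unfolding wfr_def using foundation by metis

lemma dfun_lev: "dfun lev"
  unfolding lev_def by (rule dfun_wrec[OF drel_mem]) (unfold dfun_def, intro d_rules)

text \<open>The level of \<open>x\<close> is the union of the power sets of the levels of its
  members. The axioms of union, power set and replacement provide the smallness without which
  \<open>mk\<close> would return its default value.\<close>

lemma mem_lev: "z \<epsilon> lev x \<longleftrightarrow> (\<exists>y. y \<epsilon> x \<and> (\<forall>w. w \<epsilon> z \<longrightarrow> w \<epsilon> lev y))"
proof -
  define F where "F s = mk {z. \<exists>u. u \<epsilon> s \<and> (\<forall>w. w \<epsilon> z \<longrightarrow> w \<epsilon> u)}" for s
  have dF: "dfun F" unfolding dfun_def F_def by (intro d_rules)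
  have lev: "lev = wrec (\<epsilon>) F" unfolding lev_def F_def ..
  obtain T where T: "trans T" "x \<epsilon> T" by (rule trcl)
  have "closed (\<epsilon>) T" using T unfolding trans_def closed_def by blast
  from wrec[OF drel_mem dF wfr_mem this T(2)]
  have 1: "lev x = F (mk {z. \<exists>y. y \<epsilon> x \<and> z = lev y})" unfolding lev .
  define P where "P u = mk {z. \<forall>w. w \<epsilon> z \<longrightarrow> w \<epsilon> u}" for u
  have dP: "dfun P" unfolding dfun_def P_def by (intro d_rules)
  have P: "z \<epsilon> P u \<longleftrightarrow> (\<forall>w. w \<epsilon> z \<longrightarrow> w \<epsilon> u)" for z u
    unfolding P_def using mem_mk[OF small_Pow] by simp
  have F: "z \<epsilon> F s \<longleftrightarrow> (\<exists>u. u \<epsilon> s \<and> (\<forall>w. w \<epsilon> z \<longrightarrow> w \<epsilon> u))" for z s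
    using mem_mk[OF small_UN[OF dP, of s], of z] unfolding P F_def by simp
  show ?thesis unfolding 1 F using mem_mk[OF small_repl[OF dfun_lev, of x]] by auto
qed

definition sub :: "'v \<Rightarrow> 'v \<Rightarrow> bool" where "sub a b \<longleftrightarrow> (\<forall>x. x \<epsilon> a \<longrightarrow> x \<epsilon> b)"

lemma drel_sub: "drel sub" unfolding drel_def sub_def by (intro d_rules)

lemma sub_trans: "sub a b \<Longrightarrow> sub b c \<Longrightarrow> sub a c" unfolding sub_def by blast

lemma lev_sub: "sub (lev x) (lev y)" if "\<And>z. z \<epsilon> x \<Longrightarrow> lev z \<epsilon> lev y"
proof -
  have "w \<epsilon> lev y" if w: "\<forall>v. v \<epsilon> w \<longrightarrow> v \<epsilon> lev z" and z: "z \<epsilon> x" for z w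
  proof -
    obtain y' where "y' \<epsilon> y" "sub (lev z) (lev y')"
      using \<open>z \<epsilon> x \<Longrightarrow> lev z \<epsilon> lev y\<close> z unfolding mem_lev[of _ y] sub_def by blast
    then show ?thesis using w unfolding mem_lev[of w y] sub_def by blast
  qed
  then show ?thesis unfolding sub_def mem_lev[of _ x] by blast
qed

text \<open>Comparability of ranks without ordinals. In the induction on \<open>x\<close>, the
  hypothesis first gives the comparison \<open>C\<close> with the roles exchanged; \<open>C\<close>
  applied to the members of \<open>y\<close> then gives the claim.\<close>

lemma lev_linear: "sub (lev y) (lev x) \<or> lev x \<epsilon> lev y"
proof -
  have main: "\<forall>y. sub (lev y) (lev x) \<or> lev x \<epsilon> lev y" for x
  proof (rule eps_induct[of "\<lambda>x. \<forall>y. sub (lev y) (lev x) \<or> lev x \<epsilon> lev y"])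
    show "dcls (\<lambda>x. \<forall>y. sub (lev y) (lev x) \<or> lev x \<epsilon> lev y)"
      unfolding dcls_def by (intro d_rules dpred_rel[OF drel_sub] dterm_fun[OF dfun_lev])
    fix x assume IH: "\<And>x'. x' \<epsilon> x \<Longrightarrow> \<forall>y. sub (lev y) (lev x') \<or> lev x' \<epsilon> lev y"
    have C: "sub (lev x) (lev y) \<or> lev y \<epsilon> lev x" for y
    proof (cases "\<forall>z. z \<epsilon> x \<longrightarrow> lev z \<epsilon> lev y")
      case True
      then show ?thesis using lev_sub[of x y] by blast
    next
      case False
      then obtain z where "z \<epsilon> x" "sub (lev y) (lev z)" using IH by blast
      then show ?thesis unfolding mem_lev[of _ x] sub_def by blast
    qed
    show "\<forall>y. sub (lev y) (lev x) \<or> lev x \<epsilon> lev y"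
    proof
      fix y
      show "sub (lev y) (lev x) \<or> lev x \<epsilon> lev y"
      proof (cases "\<forall>z. z \<epsilon> y \<longrightarrow> lev z \<epsilon> lev x")
        case True
        then show ?thesis using lev_sub[of y x] by blast
      next
        case False
        then obtain z where "z \<epsilon> y" "sub (lev x) (lev z)" using C by blast
        then show ?thesis unfolding mem_lev[of _ y] sub_def by blast
      qed
    qed
  qed
  then show ?thesis by blast
qed

lemma mem_lev_self: "x \<epsilon> lev y" if "sub (lev x) (lev z)" "z \<epsilon> y" for x y z
proof -
  have "sub x (lev x)" for x
  proof (rule eps_induct[of "\<lambda>x. sub x (lev x)"])
    show "dcls (\<lambda>x. sub x (lev x))"
      unfolding dcls_def by (intro d_rules dpred_rel[OF drel_sub] dterm_fun[OF dfun_lev])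
    fix x assume "\<And>y. y \<epsilon> x \<Longrightarrow> sub y (lev y)"
    then show "sub x (lev x)" unfolding sub_def mem_lev[of _ x] by blast
  qed
  then have "sub x (lev z)" using that(1) sub_trans by blast
  then show ?thesis using that(2) unfolding mem_lev[of x y] sub_def by blast
qed

text \<open>Induction on a bound \<open>z\<close> for the level of a witness: a witness that is not
  least is beaten by one whose level is contained in that of a member of \<open>z\<close>.\<close>

lemma least_rank:
  assumes P: "dcls P" and y: "P y"
  obtains m where "P m" "\<And>y. P y \<Longrightarrow> sub (lev m) (lev y)"
proof -
  have "\<forall>y. P y \<longrightarrow> sub (lev y) (lev z) \<longrightarrow> (\<exists>m. P m \<and> (\<forall>y. P y \<longrightarrow> sub (lev m) (lev y)))" for z
  proof (rule eps_induct[of "\<lambda>z. \<forall>y. P y \<longrightarrow> sub (lev y) (lev z) \<longrightarrow> (\<exists>m. P m \<and> (\<forall>y. P y \<longrightarrow> sub (lev m) (lev y)))"])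
    show "dcls (\<lambda>z. \<forall>y. P y \<longrightarrow> sub (lev y) (lev z) \<longrightarrow> (\<exists>m. P m \<and> (\<forall>y. P y \<longrightarrow> sub (lev m) (lev y))))"
      unfolding dcls_def
      by (intro d_rules dpred_cls[OF P] dpred_rel[OF drel_sub] dterm_fun[OF dfun_lev])
    fix z assume IH: "\<And>z'. z' \<epsilon> z \<Longrightarrow> \<forall>y. P y \<longrightarrow> sub (lev y) (lev z') \<longrightarrow> (\<exists>m. P m \<and> (\<forall>y. P y \<longrightarrow> sub (lev m) (lev y)))"
    show "\<forall>y. P y \<longrightarrow> sub (lev y) (lev z) \<longrightarrow> (\<exists>m. P m \<and> (\<forall>y. P y \<longrightarrow> sub (lev m) (lev y)))"
    proof (intro allI impI)
      fix y assume y: "P y" "sub (lev y) (lev z)"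
      show "\<exists>m. P m \<and> (\<forall>y. P y \<longrightarrow> sub (lev m) (lev y))"
      proof (cases "\<forall>y'. P y' \<longrightarrow> sub (lev y) (lev y')")
        case False
        then obtain y' where y': "P y'" "lev y' \<epsilon> lev y" using lev_linear by blast
        then have "lev y' \<epsilon> lev z" using y unfolding sub_def by blast
        then obtain z' where "z' \<epsilon> z" "sub (lev y') (lev z')" unfolding mem_lev[of _ z] sub_def by blast
        then show ?thesis using IH y' by blast
      qed (use y in blast)
    qed
  qed
  moreover have "sub (lev y) (lev y)" unfolding sub_def by blast
  ultimately show thesis using y that by blast
qed

text \<open>Scott's trick: the witnesses of least rank form a set, to which the axiom of choice
  applies. This supplies the functions in Los's theorem for unbounded existential
  quantifiers.\<close>

lemma class_choice:
  assumes P: "drel P"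
  obtains g where "fn X g" "\<And>x. x \<epsilon> X \<Longrightarrow> \<exists>y. P x y \<Longrightarrow> P x (app g x)"
proof -
  define S where "S x = mk {y. P x y \<and> (\<forall>y'. P x y' \<longrightarrow> sub (lev y) (lev y'))}" for x
  have dS: "dfun S" unfolding dfun_def S_def
    by (intro d_rules dpred_rel[OF P] dpred_rel[OF drel_sub] dterm_fun[OF dfun_lev])
  have dPx: "dcls (P x)" for x unfolding dcls_def by (intro d_rules dpred_rel[OF P])
  have S: "y \<epsilon> S x \<longleftrightarrow> P x y \<and> (\<forall>y'. P x y' \<longrightarrow> sub (lev y) (lev y'))" for x y
  proof (cases "\<exists>y. P x y")
    case True
    then obtain m where m: "P x m" "\<And>y. P x y \<Longrightarrow> sub (lev m) (lev y)"
      using least_rank[OF dPx] by metis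
    have "small {y. P x y \<and> (\<forall>y'. P x y' \<longrightarrow> sub (lev y) (lev y'))}"
    proof (rule small_sub)
      show "dcls (\<lambda>y. P x y \<and> (\<forall>y'. P x y' \<longrightarrow> sub (lev y) (lev y')))" unfolding dcls_def
        by (intro d_rules dpred_rel[OF P] dpred_rel[OF drel_sub] dterm_fun[OF dfun_lev])
      fix y assume "P x y \<and> (\<forall>y'. P x y' \<longrightarrow> sub (lev y) (lev y'))"
      \<comment> \<open>All witnesses of least rank lie in one level, that of the singleton of
        \<open>m\<close>.\<close>
      then show "y \<epsilon> lev (mk {z. z = m})" using m by (intro mem_lev_self[of y m]) auto
    qed
    from mem_mk[OF this] show ?thesis unfolding S_def by simp
  next
    case False
    then have "S x = mk {}" unfolding S_def by simp
    then show ?thesis using False zero_def not_mem_zero by metis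
  qed
  obtain c where c: "fn X c" "\<And>x. x \<epsilon> X \<Longrightarrow> \<exists>y. y \<epsilon> S x \<Longrightarrow> app c x \<epsilon> S x"
    using choice[OF dS] by metis
  show thesis
  proof (rule that[OF c(1)])
    fix x assume x: "x \<epsilon> X" "\<exists>y. P x y"
    then obtain m where "P x m" "\<And>y. P x y \<Longrightarrow> sub (lev m) (lev y)"
      using least_rank[OF dPx] by metis
    then have "\<exists>y. y \<epsilon> S x" unfolding S by blast
    from c(2)[OF x(1) this] show "P x (app c x)" unfolding S by blast
  qed
qed

section \<open>Definability of satisfaction over classes, and of class functions\<close>

lemma dterm_if:
  assumes "dpred P" "dterm t" "dterm s" shows "dterm (\<lambda>e. if P e then t e else s e)"
proof -
  have 1: "(if P e then t e else s e) = z \<longleftrightarrow> (P e \<and> t e = z) \<or> (\<not> P e \<and> s e = z)" for e z by simp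
  show ?thesis unfolding dterm_def 1
    by (intro dpred_disj dpred_conj dpred_not dpred_rename[OF assms(1)] assms(2,3)[unfolded dterm_def])
qed

text \<open>The induction runs over the external formula, so each \<open>\<phi>\<close> receives a
  defining formula of its own and no truth definition is involved. The terms \<open>t n\<close> are
  arbitrary in the induction because a quantifier replaces one of them by the new slot 0.\<close>

lemma dpred_sat:
  assumes N: "dcls (\<lambda>x. x \<in> N)" and t: "\<And>n. dterm (t n)"
  shows "dpred (\<lambda>e. sat N (\<epsilon>) \<phi> (\<lambda>n. t n e))"
  using t
proof (induction \<phi> arbitrary: t)
  case (Ex k \<phi>)
  define t' where "t' n = (if n = k then (\<lambda>e. e 0) else (\<lambda>e. t n (\<lambda>n. e (Suc n))))" for n
  have "dterm (t' n)" for n unfolding t'_def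
    by (cases "n = k") (simp_all add: dterm_var dterm_shift[OF Ex.prems])
  then have "dpred (\<lambda>e. sat N (\<epsilon>) \<phi> (\<lambda>n. t' n e))" by (rule Ex.IH)
  moreover have "(\<lambda>n. t' n e) = (\<lambda>n. t n (\<lambda>n. e (Suc n)))(k := e 0)" for e
    by (auto simp: t'_def)
  ultimately have 1: "dpred (\<lambda>e. sat N (\<epsilon>) \<phi> ((\<lambda>n. t n (\<lambda>n. e (Suc n)))(k := e 0)))" by simp
  show ?case unfolding sat.simps Bex_def
    by (intro dpred_ex dpred_conj dpred_cls[OF N] dterm_var 1)
qed (simp_all add: dpred_mem dpred_eq dpred_not dpred_conj)

text \<open>Passes from interleaved slots to the convention of \<open>defines_fun\<close>, where
  slots 0 and 1 are argument and value and all others are parameters.\<close>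

lemma drel_definesE:
  assumes "drel R"
  obtains \<phi> e where "\<forall>x y. sat UNIV (\<epsilon>) \<phi> (e(0 := x, 1 := y)) \<longleftrightarrow> R x y"
proof -
  obtain \<phi> p where P: "\<forall>e. R (e 0) (e 1) \<longleftrightarrow> sat UNIV (\<epsilon>) \<phi> (\<lambda>n. if even n then e (n div 2) else p (n div 2))"
    by (rule dpredE[OF assms[unfolded drel_def]])
  obtain \<psi> where \<psi>: "\<forall>(M :: 'v set) E e. sat M E \<psi> e \<longleftrightarrow>
      sat M E \<phi> (\<lambda>n. e (if n = 0 then 0 else if n = 2 then 1 else n + 1))"
    by (rule sat_renameE)
  let ?e = "\<lambda>n::nat. if odd n then undefined else p ((n - 1) div 2)"
  have "sat UNIV (\<epsilon>) \<psi> (?e(0 := x, 1 := y)) \<longleftrightarrow> R x y" for x y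
  proof -
    have "(\<lambda>n. if even n then (case_nat x (case_nat y (\<lambda>_. undefined))) (n div 2) else p (n div 2)) =
       (\<lambda>n. (?e(0 := x, 1 := y)) (if n = 0 then 0 else if n = 2 then 1 else n + 1))"
    proof
      fix n
      consider "n = 0" | "n = 2" | "odd n" | k where "n = 2 * Suc (Suc k)"
        by (metis even_Suc nat_mult_div_cancel_disj not0_implies_Suc dvd_def mult_0_right mult.right_neutral One_nat_def)
      then show "(if even n then (case_nat x (case_nat y (\<lambda>_. undefined))) (n div 2) else p (n div 2)) =
       (?e(0 := x, 1 := y)) (if n = 0 then 0 else if n = 2 then 1 else n + 1)"
        by cases (auto simp: split: nat.split)
    qed
    then show ?thesis using P[rule_format, of "case_nat x (case_nat y (\<lambda>_. undefined))"] \<psi> by auto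
  qed
  then show thesis by (intro that[of \<psi> ?e]) simp
qed

lemma defines_fun_drel:
  assumes "defines_fun UNIV (\<epsilon>) \<phi> e D k"
  shows "drel (\<lambda>x y. x \<in> D \<and> k x = y)"
proof -
  define t :: "nat \<Rightarrow> (nat \<Rightarrow> 'v) \<Rightarrow> 'v" where "t n = (if n = 1 then (\<lambda>e. e 1) else if n = 0 then (\<lambda>e. e 0) else (\<lambda>_. e n))" for n
  have "dterm (t n)" for n unfolding t_def by (simp add: dterm_var dterm_const)
  then have "dpred (\<lambda>d. sat UNIV (\<epsilon>) \<phi> (\<lambda>n. t n d))"
    by (intro dpred_sat) (simp_all add: dcls_def dpred_const)
  moreover have "(\<lambda>n. t n d) = e(0 := d 0, 1 := d 1)" for d by (auto simp: t_def)
  ultimately have "dpred (\<lambda>d. sat UNIV (\<epsilon>) \<phi> (e(0 := d 0, 1 := d 1)))" by simp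
  then show ?thesis using assms unfolding drel_def defines_fun_def by simp
qed

lemma
  assumes "ultrafilter_on UNIV (\<epsilon>) X U"
  shows uf_sub: "A \<epsilon> U \<Longrightarrow> x \<epsilon> A \<Longrightarrow> x \<epsilon> X"
    and uf_space: "X \<epsilon> U"
    and uf_ne: "A \<epsilon> U \<Longrightarrow> \<exists>x. x \<epsilon> A"
    and uf_mono: "A \<epsilon> U \<Longrightarrow> (\<And>x. x \<epsilon> A \<Longrightarrow> x \<epsilon> B) \<Longrightarrow> (\<And>x. x \<epsilon> B \<Longrightarrow> x \<epsilon> X) \<Longrightarrow> B \<epsilon> U"
    and uf_inter: "A \<epsilon> U \<Longrightarrow> B \<epsilon> U \<Longrightarrow> (\<And>x. x \<epsilon> C \<longleftrightarrow> x \<epsilon> A \<and> x \<epsilon> B) \<Longrightarrow> C \<epsilon> U"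
    and uf_ultra: "(\<And>x. x \<epsilon> A \<Longrightarrow> x \<epsilon> X) \<Longrightarrow> (\<And>x. x \<epsilon> B \<longleftrightarrow> x \<epsilon> X \<and> \<not> x \<epsilon> A) \<Longrightarrow> A \<epsilon> U \<or> B \<epsilon> U"
proof -
  show "A \<epsilon> U \<Longrightarrow> x \<epsilon> A \<Longrightarrow> x \<epsilon> X"
    using assms[unfolded ultrafilter_on_def, THEN conjunct1]
    unfolding is_subset_def by simp
  show "X \<epsilon> U"
    using assms[unfolded ultrafilter_on_def, THEN conjunct2, THEN conjunct1] .
  show "A \<epsilon> U \<Longrightarrow> \<exists>x. x \<epsilon> A"
    using assms[unfolded ultrafilter_on_def, THEN conjunct2, THEN conjunct2, THEN conjunct1]
    unfolding is_empty_def by simp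
  show "A \<epsilon> U \<Longrightarrow> (\<And>x. x \<epsilon> A \<Longrightarrow> x \<epsilon> B) \<Longrightarrow> (\<And>x. x \<epsilon> B \<Longrightarrow> x \<epsilon> X) \<Longrightarrow> B \<epsilon> U"
    by (rule assms[unfolded ultrafilter_on_def, THEN conjunct2, THEN conjunct2, THEN conjunct2, THEN conjunct1, rule_format, of A B])
      (simp_all add: is_subset_def)
  show "A \<epsilon> U \<Longrightarrow> B \<epsilon> U \<Longrightarrow> (\<And>x. x \<epsilon> C \<longleftrightarrow> x \<epsilon> A \<and> x \<epsilon> B) \<Longrightarrow> C \<epsilon> U"
    by (rule assms[unfolded ultrafilter_on_def, THEN conjunct2, THEN conjunct2, THEN conjunct2, THEN conjunct2, THEN conjunct1, rule_format, of A B C]) simp_all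
  show "(\<And>x. x \<epsilon> A \<Longrightarrow> x \<epsilon> X) \<Longrightarrow> (\<And>x. x \<epsilon> B \<longleftrightarrow> x \<epsilon> X \<and> \<not> x \<epsilon> A) \<Longrightarrow> A \<epsilon> U \<or> B \<epsilon> U"
    by (rule assms[unfolded ultrafilter_on_def, THEN conjunct2, THEN conjunct2, THEN conjunct2, THEN conjunct2, THEN conjunct2, rule_format, of A B])
      (simp_all add: is_subset_def)
qed

end

section \<open>Countably complete ultrafilters and almost-everywhere statements\<close>

locale ultra = zfc E for E :: "'v \<Rightarrow> 'v \<Rightarrow> bool" (infix "\<epsilon>" 50) +
  fixes U :: 'v
  assumes cc: "cc_ultrafilter UNIV (\<epsilon>) U"
begin

definition X where "X = uf_space UNIV (\<epsilon>) U"

text \<open>The underlying set is the largest member of \<open>U\<close>, hence determined by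
  \<open>U\<close>; so the description in \<open>uf_space\<close> succeeds.\<close>

lemma ultrafilter: "ultrafilter_on UNIV (\<epsilon>) X U" and complete: "countably_complete UNIV (\<epsilon>) X U"
proof -
  obtain Y where Y: "ultrafilter_on UNIV (\<epsilon>) Y U" "countably_complete UNIV (\<epsilon>) Y U"
    using cc unfolding cc_ultrafilter_def by auto
  have u: "Z = Y" if Z: "ultrafilter_on UNIV (\<epsilon>) Z U" for Z
  proof (rule ext)
    show "x \<epsilon> Z \<longleftrightarrow> x \<epsilon> Y" for x
      using uf_sub[OF Y(1) uf_space[OF Z]] uf_sub[OF Z uf_space[OF Y(1)]] by blast
  qed
  have "X = Y" unfolding X_def uf_space_def
    by (rule the_equality) (use Y(1) in simp, use u in blast)
  with Y show "ultrafilter_on UNIV (\<epsilon>) X U" "countably_complete UNIV (\<epsilon>) X U" by simp_all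
qed

lemma uf_funs_iff: "f \<in> uf_funs UNIV (\<epsilon>) U \<longleftrightarrow> fn X f"
  unfolding uf_funs_def X_def[symmetric] by simp

lemmas U_sub = uf_sub[OF ultrafilter] and U_space = uf_space[OF ultrafilter]
  and U_ne = uf_ne[OF ultrafilter] and U_mono = uf_mono[OF ultrafilter]
  and U_inter = uf_inter[OF ultrafilter] and U_ultra = uf_ultra[OF ultrafilter]

text \<open>The quantifier "for \<open>U\<close>-almost all \<open>i\<close>". The set of good
  points is asserted to exist rather than formed, since separation may fail for an undefinable
  \<open>P\<close>; this is the origin of the definability side conditions below.\<close>

definition lg :: "('v \<Rightarrow> bool) \<Rightarrow> bool" where
  "lg P \<longleftrightarrow> (\<exists>A. A \<epsilon> U \<and> (\<forall>x. x \<epsilon> A \<longleftrightarrow> x \<epsilon> X \<and> P x))"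

lemma lg_ex: "lg P \<Longrightarrow> \<exists>x. x \<epsilon> X \<and> P x"
  unfolding lg_def using U_ne by blast

lemma lg_mono: assumes "lg P" "dcls Q" "\<And>x. x \<epsilon> X \<Longrightarrow> P x \<Longrightarrow> Q x" shows "lg Q"
proof -
  obtain A where A: "A \<epsilon> U" "\<forall>x. x \<epsilon> A \<longleftrightarrow> x \<epsilon> X \<and> P x" using assms(1) unfolding lg_def by blast
  obtain B where B: "\<forall>x. x \<epsilon> B \<longleftrightarrow> x \<epsilon> X \<and> Q x" using sep[OF assms(2)] by blast
  have "B \<epsilon> U" by (rule U_mono[OF A(1)]) (use A B assms(3) in blast)+
  with B show ?thesis unfolding lg_def by blast
qed

lemma lg_cong: assumes "\<And>x. x \<epsilon> X \<Longrightarrow> P x \<longleftrightarrow> Q x" shows "lg P \<longleftrightarrow> lg Q"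
proof -
  have "(\<forall>x. x \<epsilon> A \<longleftrightarrow> x \<epsilon> X \<and> P x) \<longleftrightarrow> (\<forall>x. x \<epsilon> A \<longleftrightarrow> x \<epsilon> X \<and> Q x)" for A
    using assms by auto
  then show ?thesis unfolding lg_def by simp
qed

lemma lg_conj: assumes "dcls P" "dcls Q" shows "lg (\<lambda>x. P x \<and> Q x) \<longleftrightarrow> lg P \<and> lg Q"
proof
  assume "lg (\<lambda>x. P x \<and> Q x)"
  then show "lg P \<and> lg Q" using lg_mono assms by blast
next
  assume "lg P \<and> lg Q"
  then obtain A B where A: "A \<epsilon> U" "\<forall>x. x \<epsilon> A \<longleftrightarrow> x \<epsilon> X \<and> P x" and B: "B \<epsilon> U" "\<forall>x. x \<epsilon> B \<longleftrightarrow> x \<epsilon> X \<and> Q x"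
    unfolding lg_def by blast
  have "dcls (\<lambda>x. P x \<and> Q x)" unfolding dcls_def by (intro d_rules dpred_cls[OF assms(1)] dpred_cls[OF assms(2)])
  from sep[OF this] obtain C where C: "\<forall>x. x \<epsilon> C \<longleftrightarrow> x \<epsilon> X \<and> P x \<and> Q x" by blast
  have "C \<epsilon> U" by (rule U_inter[OF A(1) B(1)]) (use A B C in blast)
  with C show "lg (\<lambda>x. P x \<and> Q x)" unfolding lg_def by blast
qed

lemma lg_not: assumes "dcls P" shows "lg (\<lambda>x. \<not> P x) \<longleftrightarrow> \<not> lg P"
proof -
  have n: "dcls (\<lambda>x. \<not> P x)" using assms unfolding dcls_def by (rule dpred_not)
  obtain A where A: "\<forall>x. x \<epsilon> A \<longleftrightarrow> x \<epsilon> X \<and> P x" using sep[OF assms] by blast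
  obtain B where B: "\<forall>x. x \<epsilon> B \<longleftrightarrow> x \<epsilon> X \<and> \<not> P x" using sep[OF n] by blast
  have "A \<epsilon> U \<or> B \<epsilon> U" by (rule U_ultra) (use A B in blast)+
  then have 1: "lg P \<or> lg (\<lambda>x. \<not> P x)" using A B unfolding lg_def by blast
  have 2: "\<not> (lg P \<and> lg (\<lambda>x. \<not> P x))"
    unfolding lg_conj[OF assms n, symmetric] using lg_ex by blast
  from 1 2 show ?thesis by blast
qed

lemma lg_const [simp]: "lg (\<lambda>_. b) \<longleftrightarrow> b"
proof (cases b)
  case True
  then show ?thesis unfolding lg_def using U_space by auto
next
  case False
  then show ?thesis using lg_ex by auto
qed

text \<open>Completeness is stated for functions of the model on the internal \<open>om\<close>, so
  the properties must be definable jointly in \<open>n\<close> and the index in order to be gathered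
  into one function.\<close>

lemma lg_countable:
  assumes P: "drel P" and lg: "\<And>n. n \<epsilon> om \<Longrightarrow> lg (P n)"
  shows "lg (\<lambda>i. \<forall>n. n \<epsilon> om \<longrightarrow> P n i)"
proof -
  define A where "A n = mk {i. i \<epsilon> X \<and> P n i}" for n
  have dA: "dfun A" unfolding A_def dfun_def by (intro d_rules dpred_rel[OF P])
  have "small {i. i \<epsilon> X \<and> P n i}" for n
    by (rule small_sub[where a = X]) (unfold dcls_def, intro d_rules dpred_rel[OF P], simp)
  from mem_mk[OF this] have A: "i \<epsilon> A n \<longleftrightarrow> i \<epsilon> X \<and> P n i" for i n unfolding A_def by simp
  have AU: "A n \<epsilon> U" if n: "n \<epsilon> om" for n
  proof -
    obtain B where "B \<epsilon> U" "\<forall>x. x \<epsilon> B \<longleftrightarrow> x \<epsilon> X \<and> P n x" using lg[OF n] unfolding lg_def by blast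
    moreover from this have "B = A n" by (intro ext) (simp add: A)
    ultimately show ?thesis by simp
  qed
  have m: "opr n a \<epsilon> lam om A \<longleftrightarrow> n \<epsilon> om \<and> a = A n" for n a by (auto simp: mem_lam[OF dA])
  have "\<exists>B. B \<epsilon> U \<and> (\<forall>x. x \<epsilon> B \<longleftrightarrow> x \<epsilon> X \<and> (\<forall>n a. opr n a \<epsilon> lam om A \<longrightarrow> x \<epsilon> a))"
    using complete[unfolded countably_complete_def, rule_format, of om "lam om A"] AU
    by (simp add: is_omega_iff fn_lam[OF dA] maps_to_iff m)
  then show ?thesis unfolding lg_def by (simp add: m A) (metis (no_types, lifting) zero_om)
qed

abbreviation eqU where "eqU f g \<equiv> lg (\<lambda>i. app f i = app g i)"
abbreviation meU where "meU f g \<equiv> lg (\<lambda>i. app f i \<epsilon> app g i)"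

lemma eq_mod_iff: assumes "fn X f" "fn X g" shows "eq_mod UNIV (\<epsilon>) U f g \<longleftrightarrow> eqU f g"
  unfolding eq_mod_def X_def[symmetric] lg_def maps_to_iff
  by (simp add: opr_mem_fn[OF assms(1)] opr_mem_fn[OF assms(2)] cong: conj_cong)

lemma mem_mod_iff: assumes "fn X f" "fn X g" shows "mem_mod UNIV (\<epsilon>) U f g \<longleftrightarrow> meU f g"
  unfolding mem_mod_def X_def[symmetric] lg_def maps_to_iff
  by (simp add: opr_mem_fn[OF assms(1)] opr_mem_fn[OF assms(2)] cong: conj_cong)

lemma d_eqU: "dcls (\<lambda>i. app f i = app g i)" and d_meU: "dcls (\<lambda>i. app f i \<epsilon> app g i)"
  unfolding dcls_def by (intro d_rules)+

lemma eqU_sym: "eqU f g \<Longrightarrow> eqU g f"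
  by (rule lg_mono[where P = "\<lambda>i. app f i = app g i"]) (simp_all add: d_eqU)

lemma eqU_trans: "eqU f g \<Longrightarrow> eqU g h \<Longrightarrow> eqU f h"
  using lg_mono[of "\<lambda>i. app f i = app g i \<and> app g i = app h i" "\<lambda>i. app f i = app h i"]
  by (simp add: d_eqU lg_conj)

lemma meU_cong1: assumes "eqU f f'" "meU f g" shows "meU f' g"
proof -
  have "lg (\<lambda>i. app f i = app f' i \<and> app f i \<epsilon> app g i)"
    using assms by (simp add: lg_conj d_eqU d_meU)
  then show ?thesis by (rule lg_mono[OF _ d_meU]) metis
qed

lemma meU_cong2: assumes "eqU g g'" "meU f g" shows "meU f g'"
proof -
  have "lg (\<lambda>i. app g i = app g' i \<and> app f i \<epsilon> app g i)"
    using assms by (simp add: lg_conj d_eqU d_meU)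
  then show ?thesis by (rule lg_mono[OF _ d_meU]) metis
qed

text \<open>
  A class of functions represents the members of \<open>[f]\<^sub>U\<close>; the clause on transitive sets cuts it
  down to a set without losing a member (lemma \<open>adjust\<close>), so that recursion applies.
\<close>

definition rel :: "'v \<Rightarrow> 'v \<Rightarrow> bool" where
  "rel g f \<longleftrightarrow> fn X g \<and> fn X f \<and> meU g f \<and>
     (\<forall>T. trans T \<longrightarrow> (\<forall>i. i \<epsilon> X \<longrightarrow> app f i \<epsilon> T) \<longrightarrow> (\<forall>i. i \<epsilon> X \<longrightarrow> app g i \<epsilon> T))"

lemma drel_rel: "drel rel"
  unfolding drel_def rel_def lg_def trans_def by (intro d_rules)

lemma adjust:
  assumes "fn X g" "fn X f" "meU g f"
  obtains g' where "rel g' f" "eqU g g'"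
proof -
  \<comment> \<open>At the exceptional points the default is \<open>app f i\<close>: it belongs to
    every transitive set containing the values of \<open>f\<close>, as do the members of those
    values.\<close>
  define G where "G i = (if app g i \<epsilon> app f i then app g i else app f i)" for i
  have dG: "dfun G" unfolding dfun_def G_def by (intro dterm_if d_rules)
  have e: "eqU g (lam X G)"
    by (rule lg_mono[OF assms(3) d_eqU]) (simp add: app_lam[OF dG] G_def)
  have "app (lam X G) i \<epsilon> T"
    if "trans T" "\<forall>i. i \<epsilon> X \<longrightarrow> app f i \<epsilon> T" "i \<epsilon> X" for T i
    using that unfolding trans_def by (auto simp: app_lam[OF dG] G_def)
  then have "rel (lam X G) f" unfolding rel_def
    using meU_cong1[OF e assms(3)] assms(2) fn_lam[OF dG] by blast
  with e show thesis by (rule that[rotated])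
qed

text \<open>A set without minimal element yields, by choice and recursion on the internal
  \<open>om\<close>, a descending sequence of functions. Countable completeness gives one index at
  which all the memberships hold at once, against foundation.\<close>

lemma wfr_rel: "wfr rel"
  unfolding wfr_def
proof (intro allI impI, rule ccontr)
  fix B x0 assume x0: "x0 \<epsilon> B" and "\<not> (\<exists>x. x \<epsilon> B \<and> (\<forall>y. y \<epsilon> B \<longrightarrow> \<not> rel y x))"
  then have nomin: "\<exists>y. y \<epsilon> B \<and> rel y x" if "x \<epsilon> B" for x using that by blast
  define F where "F x = mk {y. y \<epsilon> B \<and> rel y x}" for x
  have dF: "dfun F" unfolding F_def dfun_def by (intro d_rules dpred_rel[OF drel_rel])
  have "small {y. y \<epsilon> B \<and> rel y x}" for x
    by (rule small_sub[where a = B]) (unfold dcls_def, intro d_rules dpred_rel[OF drel_rel], simp)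
  from mem_mk[OF this] have F: "y \<epsilon> F x \<longleftrightarrow> y \<epsilon> B \<and> rel y x" for x y unfolding F_def by simp
  obtain c where c: "\<And>x. x \<epsilon> B \<Longrightarrow> \<exists>y. y \<epsilon> F x \<Longrightarrow> app c x \<epsilon> F x"
    using choice[OF dF] by metis
  have c: "app c x \<epsilon> B" "rel (app c x) x" if "x \<epsilon> B" for x
    using c[OF that] nomin[OF that] unfolding F by blast+
  have dc: "dfun (app c)" unfolding dfun_def by (intro d_rules)
  obtain g where g: "app g zero = x0" "\<And>n. n \<epsilon> om \<Longrightarrow> app g (suc n) = app c (app g n)"
    using omega_rec[OF dc] by metis
  have gB: "app g n \<epsilon> B" if "n \<epsilon> om" for n
    by (rule om_induct[of "\<lambda>n. app g n \<epsilon> B"])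
       (use x0 g c that in \<open>auto simp: dcls_def intro!: d_rules\<close>)
  have dP: "drel (\<lambda>n i. app (app g (suc n)) i \<epsilon> app (app g n) i)"
    unfolding drel_def by (intro d_rules dterm_fun[OF dfun_suc])
  have "lg (\<lambda>i. app (app g (suc n)) i \<epsilon> app (app g n) i)" if "n \<epsilon> om" for n
    using c(2)[OF gB[OF that]] g(2)[OF that] unfolding rel_def by simp
  from lg_countable[OF dP this] obtain i where
    i: "\<And>n. n \<epsilon> om \<Longrightarrow> app (app g (suc n)) i \<epsilon> app (app g n) i" using lg_ex by blast
  have "dfun (\<lambda>n. app (app g n) i)" unfolding dfun_def by (intro d_rules)
  from repl[OF this, of om] obtain S where S: "\<forall>y. y \<epsilon> S \<longleftrightarrow> (\<exists>n. n \<epsilon> om \<and> y = app (app g n) i)" by blast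
  then have "app (app g zero) i \<epsilon> S" using zero_om by blast
  from foundation[OF this] obtain y where y: "y \<epsilon> S" "\<forall>z. z \<epsilon> y \<longrightarrow> \<not> z \<epsilon> S" by blast
  then obtain n where "n \<epsilon> om" "y = app (app g n) i" using S by blast
  with y i S suc_om show False by blast
qed

text \<open>The functions from \<open>X\<close> into a transitive set form a set, and the last
  clause of \<open>rel\<close> keeps predecessors inside it. This makes recursion along
  \<open>rel\<close> legitimate.\<close>

lemma fns_closed:
  assumes "fn X f" obtains D where "closed rel D" "f \<epsilon> D"
proof -
  obtain T where T: "trans T" "f \<epsilon> T" by (rule trcl)
  have v: "app f i \<epsilon> T" if i: "i \<epsilon> X" for i
  proof -
    have "opr i (app f i) \<epsilon> T" using T opr_mem_fn[OF assms i] unfolding trans_def by blast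
    moreover have "mk {z. z = i \<or> z = app f i} \<epsilon> opr i (app f i)" by (simp add: mem_opr)
    ultimately have "mk {z. z = i \<or> z = app f i} \<epsilon> T" using T unfolding trans_def by blast
    then show ?thesis using T(1) mem_upair unfolding trans_def by blast
  qed
  define D where "D = mk {f. fn X f \<and> (\<forall>x. x \<epsilon> X \<longrightarrow> app f x \<epsilon> T)}"
  have D: "f \<epsilon> D \<longleftrightarrow> fn X f \<and> (\<forall>x. x \<epsilon> X \<longrightarrow> app f x \<epsilon> T)" for f
    unfolding D_def using mem_mk[OF small_fns] by simp
  show thesis
  proof (rule that)
    show "closed rel D" unfolding closed_def D rel_def using T(1) by blast
    show "f \<epsilon> D" unfolding D using assms v by blast
  qed
qed

lemma rel_induct:
  assumes "dcls P" "\<And>f. fn X f \<Longrightarrow> (\<And>g. rel g f \<Longrightarrow> P g) \<Longrightarrow> P f" "fn X f"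
  shows "P f"
proof (rule ccontr)
  assume nf: "\<not> P f"
  obtain D where D: "closed rel D" "f \<epsilon> D" by (rule fns_closed[OF assms(3)])
  have "dcls (\<lambda>x. fn X x \<and> \<not> P x)" unfolding dcls_def by (intro d_rules dpred_cls[OF assms(1)])
  from sep[OF this, of D] obtain B where B: "\<forall>x. x \<epsilon> B \<longleftrightarrow> x \<epsilon> D \<and> fn X x \<and> \<not> P x" by blast
  then have "f \<epsilon> B" using D nf assms(3) by blast
  then obtain m where m: "m \<epsilon> B" "\<And>y. y \<epsilon> B \<Longrightarrow> \<not> rel y m" using wfr_rel unfolding wfr_def by metis
  have mB: "m \<epsilon> D" "fn X m" "\<not> P m" using B[rule_format, of m] m(1) by simp_all
  have "P g" if g: "rel g m" for g
  proof -
    have "g \<epsilon> D" using D(1) mB(1) g unfolding closed_def by blast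
    moreover have "fn X g" using g unfolding rel_def by simp
    ultimately show ?thesis using m(2)[of g] g B[rule_format, of g] by blast
  qed
  then have "P m" by (rule assms(2)[OF mB(2)])
  with mB show False by simp
qed

lemma relD: assumes "rel g f" shows "fn X g" "fn X f" "meU g f"
  using assms unfolding rel_def by simp_all

subsection \<open>The transitive collapse\<close>

text \<open>The Mostowski collapse; the step function is the identity because \<open>wrec\<close>
  already passes on the set of collapsed predecessors.\<close>

definition col :: "'v \<Rightarrow> 'v" where "col = wrec rel (\<lambda>s. s)"

lemma dfun_id: "dfun (\<lambda>s. s)" unfolding dfun_def by (intro d_rules)

lemma dfun_col: "dfun col"
  unfolding col_def by (rule dfun_wrec[OF drel_rel dfun_id])

lemma mem_col: assumes "fn X f" shows "z \<epsilon> col f \<longleftrightarrow> (\<exists>g. rel g f \<and> z = col g)"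
proof -
  obtain D where D: "closed rel D" "f \<epsilon> D" by (rule fns_closed[OF assms])
  have "col f = mk {z. \<exists>g. rel g f \<and> z = col g}"
    unfolding col_def by (rule wrec[OF drel_rel dfun_id wfr_rel D])
  then show ?thesis using mem_mk[OF small_image[OF drel_rel dfun_col D]] by simp
qed

lemma dcls_lg: assumes "dpred (\<lambda>e. P (\<lambda>n. e (Suc n)) (e 0))" shows "dpred (\<lambda>e. lg (P e))"
proof -
  have 2: "dpred (\<lambda>e. P (\<lambda>n. e (Suc (f n))) (e k))" for f k
    using dpred_rename[OF assms, of "case_nat k (\<lambda>n. Suc (f n))"] by simp
  show ?thesis unfolding lg_def by (intro d_rules 2)
qed

text \<open>A predecessor of \<open>f\<close> need not be one of \<open>f'\<close>, because
  \<open>rel\<close> bounds the values. By \<open>adjust\<close> it is almost equal to a predecessor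
  of \<open>f'\<close>, and the induction hypothesis identifies the two collapses.\<close>

lemma col_eqU:
  assumes "fn X f" "fn X f'" "eqU f f'" shows "col f = col f'"
proof -
  have "\<forall>f'. fn X f' \<longrightarrow> eqU f f' \<longrightarrow> col f = col f'"
  proof (rule rel_induct[of "\<lambda>f. \<forall>f'. fn X f' \<longrightarrow> eqU f f' \<longrightarrow> col f = col f'"])
    show "dcls (\<lambda>f. \<forall>f'. fn X f' \<longrightarrow> eqU f f' \<longrightarrow> col f = col f')" unfolding dcls_def
      by (intro d_rules dcls_lg dterm_fun[OF dfun_col])
    fix f assume f: "fn X f" and IH: "\<And>g. rel g f \<Longrightarrow> \<forall>g'. fn X g' \<longrightarrow> eqU g g' \<longrightarrow> col g = col g'"
    show "\<forall>f'. fn X f' \<longrightarrow> eqU f f' \<longrightarrow> col f = col f'"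
    proof (intro allI impI ext iffI)
      fix f' z assume f': "fn X f'" "eqU f f'" and "z \<epsilon> col f"
      then obtain g where g: "rel g f" "z = col g" unfolding mem_col[OF f] by blast
      then have "meU g f'" using meU_cong2[OF f'(2)] relD(3) by blast
      then obtain g' where g': "rel g' f'" "eqU g g'" using adjust[OF relD(1)[OF g(1)] f'(1)] by metis
      have "col g = col g'" by (rule IH[OF g(1), rule_format, OF relD(1)[OF g'(1)] g'(2)])
      with g' show "z \<epsilon> col f'" unfolding mem_col[OF f'(1)] using g(2) by blast
    next
      fix f' z assume f': "fn X f'" "eqU f f'" and "z \<epsilon> col f'"
      then obtain g' where g': "rel g' f'" "z = col g'" unfolding mem_col[OF f'(1)] by blast
      then have "meU g' f" using meU_cong2[OF eqU_sym[OF f'(2)]] relD(3) by blast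
      then obtain g where g: "rel g f" "eqU g' g" using adjust[OF relD(1)[OF g'(1)] f] by metis
      have "col g = col g'"
        by (rule IH[OF g(1), rule_format, OF relD(1)[OF g'(1)] eqU_sym[OF g(2)]])
      then show "z \<epsilon> col f" unfolding mem_col[OF f] using g(1) g'(2) by metis
    qed
  qed fact
  then show ?thesis using assms(2,3) by simp
qed

lemma d_const: "dfun (\<lambda>_. c)" unfolding dfun_def by (intro d_rules)

lemma lg_disj: assumes "dcls P" "dcls Q" "lg (\<lambda>x. P x \<or> Q x)" shows "lg P \<or> lg Q"
proof (rule ccontr)
  assume "\<not> (lg P \<or> lg Q)"
  then have "lg (\<lambda>x. \<not> P x)" "lg (\<lambda>x. \<not> Q x)" using lg_not assms(1,2) by auto
  moreover have "dcls (\<lambda>x. \<not> P x)" "dcls (\<lambda>x. \<not> Q x)" using assms(1,2) unfolding dcls_def by (auto intro: dpred_not)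
  moreover have "dcls (\<lambda>x. P x \<or> Q x)" using assms(1,2) unfolding dcls_def by (rule dpred_disj)
  ultimately have "lg (\<lambda>x. \<not> P x \<and> \<not> Q x)" by (simp add: lg_conj)
  then have "lg (\<lambda>x. \<not> (P x \<or> Q x))" by simp
  then show False using lg_not[OF \<open>dcls (\<lambda>x. P x \<or> Q x)\<close>] assms(3) by simp
qed

lemma pick:
  assumes P: "drel P" and lg: "lg (\<lambda>i. \<exists>y. P i y)"
  obtains g where "fn X g" "lg (\<lambda>i. P i (app g i))"
proof -
  obtain g where g: "fn X g" "\<And>i. i \<epsilon> X \<Longrightarrow> \<exists>y. P i y \<Longrightarrow> P i (app g i)"
    using class_choice[OF P] by metis
  have "lg (\<lambda>i. P i (app g i))"
    by (rule lg_mono[OF lg]) (use g in \<open>auto simp: dcls_def intro!: dpred_rel[OF P] d_rules\<close>)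
  with g show thesis using that by blast
qed

lemma d_not_meU: "dcls (\<lambda>i. \<not> app f i \<epsilon> app g i)"
  unfolding dcls_def by (intro d_rules)

text \<open>Extensionality of the ultrapower. If \<open>f\<close> and \<open>f'\<close> are not
  almost equal, then almost everywhere the same one of them contains an element that the other
  lacks; a function selecting such elements would represent a member on one side only.\<close>

lemma eqU_col:
  assumes "fn X f" "fn X f'" "col f = col f'" shows "eqU f f'"
proof -
  have "\<forall>f'. fn X f' \<longrightarrow> col f = col f' \<longrightarrow> eqU f f'"
  proof (rule rel_induct[of "\<lambda>f. \<forall>f'. fn X f' \<longrightarrow> col f = col f' \<longrightarrow> eqU f f'"])
    show "dcls (\<lambda>f. \<forall>f'. fn X f' \<longrightarrow> col f = col f' \<longrightarrow> eqU f f')" unfolding dcls_def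
      by (intro d_rules dcls_lg dterm_fun[OF dfun_col])
    fix f assume f: "fn X f" and IH: "\<And>g. rel g f \<Longrightarrow> \<forall>g'. fn X g' \<longrightarrow> col g = col g' \<longrightarrow> eqU g g'"
    show "\<forall>f'. fn X f' \<longrightarrow> col f = col f' \<longrightarrow> eqU f f'"
    proof (intro allI impI, rule ccontr)
      fix f' assume f': "fn X f'" "col f = col f'" and ne: "\<not> eqU f f'"
      let ?P = "\<lambda>a b i y. y \<epsilon> app a i \<and> \<not> y \<epsilon> app b i"
      have dP: "drel (?P a b)" for a b unfolding drel_def by (intro d_rules)
      have d1: "dcls (\<lambda>i. \<exists>y. ?P a b i y)" for a b unfolding dcls_def by (intro d_rules)
      have "lg (\<lambda>i. \<not> app f i = app f' i)" using ne lg_not[OF d_eqU] by simp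
      moreover have "(\<not> app f i = app f' i) = ((\<exists>y. ?P f f' i y) \<or> (\<exists>y. ?P f' f i y))" for i
        by (metis ext)
      ultimately have "lg (\<lambda>i. (\<exists>y. ?P f f' i y) \<or> (\<exists>y. ?P f' f i y))" by simp
      then have "lg (\<lambda>i. \<exists>y. ?P f f' i y) \<or> lg (\<lambda>i. \<exists>y. ?P f' f i y)" by (rule lg_disj[OF d1 d1])
      then show False
      proof
        assume "lg (\<lambda>i. \<exists>y. ?P f f' i y)"
        from pick[OF dP this] obtain g where g: "fn X g" "lg (\<lambda>i. app g i \<epsilon> app f i \<and> \<not> app g i \<epsilon> app f' i)"
          by blast
        have "meU g f" "\<not> meU g f'"
          using g(2)[unfolded lg_conj[OF d_meU d_not_meU]] lg_not[OF d_meU] by simp_all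
        obtain g1 where g1: "rel g1 f" "eqU g g1" using adjust[OF g(1) f \<open>meU g f\<close>] .
        then have "col g1 \<epsilon> col f'" using f'(2) mem_col[OF f] by metis
        then obtain g2 where g2: "rel g2 f'" "col g1 = col g2" unfolding mem_col[OF f'(1)] by blast
        have "eqU g1 g2" by (rule IH[OF g1(1), rule_format, OF relD(1)[OF g2(1)] g2(2)])
        then have "eqU g g2" by (rule eqU_trans[OF g1(2)])
        then have "meU g f'" by (rule meU_cong1[OF eqU_sym relD(3)[OF g2(1)]])
        with \<open>\<not> meU g f'\<close> show False by blast
      next
        assume "lg (\<lambda>i. \<exists>y. ?P f' f i y)"
        from pick[OF dP this] obtain g where g: "fn X g" "lg (\<lambda>i. app g i \<epsilon> app f' i \<and> \<not> app g i \<epsilon> app f i)"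
          by blast
        have "meU g f'" "\<not> meU g f"
          using g(2)[unfolded lg_conj[OF d_meU d_not_meU]] lg_not[OF d_meU] by simp_all
        obtain g1 where g1: "rel g1 f'" "eqU g g1" using adjust[OF g(1) f'(1) \<open>meU g f'\<close>] .
        then have "col g1 \<epsilon> col f" using f'(2) mem_col[OF f'(1)] by metis
        then obtain g2 where g2: "rel g2 f" "col g1 = col g2" unfolding mem_col[OF f] by blast
        have "eqU g2 g1" by (rule IH[OF g2(1), rule_format, OF relD(1)[OF g1(1)] g2(2)[symmetric]])
        then have "eqU g2 g" by (rule eqU_trans[OF _ eqU_sym[OF g1(2)]])
        then have "meU g f" by (rule meU_cong1[OF _ relD(3)[OF g2(1)]])
        with \<open>\<not> meU g f\<close> show False by blast
      qed
    qed
  qed fact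
  then show ?thesis using assms(2,3) by simp
qed

lemma col_eq_iff: "fn X f \<Longrightarrow> fn X g \<Longrightarrow> col f = col g \<longleftrightarrow> eqU f g"
  using col_eqU eqU_col by blast

lemma col_mem_iff: assumes "fn X f" "fn X g" shows "col f \<epsilon> col g \<longleftrightarrow> meU f g"
proof
  assume "col f \<epsilon> col g"
  then obtain h where h: "rel h g" "col f = col h" unfolding mem_col[OF assms(2)] by blast
  have "eqU h f" by (rule eqU_sym[OF eqU_col[OF assms(1) relD(1)[OF h(1)] h(2)]])
  then show "meU f g" by (rule meU_cong1[OF _ relD(3)[OF h(1)]])
next
  assume "meU f g"
  then obtain f' where f': "rel f' g" "eqU f f'" using adjust[OF assms] by blast
  then have "col f = col f'" using col_eqU[OF assms(1) relD(1)] by blast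
  with f' show "col f \<epsilon> col g" unfolding mem_col[OF assms(2)] by blast
qed

end

section \<open>Elementary embeddings and the transfer of formulas\<close>

definition elem :: "('v \<Rightarrow> 'v \<Rightarrow> bool) \<Rightarrow> 'v set \<Rightarrow> 'v set \<Rightarrow> ('v \<Rightarrow> 'v) \<Rightarrow> bool" where
  "elem E M N j \<longleftrightarrow> (\<forall>x\<in>M. j x \<in> N) \<and>
     (\<forall>\<phi> e. range e \<subseteq> M \<longrightarrow> (sat N E \<phi> (\<lambda>n. j (e n)) \<longleftrightarrow> sat M E \<phi> e))"

lemma elem_in: "elem E M N j \<Longrightarrow> x \<in> M \<Longrightarrow> j x \<in> N"
  unfolding elem_def by blast

lemma elem_sat: "elem E M N j \<Longrightarrow> range e \<subseteq> M \<Longrightarrow> sat N E \<phi> (\<lambda>n. j (e n)) \<longleftrightarrow> sat M E \<phi> e"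
  unfolding elem_def by blast

lemma elem_fo:
  assumes "elem E M N j" "fo Q" "range e \<subseteq> M" shows "Q N E (\<lambda>n. j (e n)) \<longleftrightarrow> Q M E e"
proof -
  obtain \<phi> where \<phi>: "\<forall>M E e. range e \<subseteq> M \<longrightarrow> (Q M E e \<longleftrightarrow> sat M E \<phi> e)"
    by (rule foE[OF assms(2)])
  have "range (\<lambda>n. j (e n)) \<subseteq> N" using assms(1,3) unfolding elem_def by auto
  then show ?thesis using \<phi> elem_sat[OF assms(1,3)] assms(3) by simp
qed

lemma elem_fo1:
  assumes "elem E M N j" "fo (\<lambda>M E e. Q M E (e 0))" "a \<in> M"
  shows "Q N E (j a) \<longleftrightarrow> Q M E a"
  using elem_fo[OF assms(1,2), of "\<lambda>_. a"] assms(3) by simp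

lemma elem_fo2:
  assumes "elem E M N j" "fo (\<lambda>M E e. Q M E (e 0) (e 1))" "a \<in> M" "b \<in> M"
  shows "Q N E (j a) (j b) \<longleftrightarrow> Q M E a b"
  using elem_fo[OF assms(1,2), of "case_nat a (\<lambda>_. b)"] assms(3-) by (simp add: image_subset_iff split: nat.split)

lemma elem_fo3:
  assumes "elem E M N j" "fo (\<lambda>M E e. Q M E (e 0) (e 1) (e 2))" "a \<in> M" "b \<in> M" "c \<in> M"
  shows "Q N E (j a) (j b) (j c) \<longleftrightarrow> Q M E a b c"
  using elem_fo[OF assms(1,2), of "case_nat a (case_nat b (\<lambda>_. c))"] assms(3-)
  by (simp add: image_subset_iff numeral_2_eq_2 split: nat.split)

lemma elem_fo4:
  assumes "elem E M N j" "fo (\<lambda>M E e. Q M E (e 0) (e 1) (e 2) (e 3))"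
    "a \<in> M" "b \<in> M" "c \<in> M" "d \<in> M"
  shows "Q N E (j a) (j b) (j c) (j d) \<longleftrightarrow> Q M E a b c d"
  using elem_fo[OF assms(1,2), of "case_nat a (case_nat b (case_nat c (\<lambda>_. d)))"] assms(3-)
  by (simp add: image_subset_iff numeral_2_eq_2 numeral_3_eq_3 split: nat.split)

lemma elem_mem:
  assumes "elem E M N j" "a \<in> M" "b \<in> M" shows "E (j a) (j b) \<longleftrightarrow> E a b"
  by (rule elem_fo2[where Q = "\<lambda>M E a b. E a b", OF assms(1) fo_mem assms(2,3)])

lemma elem_inj:
  assumes "elem E M N j" "a \<in> M" "b \<in> M" shows "j a = j b \<longleftrightarrow> a = b"
  by (rule elem_fo2[where Q = "\<lambda>M E a b. a = b", OF assms(1) fo_eq assms(2,3)])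

lemma elem_comp:
  assumes "elem E M N j" "elem E N P k" shows "elem E M P (\<lambda>x. k (j x))"
  unfolding elem_def
proof (intro conjI ballI allI impI)
  fix \<phi> :: fm and e :: "nat \<Rightarrow> 'a" assume e: "range e \<subseteq> M"
  then have "range (\<lambda>n. j (e n)) \<subseteq> N" using elem_in[OF assms(1)] by auto
  then show "sat P E \<phi> (\<lambda>n. k (j (e n))) \<longleftrightarrow> sat M E \<phi> e"
    using elem_sat[OF assms(2)] elem_sat[OF assms(1) e] by simp
qed (use assms elem_in in metis)

lemma elem_cong: "elem E M N j \<Longrightarrow> (\<And>x. x \<in> M \<Longrightarrow> k x = j x) \<Longrightarrow> elem E M N k"
  unfolding elem_def by (simp add: image_subset_iff)

text \<open>Universal closure over the first \<open>n\<close> variables. Schemas are transferred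
  through their closures, because parameters in the target generally lie outside the range of the
  embedding.\<close>

primrec Alls :: "nat \<Rightarrow> fm \<Rightarrow> fm" where
  "Alls 0 \<phi> = \<phi>"
| "Alls (Suc n) \<phi> = Neg (Ex n (Neg (Alls n \<phi>)))"

lemma sat_Alls:
  "sat M E (Alls n \<phi>) e \<longleftrightarrow> (\<forall>e'. e' ` {..<n} \<subseteq> M \<longrightarrow> (\<forall>k\<ge>n. e' k = e k) \<longrightarrow> sat M E \<phi> e')"
proof (induction n arbitrary: e)
  case 0
  have "e' = e" if "\<forall>k\<ge>0. e' k = e k" for e' using that by auto
  then show ?case by auto
next
  case (Suc n)
  have "(\<forall>x\<in>M. \<forall>e'. e' ` {..<n} \<subseteq> M \<longrightarrow> (\<forall>k\<ge>n. e' k = (e(n := x)) k) \<longrightarrow> sat M E \<phi> e') \<longleftrightarrow>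
      (\<forall>e'. e' ` {..<Suc n} \<subseteq> M \<longrightarrow> (\<forall>k\<ge>Suc n. e' k = e k) \<longrightarrow> sat M E \<phi> e')"
  proof (intro iffI ballI allI impI)
    fix e' assume H: "\<forall>x\<in>M. \<forall>e'. e' ` {..<n} \<subseteq> M \<longrightarrow> (\<forall>k\<ge>n. e' k = (e(n := x)) k) \<longrightarrow> sat M E \<phi> e'"
      and e': "e' ` {..<Suc n} \<subseteq> M" "\<forall>k\<ge>Suc n. e' k = e k"
    have "e' n \<in> M" "e' ` {..<n} \<subseteq> M" using e'(1) by auto
    moreover have "\<forall>k\<ge>n. e' k = (e(n := e' n)) k" using e'(2) by auto
    ultimately show "sat M E \<phi> e'" using H by blast
  next
    fix x e' assume H: "\<forall>e'. e' ` {..<Suc n} \<subseteq> M \<longrightarrow> (\<forall>k\<ge>Suc n. e' k = e k) \<longrightarrow> sat M E \<phi> e'"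
      and x: "x \<in> M" and e': "e' ` {..<n} \<subseteq> M" "\<forall>k\<ge>n. e' k = (e(n := x)) k"
    have "e' n = x" using e'(2) by simp
    then have "e' ` {..<Suc n} \<subseteq> M" using e'(1) x by (simp add: lessThan_Suc)
    moreover have "\<forall>k\<ge>Suc n. e' k = e k" using e'(2) by simp
    ultimately show "sat M E \<phi> e'" using H by blast
  qed
  moreover have "sat M E (Alls (Suc n) \<phi>) e \<longleftrightarrow> (\<forall>x\<in>M. sat M E (Alls n \<phi>) (e(n := x)))" by simp
  ultimately show ?case unfolding Suc.IH by simp
qed

lemma fo_all_env:
  assumes "fo Q" shows "fo (\<lambda>M E e. \<forall>e'. range e' \<subseteq> M \<longrightarrow> Q M E e')"
proof -
  obtain \<phi> where \<phi>: "\<forall>M E e. range e \<subseteq> M \<longrightarrow> (Q M E e \<longleftrightarrow> sat M E \<phi> e)"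
    by (rule foE[OF assms])
  obtain n where n: "vars \<phi> \<subseteq> {..<n}" using finite_nat_set_iff_bounded finite_vars[of \<phi>] by auto
  show ?thesis
  proof (rule foI[where \<phi> = "Alls n \<phi>"])
    fix M :: "'a set" and E and e :: "nat \<Rightarrow> 'a" assume e: "range e \<subseteq> M"
    have "sat M E (Alls n \<phi>) e \<longleftrightarrow> (\<forall>e'. range e' \<subseteq> M \<longrightarrow> sat M E \<phi> e')"
      unfolding sat_Alls
    proof (intro iffI allI impI)
      fix e' :: "nat \<Rightarrow> 'a" assume H: "\<forall>e'. e' ` {..<n} \<subseteq> M \<longrightarrow> (\<forall>k\<ge>n. e' k = e k) \<longrightarrow> sat M E \<phi> e'"
        and e': "range e' \<subseteq> M"
      let ?e = "\<lambda>k. if k < n then e' k else e k"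
      have "sat M E \<phi> ?e" using H[rule_format, of ?e] e' by auto
      moreover have "sat M E \<phi> ?e \<longleftrightarrow> sat M E \<phi> e'" by (rule sat_cong) (use n in auto)
      ultimately show "sat M E \<phi> e'" by simp
    next
      fix e' :: "nat \<Rightarrow> 'a" assume H: "\<forall>e'. range e' \<subseteq> M \<longrightarrow> sat M E \<phi> e'"
        and e': "e' ` {..<n} \<subseteq> M" "\<forall>k\<ge>n. e' k = e k"
      have "e' k \<in> M" for k using e' e by (cases "k < n") auto
      then show "sat M E \<phi> e'" using H by blast
    qed
    then show "(\<forall>e'. range e' \<subseteq> M \<longrightarrow> Q M E e') \<longleftrightarrow> sat M E (Alls n \<phi>) e" using \<phi> by simp
  qed
qed

lemma fo_sat: "fo (\<lambda>M E e. sat M E \<phi> (\<lambda>n. e (f n)))"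
proof -
  obtain \<psi> where "\<forall>(M :: 'a set) E e. sat M E \<psi> e \<longleftrightarrow> sat M E \<phi> (\<lambda>n. e (f n))"
    by (rule sat_renameE)
  then show ?thesis by (intro foI[where \<phi> = \<psi>]) simp
qed

lemma elem_all_env:
  assumes "elem E M N j" "fo Q" "M \<noteq> {}" "\<forall>e. range e \<subseteq> M \<longrightarrow> Q M E e" "range e \<subseteq> N"
  shows "Q N E e"
proof -
  obtain a where "a \<in> M" using assms(3) by blast
  then show ?thesis using elem_fo[OF assms(1) fo_all_env[OF assms(2)], of "\<lambda>_. a"] assms(4,5) by auto
qed

lemma elem_closed:
  assumes "elem E M N j" "fo (\<lambda>M E e. Q M E)" "M \<noteq> {}" "Q M E"
  shows "Q N E"
proof -
  obtain a where "a \<in> M" using assms(3) by blast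
  then show ?thesis using elem_fo[OF assms(1,2), of "\<lambda>_. a"] assms(4) by simp
qed

lemma fo_separation: "fo (\<lambda>M E e. \<forall>a\<in>M. \<exists>b\<in>M. \<forall>x\<in>M. E x b \<longleftrightarrow> E x a \<and> sat M E \<phi> (e(0 := x)))"
proof (intro fo_intros)
  have "(\<lambda>n. e (Suc (Suc (Suc n))))(0 := e 0) = (\<lambda>n. e (if n = 0 then 0 else Suc (Suc (Suc n))))" for e :: "nat \<Rightarrow> 'a"
    by auto
  then show "fo (\<lambda>M E e :: nat \<Rightarrow> 'a. sat M E \<phi> ((\<lambda>n. e (Suc (Suc (Suc n))))(0 := e 0)))"
    by (simp only: fo_sat)
qed

lemma fo_replacement: "fo (\<lambda>M E e. \<forall>a\<in>M. (\<forall>x\<in>M. E x a \<longrightarrow> (\<exists>!y. y \<in> M \<and> sat M E \<phi> (e(0 := x, 1 := y)))) \<longrightarrow>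
          (\<exists>b\<in>M. \<forall>y\<in>M. E y b \<longleftrightarrow> (\<exists>x\<in>M. E x a \<and> sat M E \<phi> (e(0 := x, 1 := y)))))"
proof -
  have 1: "fo (\<lambda>M E e :: nat \<Rightarrow> 'a. sat M E \<phi> ((\<lambda>n. e (f n))(0 := e k, 1 := e l)))" for f k l
  proof -
    have "(\<lambda>n. e (f n))(0 := e k, 1 := e l) = (\<lambda>n. e (if n = 1 then l else if n = 0 then k else f n))" for e :: "nat \<Rightarrow> 'a"
      by auto
    then show ?thesis by (simp only: fo_sat)
  qed
  show ?thesis unfolding Ex1_bounded by (intro fo_intros 1)
qed

text \<open>Abstract in the two kinds of transfer, for closed statements and for statements holding
  in all environments, so that it applies both to elementary embeddings and to isomorphic
  copies.\<close>

lemma ZFC_transfer: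
  assumes c: "\<And>Q. fo (\<lambda>M E e. Q M E) \<Longrightarrow> Q M E \<Longrightarrow> Q N E'"
    and all: "\<And>Q e. fo Q \<Longrightarrow> \<forall>e. range e \<subseteq> M \<longrightarrow> Q M E e \<Longrightarrow> range e \<subseteq> N \<Longrightarrow> Q N E' e"
    and zfc: "ZFC M E"
  shows "ZFC N E'"
  unfolding ZFC_def
proof (intro conjI)
  note z = zfc[unfolded ZFC_def]
  show "\<forall>a\<in>N. \<forall>b\<in>N. (\<forall>x\<in>N. E' x a \<longleftrightarrow> E' x b) \<longrightarrow> a = b"
    by (rule c, (intro fo_intros)[1], rule z[THEN conjunct1])
  show "\<forall>a\<in>N. \<not> is_empty N E' a \<longrightarrow> (\<exists>x\<in>N. E' x a \<and> (\<forall>y\<in>N. E' y x \<longrightarrow> \<not> E' y a))"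
    by (rule c, (intro fo_intros fo_is_empty)[1], rule z[THEN conjunct2, THEN conjunct1])
  show "\<forall>a\<in>N. \<forall>b\<in>N. \<exists>c\<in>N. \<forall>x\<in>N. E' x c \<longleftrightarrow> x = a \<or> x = b"
    by (rule c, (intro fo_intros)[1], rule z[THEN conjunct2, THEN conjunct2, THEN conjunct1])
  show "\<forall>a\<in>N. \<exists>b\<in>N. \<forall>x\<in>N. E' x b \<longleftrightarrow> (\<exists>y\<in>N. E' x y \<and> E' y a)"
    by (rule c, (intro fo_intros)[1], rule z[THEN conjunct2, THEN conjunct2, THEN conjunct2, THEN conjunct1])
  show "\<forall>a\<in>N. \<exists>b\<in>N. \<forall>x\<in>N. E' x b \<longleftrightarrow> is_subset N E' x a"
    by (rule c, (intro fo_intros fo_is_subset)[1],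
        rule z[THEN conjunct2, THEN conjunct2, THEN conjunct2, THEN conjunct2, THEN conjunct1])
  show "\<exists>a\<in>N. is_inductive N E' a"
    by (rule c, (intro fo_intros fo_is_inductive)[1],
        rule z[THEN conjunct2, THEN conjunct2, THEN conjunct2, THEN conjunct2, THEN conjunct2, THEN conjunct1])
  show "\<forall>a\<in>N. (\<forall>x\<in>N. E' x a \<longrightarrow> \<not> is_empty N E' x) \<and>
        (\<forall>x\<in>N. \<forall>y\<in>N. E' x a \<and> E' y a \<and> x \<noteq> y \<longrightarrow> \<not> (\<exists>z\<in>N. E' z x \<and> E' z y)) \<longrightarrow>
        (\<exists>c\<in>N. \<forall>x\<in>N. E' x a \<longrightarrow> (\<exists>!z. z \<in> N \<and> E' z x \<and> E' z c))"
    by (rule c, (unfold Ex1_bounded, intro fo_intros fo_is_empty)[1],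
        rule z[THEN conjunct2, THEN conjunct2, THEN conjunct2, THEN conjunct2, THEN conjunct2, THEN conjunct2, THEN conjunct2, THEN conjunct2])
  show "\<forall>\<phi> e. range e \<subseteq> N \<longrightarrow>
        (\<forall>a\<in>N. \<exists>b\<in>N. \<forall>x\<in>N. E' x b \<longleftrightarrow> E' x a \<and> sat N E' \<phi> (e(0 := x)))"
    by (intro allI impI, rule all[OF fo_separation])
       (use z[THEN conjunct2, THEN conjunct2, THEN conjunct2, THEN conjunct2, THEN conjunct2, THEN conjunct2, THEN conjunct1] in metis, assumption)
  show "\<forall>\<phi> e. range e \<subseteq> N \<longrightarrow>
        (\<forall>a\<in>N. (\<forall>x\<in>N. E' x a \<longrightarrow> (\<exists>!y. y \<in> N \<and> sat N E' \<phi> (e(0 := x, 1 := y)))) \<longrightarrow>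
          (\<exists>b\<in>N. \<forall>y\<in>N. E' y b \<longleftrightarrow> (\<exists>x\<in>N. E' x a \<and> sat N E' \<phi> (e(0 := x, 1 := y)))))"
    by (intro allI impI[of "range _ \<subseteq> _"], rule all[OF fo_replacement])
       (rule z[THEN conjunct2, THEN conjunct2, THEN conjunct2, THEN conjunct2, THEN conjunct2, THEN conjunct2, THEN conjunct2, THEN conjunct1, THEN spec], assumption)
qed

lemma ZFC_elem:
  assumes j: "elem E M N j" and M: "M \<noteq> {}" and zfc: "ZFC M E"
  shows "ZFC N E"
proof (rule ZFC_transfer[OF _ _ zfc])
  show "Q N E" if "fo (\<lambda>M E e. Q M E)" "Q M E" for Q
    by (rule elem_closed[OF j that(1) M that(2)])
  show "Q N E e" if "fo Q" "\<forall>e. range e \<subseteq> M \<longrightarrow> Q M E e" "range e \<subseteq> N" for Q e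
    by (rule elem_all_env[OF j that(1) M that(2,3)])
qed

section \<open>Ultrapowers described by a seed\<close>

definition generated :: "('v \<Rightarrow> 'v \<Rightarrow> bool) \<Rightarrow> 'v set \<Rightarrow> 'v set \<Rightarrow> ('v \<Rightarrow> 'v) \<Rightarrow> 'v \<Rightarrow> 'v \<Rightarrow> bool" where
  "generated E M N j X s \<longleftrightarrow> s \<in> N \<and> E s (j X) \<and>
     (\<forall>y\<in>N. \<exists>g\<in>M. is_fun_on M E X g \<and> maps_to N E (j g) s y)"

text \<open>The trace of countable completeness on the embedding: the image of omega acquires no new
  member. It makes the ultrafilter derived from a seed countably complete.\<close>

definition omega_fixed :: "('v \<Rightarrow> 'v \<Rightarrow> bool) \<Rightarrow> 'v set \<Rightarrow> 'v set \<Rightarrow> ('v \<Rightarrow> 'v) \<Rightarrow> bool" where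
  "omega_fixed E M N j \<longleftrightarrow> (\<forall>w\<in>M. is_omega M E w \<longrightarrow> (\<forall>n\<in>N. E n (j w) \<longrightarrow> (\<exists>m\<in>M. E m w \<and> n = j m)))"

text \<open>A description in terms of the seed \<open>s\<close>, free of equivalence modulo
  \<open>Z\<close> and of the collapse; \<open>Z\<close> is recovered as the ultrafilter derived
  from \<open>s\<close>.\<close>

definition is_ultrapower :: "('v \<Rightarrow> 'v \<Rightarrow> bool) \<Rightarrow> 'v set \<Rightarrow> 'v \<Rightarrow> 'v set \<Rightarrow> ('v \<Rightarrow> 'v) \<Rightarrow> 'v \<Rightarrow> 'v \<Rightarrow> bool" where
  "is_ultrapower E M Z N j X s \<longleftrightarrow> N \<subseteq> M \<and> (\<forall>y\<in>N. \<forall>x\<in>M. E x y \<longrightarrow> x \<in> N) \<and> elem E M N j \<and>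
     j \<in> extensional M \<and> X \<in> M \<and> ultrafilter_on M E X Z \<and> generated E M N j X s \<and>
     (\<forall>A\<in>M. E A Z \<longleftrightarrow> is_subset M E A X \<and> E s (j A)) \<and> omega_fixed E M N j"

section \<open>The collapse of the ultrapower and Los's theorem\<close>

context ultra
begin

abbreviation fns :: "'v set" where "fns \<equiv> {f. fn X f}"

lemma uf_funs_eq: "uf_funs UNIV (\<epsilon>) U = fns"
  using uf_funs_iff by auto

lemma collapse: "is_collapse UNIV (\<epsilon>) U (restrict col fns)"
  unfolding is_collapse_def definable_fun_def uf_funs_eq
proof (intro conjI ballI impI)
  have "drel (\<lambda>x y. fn X x \<and> col x = y)" unfolding drel_def by (intro d_rules dterm_fun[OF dfun_col])
  then obtain \<phi> e where "\<forall>x y. sat UNIV (\<epsilon>) \<phi> (e(0 := x, 1 := y)) \<longleftrightarrow> fn X x \<and> col x = y"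
    by (rule drel_definesE)
  then show "\<exists>\<phi> e. defines_fun UNIV (\<epsilon>) \<phi> e fns (restrict col fns)"
    unfolding defines_fun_def by (intro exI[of _ \<phi>] exI[of _ e]) auto
  fix f assume "f \<in> fns"
  then have f: "fn X f" by simp
  { fix z assume "z \<epsilon> restrict col fns f"
    then obtain g where "rel g f" "z = col g" using f mem_col[OF f] by auto
    then show "z \<in> restrict col fns ` fns" using relD(1)[of g f] by (intro image_eqI[of _ _ g]) auto }
  fix g assume "g \<in> fns"
  then have g: "fn X g" by simp
  show "restrict col fns f = restrict col fns g \<longleftrightarrow> eq_mod UNIV (\<epsilon>) U f g"
    unfolding eq_mod_iff[OF f g] using f g col_eq_iff by simp
  show "restrict col fns f \<epsilon> restrict col fns g \<longleftrightarrow> mem_mod UNIV (\<epsilon>) U f g"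
    unfolding mem_mod_iff[OF f g] using f g col_mem_iff by simp
qed auto

text \<open>Two collapses agree by induction along \<open>rel\<close>. The induction applies because
  \<open>is_collapse\<close> demands a definable \<open>\<pi>\<close>.\<close>

lemma collapse_unique:
  assumes "is_collapse UNIV (\<epsilon>) U \<pi>" shows "\<pi> = restrict col fns"
proof -
  note c = assms[unfolded is_collapse_def definable_fun_def uf_funs_eq]
  have ex: "\<pi> \<in> fns \<rightarrow>\<^sub>E UNIV" using c by (elim conjE)
  have df: "\<exists>\<phi> e. defines_fun UNIV (\<epsilon>) \<phi> e fns \<pi>" using c by (elim conjE)
  have eqv: "\<forall>f\<in>fns. \<forall>g\<in>fns. \<pi> f = \<pi> g \<longleftrightarrow> eq_mod UNIV (\<epsilon>) U f g" using c by (elim conjE)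
  have mem: "\<forall>f\<in>fns. \<forall>g\<in>fns. \<pi> f \<epsilon> \<pi> g \<longleftrightarrow> mem_mod UNIV (\<epsilon>) U f g" using c by (elim conjE)
  have tr: "\<forall>f\<in>fns. \<forall>z\<in>UNIV. z \<epsilon> \<pi> f \<longrightarrow> z \<in> \<pi> ` fns" using c by (elim conjE)
  obtain \<phi> e where "defines_fun UNIV (\<epsilon>) \<phi> e fns \<pi>" using df by (elim exE)
  from defines_fun_drel[OF this] have d: "drel (\<lambda>x y. x \<in> fns \<and> \<pi> x = y)" .
  have "f \<in> fns \<and> \<pi> f = col f" if "fn X f" for f
  proof (rule rel_induct[of "\<lambda>f. f \<in> fns \<and> \<pi> f = col f"])
    show "dcls (\<lambda>f. f \<in> fns \<and> \<pi> f = col f)"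
      unfolding dcls_def by (intro dpred_rel[OF d] d_rules dterm_fun[OF dfun_col])
    fix f assume f: "fn X f" and IH: "\<And>g. rel g f \<Longrightarrow> g \<in> fns \<and> \<pi> g = col g"
    have "\<pi> f = col f"
    proof (rule ext, rule iffI)
      fix z assume z: "z \<epsilon> \<pi> f"
      then obtain g where g: "fn X g" "z = \<pi> g" using tr f by auto
      then have "meU g f" using z mem f mem_mod_iff[OF g(1) f] by auto
      from adjust[OF g(1) f this] obtain g' where g': "rel g' f" "eqU g g'" .
      have "\<pi> g = \<pi> g'" using eqv g(1) g' eq_mod_iff[OF g(1) relD(1)[OF g'(1)]] relD(1)[OF g'(1)] by simp
      then show "z \<epsilon> col f" unfolding mem_col[OF f] using g(2) g'(1) IH[OF g'(1)] by metis
    next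
      fix z assume "z \<epsilon> col f"
      then obtain g where g: "rel g f" "z = col g" unfolding mem_col[OF f] by blast
      have "\<pi> g \<epsilon> \<pi> f" using mem relD[OF g(1)] mem_mod_iff[OF relD(1,2)[OF g(1)]] by simp
      then show "z \<epsilon> \<pi> f" using IH[OF g(1)] g(2) by simp
    qed
    then show "f \<in> fns \<and> \<pi> f = col f" using f by simp
  qed fact
  then show ?thesis using ex by (intro extensionalityI[of _ fns]) (auto simp: PiE_def)
qed

lemma ult_class_eq: "ult_class UNIV (\<epsilon>) U = restrict col fns"
  unfolding ult_class_def using collapse collapse_unique by (rule the_equality)

abbreviation cst :: "'v \<Rightarrow> 'v" where "cst x \<equiv> lam X (\<lambda>_. x)"

lemma fn_cst: "fn X (cst x)" and app_cst: "i \<epsilon> X \<Longrightarrow> app (cst x) i = x"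
  using fn_lam[OF d_const] app_lam[OF d_const] by auto

lemma const_fun_eq: "const_fun UNIV (\<epsilon>) U x = cst x"
  unfolding const_fun_def uf_funs_eq X_def[symmetric]
proof (rule the_equality)
  show "cst x \<in> fns \<and> (\<forall>i\<in>UNIV. i \<epsilon> X \<longrightarrow> maps_to UNIV (\<epsilon>) (cst x) i x)"
    unfolding maps_to_iff using fn_cst app_cst opr_mem_fn[OF fn_cst] by simp
  fix f assume f: "f \<in> fns \<and> (\<forall>i\<in>UNIV. i \<epsilon> X \<longrightarrow> maps_to UNIV (\<epsilon>) f i x)"
  then have f1: "fn X f" and f2: "\<And>i. i \<epsilon> X \<Longrightarrow> opr i x \<epsilon> f" unfolding maps_to_iff by auto
  show "f = cst x"
    by (rule fn_ext[OF f1 fn_cst]) (use f2 opr_mem_fn[OF f1] app_cst in metis)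
qed

definition emb :: "'v \<Rightarrow> 'v" where "emb x = col (cst x)"

lemma ult_emb_eq: "ult_emb UNIV (\<epsilon>) U = emb"
  unfolding ult_emb_def const_fun_eq ult_class_eq emb_def[abs_def] using fn_cst by (auto simp: restrict_def)

definition N :: "'v set" where "N = col ` fns"

lemma N_iff: "y \<in> N \<longleftrightarrow> (\<exists>f. fn X f \<and> y = col f)"
  unfolding N_def by auto

lemma N_trans: "y \<in> N \<Longrightarrow> x \<epsilon> y \<Longrightarrow> x \<in> N"
  unfolding N_iff using mem_col relD(1) by metis

text \<open>Los's theorem, by induction on the external formula. In the quantifier step witnesses
  exist almost everywhere, and \<open>pick\<close> gathers them into one function by class
  choice.\<close>

lemma los:
  assumes "\<And>n. fn X (f n)"
  shows "sat N (\<epsilon>) \<phi> (\<lambda>n. col (f n)) \<longleftrightarrow> lg (\<lambda>i. sat UNIV (\<epsilon>) \<phi> (\<lambda>n. app (f n) i))"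
  using assms
proof (induction \<phi> arbitrary: f)
  case (Mem m n)
  then show ?case by (simp add: col_mem_iff)
next
  case (Eq m n)
  then show ?case by (simp add: col_eq_iff)
next
  case (Neg \<phi>)
  have "dcls (\<lambda>i. sat UNIV (\<epsilon>) \<phi> (\<lambda>n. app (f n) i))" for \<phi> unfolding dcls_def
    by (rule dpred_sat) (unfold dcls_def, simp_all add: dpred_const, intro d_rules)
  from lg_not[OF this] show ?case using Neg.IH[OF Neg.prems] by simp
next
  case (And \<phi> \<psi>)
  have "dcls (\<lambda>i. sat UNIV (\<epsilon>) \<phi> (\<lambda>n. app (f n) i))" for \<phi> unfolding dcls_def
    by (rule dpred_sat) (unfold dcls_def, simp_all add: dpred_const, intro d_rules)
  from lg_conj[OF this this] show ?case using And.IH(1)[OF And.prems] And.IH(2)[OF And.prems] by simp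
next
  case (Ex k \<phi>)
  let ?P = "\<lambda>i y. sat UNIV (\<epsilon>) \<phi> ((\<lambda>n. app (f n) i)(k := y))"
  have d: "drel ?P"
  proof -
    define t :: "nat \<Rightarrow> (nat \<Rightarrow> 'v) \<Rightarrow> 'v" where "t n = (if n = k then (\<lambda>e. e 1) else (\<lambda>e. app (f n) (e 0)))" for n
    have "dterm (t n)" for n unfolding t_def by (cases "n = k") (simp_all, (intro d_rules)+)
    then have "dpred (\<lambda>e. sat UNIV (\<epsilon>) \<phi> (\<lambda>n. t n e))"
      by (intro dpred_sat) (simp_all add: dcls_def dpred_const)
    moreover have "(\<lambda>n. t n e) = (\<lambda>n. app (f n) (e 0))(k := e 1)" for e by (auto simp: t_def)
    ultimately show ?thesis unfolding drel_def by simp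
  qed
  have upd: "sat N (\<epsilon>) \<phi> ((\<lambda>n. col (f n))(k := col g)) \<longleftrightarrow> lg (\<lambda>i. ?P i (app g i))" if g: "fn X g" for g
  proof -
    have "(\<lambda>n. col (f n))(k := col g) = (\<lambda>n. col ((f(k := g)) n))" by auto
    moreover have "(\<lambda>n. app (f n) i)(k := app g i) = (\<lambda>n. app ((f(k := g)) n) i)" for i by auto
    ultimately show ?thesis using Ex.IH[of "f(k := g)"] Ex.prems g by simp
  qed
  have "sat N (\<epsilon>) (Ex k \<phi>) (\<lambda>n. col (f n)) \<longleftrightarrow> (\<exists>g. fn X g \<and> lg (\<lambda>i. ?P i (app g i)))"
  proof
    assume "sat N (\<epsilon>) (Ex k \<phi>) (\<lambda>n. col (f n))"
    then obtain x where x: "x \<in> N" "sat N (\<epsilon>) \<phi> ((\<lambda>n. col (f n))(k := x))" by auto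
    from x(1) obtain g where g: "fn X g" "x = col g" unfolding N_iff by (elim exE conjE)
    show "\<exists>g. fn X g \<and> lg (\<lambda>i. ?P i (app g i))"
      by (intro exI[of _ g] conjI g(1)) (use x(2) upd[OF g(1)] g(2) in simp)
  next
    assume "\<exists>g. fn X g \<and> lg (\<lambda>i. ?P i (app g i))"
    then obtain g where g: "fn X g" "lg (\<lambda>i. ?P i (app g i))" by (elim exE conjE)
    have "col g \<in> N" using g(1) N_iff by blast
    then show "sat N (\<epsilon>) (Ex k \<phi>) (\<lambda>n. col (f n))" using g(2) upd[OF g(1)] by auto
  qed
  also have "\<dots> \<longleftrightarrow> lg (\<lambda>i. \<exists>y. ?P i y)"
  proof
    assume ex: "lg (\<lambda>i. \<exists>y. ?P i y)"
    show "\<exists>g. fn X g \<and> lg (\<lambda>i. ?P i (app g i))"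
      by (rule pick[OF d ex]) (intro exI conjI, assumption+)
  next
    assume "\<exists>g. fn X g \<and> lg (\<lambda>i. ?P i (app g i))"
    then obtain g where "lg (\<lambda>i. ?P i (app g i))" by (elim exE conjE)
    then show "lg (\<lambda>i. \<exists>y. ?P i y)"
      by (rule lg_mono) (unfold dcls_def, intro d_rules dpred_rel[OF d], rule exI)
  qed
  finally show ?case by simp
qed

lemma los_fo:
  assumes "fo Q" "\<And>n. fn X (f n)"
  shows "Q N (\<epsilon>) (\<lambda>n. col (f n)) \<longleftrightarrow> lg (\<lambda>i. Q UNIV (\<epsilon>) (\<lambda>n. app (f n) i))"
proof -
  obtain \<phi> where \<phi>: "\<forall>M E e. range e \<subseteq> M \<longrightarrow> (Q M E e \<longleftrightarrow> sat M E \<phi> e)"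
    by (rule foE[OF assms(1)])
  have "range (\<lambda>n. col (f n)) \<subseteq> N" using assms(2) N_iff by auto
  then show ?thesis using \<phi> los[OF assms(2)] by simp
qed

lemma elem_emb: "elem (\<epsilon>) UNIV N emb"
  unfolding elem_def
proof (intro conjI allI impI ballI)
  show "emb x \<in> N" for x unfolding emb_def N_iff using fn_cst by auto
  fix \<phi> :: fm and e :: "nat \<Rightarrow> 'v"
  have "lg (\<lambda>i. sat UNIV (\<epsilon>) \<phi> (\<lambda>n. app (cst (e n)) i)) \<longleftrightarrow> lg (\<lambda>i. sat UNIV (\<epsilon>) \<phi> e)"
    by (rule lg_cong) (simp add: app_cst)
  then show "sat N (\<epsilon>) \<phi> (\<lambda>n. emb (e n)) \<longleftrightarrow> sat UNIV (\<epsilon>) \<phi> e"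
    unfolding emb_def los[OF fn_cst] by simp
qed

definition sd :: 'v where "sd = col (lam X (\<lambda>i. i))"

lemma fn_id: "fn X (lam X (\<lambda>i. i))" and app_id: "i \<epsilon> X \<Longrightarrow> app (lam X (\<lambda>i. i)) i = i"
  using fn_lam[OF dfun_id] app_lam[OF dfun_id] by auto

lemma sd_mem: "sd \<epsilon> emb A \<longleftrightarrow> lg (\<lambda>i. i \<epsilon> A)"
  unfolding sd_def emb_def col_mem_iff[OF fn_id fn_cst]
  by (rule lg_cong) (simp add: app_cst app_id)

text \<open>The identity \<open>[f] = j(f)([id])\<close>: by Los's theorem it says that
  \<open>f\<close> maps \<open>i\<close> to \<open>app f i\<close> for almost every
  \<open>i\<close>.\<close>

lemma sd_gen: assumes f: "fn X f" shows "maps_to N (\<epsilon>) (emb f) sd (col f)"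
proof -
  let ?f = "case_nat (cst f) (case_nat (lam X (\<lambda>i. i)) (\<lambda>_. f))"
  have "fn X (?f n)" for n using f fn_id fn_cst by (simp split: nat.split)
  from los_fo[where f = ?f, OF fo_maps_to[of 0 1 2] this]
  have "maps_to N (\<epsilon>) (emb f) sd (col f) \<longleftrightarrow>
      lg (\<lambda>i. maps_to UNIV (\<epsilon>) (app (cst f) i) (app (lam X (\<lambda>i. i)) i) (app f i))"
    by (simp add: emb_def sd_def numeral_2_eq_2)
  also have "\<dots> \<longleftrightarrow> lg (\<lambda>i. True)"
    by (rule lg_cong) (simp add: app_cst app_id maps_to_iff opr_mem_fn[OF f])
  finally show ?thesis by simp
qed

text \<open>A function with values in \<open>om\<close> almost everywhere is constant almost
  everywhere: otherwise it would avoid each single value almost everywhere, and by countable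
  completeness all of them together.\<close>

lemma emb_om: assumes "n \<epsilon> emb om" obtains m where "m \<epsilon> om" "n = emb m"
proof -
  have "n \<in> N" using assms elem_in[OF elem_emb, of om] N_trans by auto
  then obtain f where f: "fn X f" "n = col f" unfolding N_iff by blast
  have "meU f (cst om)" using assms unfolding f(2) emb_def col_mem_iff[OF f(1) fn_cst] .
  moreover have "meU f (cst om) \<longleftrightarrow> lg (\<lambda>i. app f i \<epsilon> om)" by (rule lg_cong) (simp add: app_cst)
  ultimately have 1: "lg (\<lambda>i. app f i \<epsilon> om)" by simp
  have "\<exists>m. m \<epsilon> om \<and> lg (\<lambda>i. app f i = m)"
  proof (rule ccontr)
    assume "\<not> (\<exists>m. m \<epsilon> om \<and> lg (\<lambda>i. app f i = m))"
    moreover have d: "dcls (\<lambda>i. app f i = m)" for m unfolding dcls_def by (intro d_rules)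
    ultimately have "lg (\<lambda>i. \<not> app f i = m)" if "m \<epsilon> om" for m using that lg_not[OF d] by simp
    then have "lg (\<lambda>i. \<forall>m. m \<epsilon> om \<longrightarrow> \<not> app f i = m)"
      by (intro lg_countable) (unfold drel_def, intro d_rules)
    then have "lg (\<lambda>i. \<not> app f i \<epsilon> om)"
      by (rule lg_mono) (unfold dcls_def, intro d_rules, metis)
    moreover have "dcls (\<lambda>i. app f i \<epsilon> om)" unfolding dcls_def by (intro d_rules)
    ultimately show False using lg_not 1 by blast
  qed
  then obtain m where m: "m \<epsilon> om" "lg (\<lambda>i. app f i = m)" by blast
  have "eqU f (cst m) \<longleftrightarrow> lg (\<lambda>i. app f i = m)" by (rule lg_cong) (simp add: app_cst)
  then have "n = emb m" unfolding f(2) emb_def using m(2) col_eq_iff[OF f(1) fn_cst] by simp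
  with m show thesis using that by blast
qed

theorem is_ultrapower_emb: "is_ultrapower (\<epsilon>) UNIV U N emb X sd"
  unfolding is_ultrapower_def
proof (intro conjI ballI impI)
  show "elem (\<epsilon>) UNIV N emb" by (rule elem_emb)
  show "generated (\<epsilon>) UNIV N emb X sd"
    unfolding generated_def
  proof (intro conjI ballI)
    show "sd \<in> N" unfolding sd_def N_iff using fn_id by blast
    show "sd \<epsilon> emb X" unfolding sd_mem using lg_cong[of "\<lambda>i. i \<epsilon> X" "\<lambda>_. True"] by simp
    fix y assume "y \<in> N"
    then show "\<exists>g\<in>UNIV. fn X g \<and> maps_to N (\<epsilon>) (emb g) sd y"
      unfolding N_iff using sd_gen by blast
  qed
  show "ultrafilter_on UNIV (\<epsilon>) X U" by (rule ultrafilter)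
  fix A
  show "A \<epsilon> U \<longleftrightarrow> is_subset UNIV (\<epsilon>) A X \<and> sd \<epsilon> emb A"
  proof
    assume A: "A \<epsilon> U"
    then show "is_subset UNIV (\<epsilon>) A X \<and> sd \<epsilon> emb A"
      unfolding is_subset_def sd_mem lg_def using U_sub[OF A] by blast
  next
    assume A: "is_subset UNIV (\<epsilon>) A X \<and> sd \<epsilon> emb A"
    then obtain B where B: "B \<epsilon> U" "\<forall>x. x \<epsilon> B \<longleftrightarrow> x \<epsilon> X \<and> x \<epsilon> A" unfolding sd_mem lg_def by blast
    have "A = B" by (rule ext) (use A B(2) in \<open>auto simp: is_subset_def\<close>)
    with B(1) show "A \<epsilon> U" by simp
  qed
next
  show "omega_fixed (\<epsilon>) UNIV N emb"
    unfolding omega_fixed_def is_omega_iff using emb_om by blast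
qed (use N_trans in auto)

end

section \<open>First-order formulas for collapse, ultrapower and embedding\<close>

context
  fixes M :: "'v set" and E :: "'v \<Rightarrow> 'v \<Rightarrow> bool"
begin

text \<open>The relation \<open>rel\<close> relativised to \<open>M\<close>; \<open>X\<close> and
  \<open>Z\<close> are explicit arguments so that elementary embeddings can move them.\<close>

definition relr :: "'v \<Rightarrow> 'v \<Rightarrow> 'v \<Rightarrow> 'v \<Rightarrow> bool" where
  "relr X Z g f \<longleftrightarrow> is_fun_on M E X g \<and> is_fun_on M E X f \<and>
     (\<exists>A\<in>M. E A Z \<and> (\<forall>x\<in>M. E x A \<longleftrightarrow> E x X \<and>
        (\<exists>y\<in>M. \<exists>z\<in>M. maps_to M E g x y \<and> maps_to M E f x z \<and> E y z))) \<and>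
     (\<forall>T\<in>M. (\<forall>x\<in>M. \<forall>y\<in>M. E x T \<longrightarrow> E y x \<longrightarrow> E y T) \<longrightarrow>
        (\<forall>i\<in>M. \<forall>y\<in>M. E i X \<longrightarrow> maps_to M E f i y \<longrightarrow> E y T) \<longrightarrow>
        (\<forall>i\<in>M. \<forall>y\<in>M. E i X \<longrightarrow> maps_to M E g i y \<longrightarrow> E y T))"

text \<open>\<open>v\<close> is the collapse of \<open>f\<close>. Instead of a recursion, a set
  function \<open>h\<close> on a closed set \<open>D\<close> satisfies the recursion equation; this
  replaces a definition by description with a formula.\<close>

definition colrel :: "'v \<Rightarrow> 'v \<Rightarrow> 'v \<Rightarrow> bool" where
  "colrel Z f v \<longleftrightarrow> (\<exists>X\<in>M. ultrafilter_on M E X Z \<and> is_fun_on M E X f \<and>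
     (\<exists>D\<in>M. \<exists>h\<in>M. E f D \<and> is_fun_on M E D h \<and> maps_to M E h f v \<and>
       (\<forall>x\<in>M. \<forall>y\<in>M. E x D \<longrightarrow> relr X Z y x \<longrightarrow> E y D) \<and>
       (\<forall>x\<in>M. \<forall>w\<in>M. E x D \<longrightarrow> maps_to M E h x w \<longrightarrow>
          (\<forall>z\<in>M. E z w \<longleftrightarrow> (\<exists>y\<in>M. relr X Z y x \<and> maps_to M E h y z)))))"

definition uemb :: "'v \<Rightarrow> 'v \<Rightarrow> 'v \<Rightarrow> bool" where
  "uemb Z x v \<longleftrightarrow> (\<exists>f\<in>M. (\<exists>X\<in>M. ultrafilter_on M E X Z \<and> is_fun_on M E X f \<and>
     (\<forall>i\<in>M. E i X \<longrightarrow> maps_to M E f i x)) \<and> colrel Z f v)"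

definition umem :: "'v \<Rightarrow> 'v \<Rightarrow> bool" where
  "umem Z v \<longleftrightarrow> (\<exists>f\<in>M. colrel Z f v)"

definition ccu :: "'v \<Rightarrow> bool" where
  "ccu Z \<longleftrightarrow> (\<exists>X\<in>M. ultrafilter_on M E X Z \<and> countably_complete M E X Z)"

end

lemma fo_relr: "fo (\<lambda>M E e. relr M E (e a) (e b) (e c) (e d))"
  unfolding relr_def by (intro fo_intros fo_basic)

lemma fo_colrel: "fo (\<lambda>M E e. colrel M E (e a) (e b) (e c))"
  unfolding colrel_def by (intro fo_intros fo_basic fo_relr)

lemma fo_uemb: "fo (\<lambda>M E e. uemb M E (e a) (e b) (e c))"
  unfolding uemb_def by (intro fo_intros fo_basic fo_colrel)

lemma fo_umem: "fo (\<lambda>M E e. umem M E (e a) (e b))"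
  unfolding umem_def by (intro fo_intros fo_colrel)

lemma fo_ccu: "fo (\<lambda>M E e. ccu M E (e a))"
  unfolding ccu_def by (intro fo_intros fo_basic)

lemma ccu_iff: "Z \<in> M \<Longrightarrow> ccu M E Z \<longleftrightarrow> cc_ultrafilter M E Z"
  unfolding ccu_def cc_ultrafilter_def by simp

context ultra
begin

lemma space_unique: "ultrafilter_on UNIV (\<epsilon>) Y U \<longleftrightarrow> Y = X"
proof
  assume Y: "ultrafilter_on UNIV (\<epsilon>) Y U"
  show "Y = X"
    by (rule ext) (use uf_sub[OF Y U_space] U_sub[OF uf_space[OF Y]] in blast)
qed (use ultrafilter in simp)

lemma relr_iff: "relr UNIV (\<epsilon>) X U g f \<longleftrightarrow> rel g f"
proof (cases "fn X g \<and> fn X f")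
  case True
  then have g: "fn X g" and f: "fn X f" by auto
  show ?thesis
    unfolding relr_def rel_def lg_def trans_def maps_to_iff
    by (simp add: opr_mem_fn[OF g] opr_mem_fn[OF f] g f cong: conj_cong imp_cong)
next
  case False
  then show ?thesis unfolding relr_def rel_def by blast
qed

lemma colrel_unfold: "colrel UNIV (\<epsilon>) U f v \<longleftrightarrow> fn X f \<and> (\<exists>D h. f \<epsilon> D \<and> fn D h \<and> opr f v \<epsilon> h \<and>
    (\<forall>x y. x \<epsilon> D \<longrightarrow> rel y x \<longrightarrow> y \<epsilon> D) \<and>
    (\<forall>x w. x \<epsilon> D \<longrightarrow> opr x w \<epsilon> h \<longrightarrow> (\<forall>z. z \<epsilon> w \<longleftrightarrow> (\<exists>y. rel y x \<and> opr y z \<epsilon> h))))"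
proof -
  have "colrel UNIV (\<epsilon>) U f v \<longleftrightarrow> fn X f \<and> (\<exists>D\<in>UNIV. \<exists>h\<in>UNIV. f \<epsilon> D \<and> fn D h \<and> opr f v \<epsilon> h \<and>
    (\<forall>x\<in>UNIV. \<forall>y\<in>UNIV. x \<epsilon> D \<longrightarrow> rel y x \<longrightarrow> y \<epsilon> D) \<and>
    (\<forall>x\<in>UNIV. \<forall>w\<in>UNIV. x \<epsilon> D \<longrightarrow> opr x w \<epsilon> h \<longrightarrow> (\<forall>z\<in>UNIV. z \<epsilon> w \<longleftrightarrow> (\<exists>y\<in>UNIV. rel y x \<and> opr y z \<epsilon> h))))"
    unfolding colrel_def space_unique maps_to_iff relr_iff[symmetric] by blast
  then show ?thesis by (simp only: ball_UNIV bex_UNIV)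
qed

text \<open>A witness \<open>h\<close> is an attempt at the recursion, so it takes the values of
  \<open>col\<close>; conversely the restriction of \<open>col\<close> to a closed set is a
  witness.\<close>

lemma colrel_iff: "colrel UNIV (\<epsilon>) U f v \<longleftrightarrow> fn X f \<and> v = col f"
proof
  assume "colrel UNIV (\<epsilon>) U f v"
  then obtain D h where f: "fn X f" and fD: "f \<epsilon> D" and h: "fn D h" and m: "opr f v \<epsilon> h"
    and cl0: "\<forall>x y. x \<epsilon> D \<longrightarrow> rel y x \<longrightarrow> y \<epsilon> D"
    and r: "\<forall>x w. x \<epsilon> D \<longrightarrow> opr x w \<epsilon> h \<longrightarrow> (\<forall>z. z \<epsilon> w \<longleftrightarrow> (\<exists>y. rel y x \<and> opr y z \<epsilon> h))"
    unfolding colrel_unfold by (elim exE conjE)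
  note cl = cl0[rule_format]
  have "attempt rel (\<lambda>s. s) D h"
    unfolding attempt_def
  proof (intro conjI allI impI)
    show "closed rel D" using cl unfolding closed_def by blast
    fix x assume x: "x \<epsilon> D"
    have "opr x (app h x) \<epsilon> h" using opr_mem_fn[OF h x] by simp
    from r[rule_format, OF x this] have "z \<epsilon> app h x \<longleftrightarrow> (\<exists>y. rel y x \<and> opr y z \<epsilon> h)" for z .
    moreover have "rel y x \<and> opr y z \<epsilon> h \<longleftrightarrow> rel y x \<and> z = app h y" for y z
      using opr_mem_fn[OF h cl[OF x]] by blast
    ultimately have "z \<epsilon> app h x \<longleftrightarrow> (\<exists>y. rel y x \<and> z = app h y)" for z by simp
    then show "app h x = mk {z. \<exists>y. rel y x \<and> z = app h y}" by (intro mk_eqI[symmetric]) simp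
  qed (fact h)
  from wrec_attempt[OF drel_rel wfr_rel this fD] show "fn X f \<and> v = col f"
    using f m opr_mem_fn[OF h fD] unfolding col_def by simp
next
  assume H: "fn X f \<and> v = col f"
  then have f: "fn X f" by simp
  obtain D where D: "closed rel D" "f \<epsilon> D" by (rule fns_closed[OF f])
  let ?h = "lam D col"
  have m: "opr x w \<epsilon> ?h \<longleftrightarrow> x \<epsilon> D \<and> w = col x" for x w by (auto simp: mem_lam[OF dfun_col])
  have "z \<epsilon> col x \<longleftrightarrow> (\<exists>y. rel y x \<and> opr y z \<epsilon> ?h)" if x: "x \<epsilon> D" for x z
  proof -
    have "col x = mk {z. \<exists>y. rel y x \<and> z = col y}"
      unfolding col_def by (rule wrec[OF drel_rel dfun_id wfr_rel D(1) x])
    then have "z \<epsilon> col x \<longleftrightarrow> (\<exists>y. rel y x \<and> z = col y)"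
      using mem_mk[OF small_image[OF drel_rel dfun_col D(1) x]] by simp
    then show ?thesis unfolding m using D(1) x unfolding closed_def by blast
  qed
  then have "\<forall>x w. x \<epsilon> D \<longrightarrow> opr x w \<epsilon> ?h \<longrightarrow> (\<forall>z. z \<epsilon> w \<longleftrightarrow> (\<exists>y. rel y x \<and> opr y z \<epsilon> ?h))"
    using m by simp
  moreover have "\<forall>x y. x \<epsilon> D \<longrightarrow> rel y x \<longrightarrow> y \<epsilon> D" using D(1) unfolding closed_def .
  moreover have "opr f v \<epsilon> ?h" using m D(2) H by simp
  ultimately show "colrel UNIV (\<epsilon>) U f v"
    unfolding colrel_unfold using f D(2) fn_lam[OF dfun_col]
    by (intro conjI exI[of _ D] exI[of _ ?h]) assumption+
qed

lemma uemb_iff: "uemb UNIV (\<epsilon>) U x v \<longleftrightarrow> emb x = v"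
proof -
  have "(\<exists>Y\<in>UNIV. ultrafilter_on UNIV (\<epsilon>) Y U \<and> fn Y f \<and> (\<forall>i\<in>UNIV. i \<epsilon> Y \<longrightarrow> maps_to UNIV (\<epsilon>) f i x))
      \<longleftrightarrow> f = cst x" for f
  proof -
    have "f = cst x" if f: "fn X f" and m: "\<forall>i. i \<epsilon> X \<longrightarrow> opr i x \<epsilon> f"
      by (rule fn_ext[OF f fn_cst]) (use m opr_mem_fn[OF f] app_cst in metis)
    then show ?thesis unfolding space_unique maps_to_iff using fn_cst opr_mem_fn[OF fn_cst] app_cst by auto
  qed
  then show ?thesis unfolding uemb_def colrel_iff emb_def using fn_cst by auto
qed

lemma umem_iff: "umem UNIV (\<epsilon>) U v \<longleftrightarrow> v \<in> N"
  unfolding umem_def colrel_iff N_iff by simp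

end

section \<open>Isomorphic copies\<close>

definition pull :: "('v \<Rightarrow> 'v) \<Rightarrow> ('v \<Rightarrow> 'v \<Rightarrow> bool) \<Rightarrow> 'v \<Rightarrow> 'v \<Rightarrow> bool" where
  "pull h E x y \<longleftrightarrow> E (h x) (h y)"

lemma sat_iso:
  assumes "inj h"
  shows "sat (h ` A) E \<phi> (\<lambda>n. h (e n)) \<longleftrightarrow> sat A (pull h E) \<phi> e"
proof (induction \<phi> arbitrary: e)
  case (Ex k \<phi>)
  have upd: "(\<lambda>n. h (e n))(k := h x) = (\<lambda>n. h ((e(k := x)) n))" for x by auto
  have "sat (h ` A) E (Ex k \<phi>) (\<lambda>n. h (e n)) \<longleftrightarrow>
      (\<exists>x\<in>A. sat (h ` A) E \<phi> ((\<lambda>n. h (e n))(k := h x)))" by auto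
  then show ?case by (simp only: upd Ex.IH sat.simps)
qed (simp_all add: pull_def inj_eq[OF assms])

lemma fo_iso:
  assumes "inj h" "fo Q" "range e \<subseteq> A"
  shows "Q (h ` A) E (\<lambda>n. h (e n)) \<longleftrightarrow> Q A (pull h E) e"
proof -
  obtain \<phi> where \<phi>: "\<forall>M E e. range e \<subseteq> M \<longrightarrow> (Q M E e \<longleftrightarrow> sat M E \<phi> e)"
    by (rule foE[OF assms(2)])
  have "range (\<lambda>n. h (e n)) \<subseteq> h ` A" using assms(3) by auto
  then show ?thesis using \<phi> assms(3) sat_iso[OF assms(1)] by simp
qed

lemma fo_iso1:
  assumes "inj h" "fo (\<lambda>M E e. Q M E (e 0))" "a \<in> A"
  shows "Q (h ` A) E (h a) \<longleftrightarrow> Q A (pull h E) a"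
  using fo_iso[OF assms(1,2), of "\<lambda>_. a"] assms(3) by simp

lemma fo_iso2:
  assumes "inj h" "fo (\<lambda>M E e. Q M E (e 0) (e 1))" "a \<in> A" "b \<in> A"
  shows "Q (h ` A) E (h a) (h b) \<longleftrightarrow> Q A (pull h E) a b"
  using fo_iso[OF assms(1,2), of "case_nat a (\<lambda>_. b)"] assms(3-) by (simp add: image_subset_iff split: nat.split)

lemma fo_iso3:
  assumes "inj h" "fo (\<lambda>M E e. Q M E (e 0) (e 1) (e 2))" "a \<in> A" "b \<in> A" "c \<in> A"
  shows "Q (h ` A) E (h a) (h b) (h c) \<longleftrightarrow> Q A (pull h E) a b c"
  using fo_iso[OF assms(1,2), of "case_nat a (case_nat b (\<lambda>_. c))"] assms(3-)
  by (simp add: image_subset_iff numeral_2_eq_2 split: nat.split)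

lemma ZFC_iso:
  assumes h: "inj h" and zfc: "ZFC (range h) E" shows "ZFC UNIV (pull h E)"
proof (rule ZFC_transfer[OF _ _ zfc])
  fix Q assume "fo (\<lambda>M E (e :: nat \<Rightarrow> 'a). Q M E)" "Q (range h) E"
  then show "Q UNIV (pull h E)" using fo_iso[OF h, of "\<lambda>M E e. Q M E" "\<lambda>_. undefined" UNIV E] by simp
next
  fix Q and e :: "nat \<Rightarrow> 'a" assume "fo Q" "\<forall>e. range e \<subseteq> range h \<longrightarrow> Q (range h) E e"
  then show "Q UNIV (pull h E) e" using fo_iso[OF h, of Q e UNIV E] by (simp add: image_subset_iff)
qed

text \<open>
  An ultrapower is equinumerous with the universe, so whatever holds for every model of ZFC
  carried by the whole type transfers to it along a bijection \<open>h\<close>.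
\<close>

locale copy =
  fixes E :: "'v \<Rightarrow> 'v \<Rightarrow> bool" and h :: "'v \<Rightarrow> 'v" and M :: "'v set" and Z :: 'v
  assumes h: "inj h" and M: "M = range h" and zfcM: "ZFC M E" and Z: "cc_ultrafilter M E (h Z)"
begin

definition E' where "E' = pull h E"

lemmas iso1 = fo_iso1[OF h, where A = UNIV and E = E, folded E'_def M, OF _ UNIV_I]
lemmas iso2 = fo_iso2[OF h, where A = UNIV and E = E, folded E'_def M, OF _ UNIV_I UNIV_I]
lemmas iso3 = fo_iso3[OF h, where A = UNIV and E = E, folded E'_def M, OF _ UNIV_I UNIV_I UNIV_I]

lemma Z': "cc_ultrafilter UNIV E' Z"
proof -
  have "ccu M E (h Z)" using Z ccu_iff[of "h Z" M E] unfolding cc_ultrafilter_def by simp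
  then have "ccu UNIV E' Z" using iso1[where Q = ccu, OF fo_ccu] by simp
  then show ?thesis by (simp add: ccu_iff)
qed

sublocale u: ultra E' Z
  by unfold_locales (use ZFC_iso[OF h] zfcM Z' in \<open>simp_all add: M E'_def\<close>)

lemma ball_M: "(\<forall>x\<in>M. P x) \<longleftrightarrow> (\<forall>x. P (h x))" and bex_M: "(\<exists>x\<in>M. P x) \<longleftrightarrow> (\<exists>x. P (h x))"
  by (auto simp: M)

lemma hM [simp]: "h x \<in> M" by (simp add: M)

lemma h_eq [simp]: "h x = h y \<longleftrightarrow> x = y" using h by (simp add: inj_eq)

lemma E_iff: "E (h x) (h y) \<longleftrightarrow> E' x y" by (simp add: E'_def pull_def)

lemma space_iff: "Y \<in> M \<and> ultrafilter_on M E Y (h Z) \<longleftrightarrow> Y = h u.X"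
proof
  assume "Y \<in> M \<and> ultrafilter_on M E Y (h Z)"
  moreover from this obtain Y' where Y': "Y = h Y'" by (auto simp: M)
  ultimately have "ultrafilter_on UNIV E' Y' Z"
    using iso2[where Q = ultrafilter_on, OF fo_ultrafilter_on] by simp
  then show "Y = h u.X" using u.space_unique Y' by simp
next
  assume "Y = h u.X"
  then show "Y \<in> M \<and> ultrafilter_on M E Y (h Z)"
    using iso2[where Q = ultrafilter_on, OF fo_ultrafilter_on] u.ultrafilter by simp
qed

lemma space: "uf_space M E (h Z) = h u.X"
  unfolding uf_space_def space_iff by simp

lemma maps_h: "maps_to M E (h f) (h x) (h y) \<longleftrightarrow> maps_to UNIV E' f x y"
  by (rule iso3[where Q = maps_to, OF fo_maps_to])

lemma fun_h: "is_fun_on M E (h x) (h y) \<longleftrightarrow> is_fun_on UNIV E' x y"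
  by (rule iso2[where Q = is_fun_on, OF fo_is_fun_on])

lemma funs: "uf_funs M E (h Z) = h ` uf_funs UNIV E' Z"
  unfolding uf_funs_def space u.X_def[symmetric] using fun_h by (auto simp: M)

lemma eq_mod_h: "eq_mod M E (h Z) (h f) (h g) \<longleftrightarrow> eq_mod UNIV E' Z f g"
  unfolding eq_mod_def space u.X_def[symmetric] ball_M bex_M by (simp add: E_iff maps_h)

lemma mem_mod_h: "mem_mod M E (h Z) (h f) (h g) \<longleftrightarrow> mem_mod UNIV E' Z f g"
  unfolding mem_mod_def space u.X_def[symmetric] ball_M bex_M by (simp add: E_iff maps_h)

lemma defines_h:
  assumes "\<And>f. f \<in> D \<Longrightarrow> \<pi> (h f) = h (\<pi>' f)"
  shows "defines_fun M E \<phi> (\<lambda>n. h (e n)) (h ` D) \<pi> \<longleftrightarrow> defines_fun UNIV E' \<phi> e D \<pi>'"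
proof -
  have "(\<lambda>n. h (e n))(0 := h x, 1 := h y) = (\<lambda>n. h ((e(0 := x, 1 := y)) n))" for x y by auto
  then have "sat M E \<phi> ((\<lambda>n. h (e n))(0 := h x, 1 := h y)) \<longleftrightarrow> sat UNIV E' \<phi> (e(0 := x, 1 := y))" for x y
    using sat_iso[OF h, of UNIV E \<phi> "e(0 := x, 1 := y)"] by (simp add: M E'_def)
  moreover have "h x \<in> h ` D \<longleftrightarrow> x \<in> D" for x by auto
  moreover have "x \<in> D \<and> \<pi> (h x) = h y \<longleftrightarrow> x \<in> D \<and> \<pi>' x = y" for x y using assms by auto
  ultimately show ?thesis unfolding defines_fun_def ball_M by (simp add: image_subset_iff)
qed

text \<open>Definability survives although \<open>h\<close> is an arbitrary injection of HOL: the
  same formula is used, with its parameters moved along \<open>h\<close>.\<close>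

lemma collapse_h:
  assumes \<pi>: "\<And>f. f \<in> u.fns \<Longrightarrow> \<pi> (h f) = h (\<pi>' f)" "\<pi> \<in> extensional (h ` u.fns)" "\<pi>' \<in> extensional u.fns"
  shows "is_collapse M E (h Z) \<pi> \<longleftrightarrow> is_collapse UNIV E' Z \<pi>'"
proof -
  have "(\<exists>\<phi> e. defines_fun M E \<phi> e (h ` u.fns) \<pi>) \<longleftrightarrow> (\<exists>\<phi> e. defines_fun UNIV E' \<phi> e u.fns \<pi>')"
  proof
    assume "\<exists>\<phi> e. defines_fun M E \<phi> e (h ` u.fns) \<pi>"
    then obtain \<phi> e where d: "defines_fun M E \<phi> e (h ` u.fns) \<pi>" by (elim exE)
    then have "range e \<subseteq> range h" unfolding defines_fun_def M by simp
    then have "\<forall>n. \<exists>x. e n = h x" by (auto simp: image_subset_iff image_iff)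
    then obtain e' where "e = (\<lambda>n. h (e' n))" by metis
    with d defines_h[where \<pi> = \<pi> and \<pi>' = \<pi>', OF \<pi>(1), of u.fns \<phi> e'] show "\<exists>\<phi> e. defines_fun UNIV E' \<phi> e u.fns \<pi>'" by auto
  next
    assume "\<exists>\<phi> e. defines_fun UNIV E' \<phi> e u.fns \<pi>'"
    then obtain \<phi> e where d: "defines_fun UNIV E' \<phi> e u.fns \<pi>'" by (elim exE)
    with defines_h[where \<pi> = \<pi> and \<pi>' = \<pi>', OF \<pi>(1), of u.fns \<phi> e] show "\<exists>\<phi> e. defines_fun M E \<phi> e (h ` u.fns) \<pi>" by auto
  qed
  moreover have "\<pi> \<in> h ` u.fns \<rightarrow>\<^sub>E M" "\<pi>' \<in> u.fns \<rightarrow>\<^sub>E UNIV" "h ` u.fns \<subseteq> M"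
    using \<pi> by (auto simp: PiE_def)
  ultimately have "definable_fun M E (h ` u.fns) \<pi> \<longleftrightarrow> definable_fun UNIV E' u.fns \<pi>'"
    unfolding definable_fun_def by simp
  moreover have "h z \<in> \<pi> ` h ` u.fns \<longleftrightarrow> z \<in> \<pi>' ` u.fns" for z
    using \<pi>(1) by (force simp: image_iff)
  ultimately show ?thesis
    unfolding is_collapse_def funs u.uf_funs_eq ball_M
    using \<pi>(1) by (simp add: E_iff eq_mod_h mem_mod_h)
qed

definition \<pi>M :: "'v \<Rightarrow> 'v" where "\<pi>M = (\<lambda>f\<in>h ` u.fns. h (u.col (inv h f)))"

lemma \<pi>M: "\<pi>M (h f) = h (u.col f)" if "f \<in> u.fns"
  using that h by (simp add: \<pi>M_def)

text \<open>A rival collapse is pulled back along \<open>h\<close> to a collapse over the whole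
  type, where uniqueness is known.\<close>

lemma ult_class_h: "ult_class M E (h Z) = \<pi>M"
  unfolding ult_class_def
proof (rule the_equality)
  show "is_collapse M E (h Z) \<pi>M"
    using collapse_h[of \<pi>M "restrict u.col u.fns"] \<pi>M u.collapse by (simp add: \<pi>M_def)
  fix \<pi> assume c: "is_collapse M E (h Z) \<pi>"
  then have \<pi>: "\<pi> \<in> h ` u.fns \<rightarrow>\<^sub>E M"
    unfolding is_collapse_def definable_fun_def funs u.uf_funs_eq by (elim conjE)
  define \<pi>' where "\<pi>' = (\<lambda>f\<in>u.fns. inv h (\<pi> (h f)))"
  have 1: "\<pi> (h f) = h (\<pi>' f)" if "f \<in> u.fns" for f
  proof -
    have "\<pi> (h f) \<in> range h" using \<pi> that unfolding M by auto
    then show ?thesis using that by (simp add: \<pi>'_def f_inv_into_f)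
  qed
  have "is_collapse UNIV E' Z \<pi>'"
    using collapse_h[where \<pi> = \<pi> and \<pi>' = \<pi>', OF 1] c \<pi> by (simp add: \<pi>'_def PiE_def)
  then have "\<pi>' = restrict u.col u.fns" by (rule u.collapse_unique)
  then show "\<pi> = \<pi>M"
    using 1 \<pi> \<pi>M by (intro extensionalityI[of _ "h ` u.fns"]) (auto simp: PiE_def \<pi>M_def)
qed

lemma ult_h: "ult M E (h Z) = h ` u.N"
  unfolding ult_def ult_class_h funs u.uf_funs_eq u.N_def using \<pi>M by (force simp: image_iff)

lemma const_h: "const_fun M E (h Z) (h x) = h (u.cst x)"
  unfolding const_fun_def funs space u.uf_funs_eq
proof (rule the_equality)
  have c: "f \<in> u.fns \<and> (\<forall>i. E' i u.X \<longrightarrow> maps_to UNIV E' f i x) \<longleftrightarrow> f = u.cst x" for f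
  proof -
    have "f = u.cst x" if f: "u.fn u.X f" and m: "\<forall>i. E' i u.X \<longrightarrow> E' (u.opr i x) f"
      by (rule u.fn_ext[OF f u.fn_cst]) (use m u.opr_mem_fn[OF f] u.app_cst in metis)
    then show ?thesis unfolding u.maps_to_iff using u.fn_cst u.opr_mem_fn[OF u.fn_cst] u.app_cst by auto
  qed
  show "h (u.cst x) \<in> h ` u.fns \<and> (\<forall>i\<in>M. E i (h u.X) \<longrightarrow> maps_to M E (h (u.cst x)) i (h x))"
    unfolding ball_M using c[of "u.cst x"] by (simp add: E_iff maps_h)
  fix f assume f: "f \<in> h ` u.fns \<and> (\<forall>i\<in>M. E i (h u.X) \<longrightarrow> maps_to M E f i (h x))"
  then obtain f' where f': "f = h f'" "f' \<in> u.fns" by blast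
  with f have "\<forall>i. E' i u.X \<longrightarrow> maps_to UNIV E' f' i x" unfolding ball_M by (simp add: E_iff maps_h)
  with f' c show "f = h (u.cst x)" by auto
qed

lemma ult_emb_h: "ult_emb M E (h Z) (h x) = h (u.emb x)"
  unfolding ult_emb_def ult_class_h u.emb_def using const_h \<pi>M u.fn_cst by simp

lemma uemb_h: "uemb M E (h Z) (h x) (h y) \<longleftrightarrow> ult_emb M E (h Z) (h x) = h y"
  using iso3[where Q = uemb, OF fo_uemb] u.uemb_iff ult_emb_h by simp

lemma umem_h: "umem M E (h Z) (h y) \<longleftrightarrow> h y \<in> ult M E (h Z)"
  using iso2[where Q = umem, OF fo_umem] u.umem_iff unfolding ult_h by auto

lemma is_ultrapower_h: "is_ultrapower E M (h Z) (ult M E (h Z)) (ult_emb M E (h Z)) (h u.X) (h u.sd)"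
proof -
  note I = u.is_ultrapower_emb[unfolded is_ultrapower_def generated_def omega_fixed_def]
  have e: "elem E' UNIV u.N u.emb" using I by (elim conjE)
  have "u.sd \<in> u.N" using I by (elim conjE)
  moreover have "E' u.sd (u.emb u.X)" using I by (elim conjE)
  moreover have "\<forall>y\<in>u.N. \<exists>g\<in>UNIV. u.fn u.X g \<and> maps_to u.N E' (u.emb g) u.sd y"
    using I by (elim conjE)
  ultimately have g: "u.sd \<in> u.N" "E' u.sd (u.emb u.X)"
    "\<forall>y\<in>u.N. \<exists>g\<in>UNIV. u.fn u.X g \<and> maps_to u.N E' (u.emb g) u.sd y" by auto
  have z: "\<forall>A\<in>UNIV. E' A Z \<longleftrightarrow> is_subset UNIV E' A u.X \<and> E' u.sd (u.emb A)" using I by (elim conjE)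
  have w: "\<forall>w\<in>UNIV. is_omega UNIV E' w \<longrightarrow> (\<forall>n\<in>u.N. E' n (u.emb w) \<longrightarrow> (\<exists>m\<in>UNIV. E' m w \<and> n = u.emb m))"
    using I by (elim conjE)
  show ?thesis
    unfolding is_ultrapower_def
  proof (intro conjI)
    show "ult M E (h Z) \<subseteq> M" unfolding ult_h by auto
    show "\<forall>y\<in>ult M E (h Z). \<forall>x\<in>M. E x y \<longrightarrow> x \<in> ult M E (h Z)"
      unfolding ult_h ball_M using u.N_trans by (auto simp: E_iff)
    show "elem E M (ult M E (h Z)) (ult_emb M E (h Z))"
      unfolding elem_def
    proof (intro conjI allI impI)
      show "\<forall>x\<in>M. ult_emb M E (h Z) x \<in> ult M E (h Z)"
        unfolding ball_M ult_emb_h ult_h using elem_in[OF e] by auto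
      fix \<phi> and e' :: "nat \<Rightarrow> 'v" assume "range e' \<subseteq> M"
      then have "\<forall>n. \<exists>x. e' n = h x" unfolding M by auto
      then obtain e where e': "e' = (\<lambda>n. h (e n))" by metis
      show "sat (ult M E (h Z)) E \<phi> (\<lambda>n. ult_emb M E (h Z) (e' n)) \<longleftrightarrow> sat M E \<phi> e'"
        unfolding e' ult_emb_h ult_h using sat_iso[OF h, of _ E \<phi>] elem_sat[OF \<open>elem E' UNIV u.N u.emb\<close>, of e \<phi>]
        unfolding M E'_def by simp
    qed
    show "ult_emb M E (h Z) \<in> extensional M" unfolding ult_emb_def by simp
    show "h u.X \<in> M" "ultrafilter_on M E (h u.X) (h Z)" using space_iff by blast+
    show "generated E M (ult M E (h Z)) (ult_emb M E (h Z)) (h u.X) (h u.sd)"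
      unfolding generated_def ult_h ult_emb_h
    proof (intro conjI ballI)
      show "h u.sd \<in> h ` u.N" using g(1) by simp
      show "E (h u.sd) (h (u.emb u.X))" using g(2) by (simp add: E_iff)
      fix y assume "y \<in> h ` u.N"
      then obtain y' where y': "y' \<in> u.N" "y = h y'" by blast
      then obtain f where f: "u.fn u.X f" "maps_to u.N E' (u.emb f) u.sd y'" using g(3) by blast
      have "maps_to (h ` u.N) E (h (u.emb f)) (h u.sd) (h y')"
        using fo_iso3[where Q = maps_to, OF h fo_maps_to elem_in[OF e UNIV_I] g(1) y'(1), of E] f(2) by (simp add: E'_def)
      then show "\<exists>f\<in>M. is_fun_on M E (h u.X) f \<and> maps_to (h ` u.N) E (ult_emb M E (h Z) f) (h u.sd) y"
        unfolding bex_M ult_emb_h fun_h y'(2) using f(1) by blast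
    qed
    show "\<forall>A\<in>M. E A (h Z) \<longleftrightarrow> is_subset M E A (h u.X) \<and> E (h u.sd) (ult_emb M E (h Z) A)"
      unfolding ball_M ult_emb_h E_iff iso2[where Q = is_subset, OF fo_is_subset] using z by simp
    show "omega_fixed E M (ult M E (h Z)) (ult_emb M E (h Z))"
      unfolding omega_fixed_def ball_M bex_M ult_emb_h ult_h iso1[where Q = is_omega, OF fo_is_omega] E_iff
      using w by (auto simp: E_iff)
  qed
qed

end

section \<open>Inner models\<close>

context zfc
begin

text \<open>The last clause is external: equinumerosity with the carrier type makes theorems about
  all models on that type available in \<open>M\<close>. Definability lets classes built from
  \<open>M\<close> take part in \<epsilon>-induction over the universe.\<close>

definition inner :: "'v set \<Rightarrow> bool" where
  "inner M \<longleftrightarrow> dcls (\<lambda>x. x \<in> M) \<and> (\<forall>y\<in>M. \<forall>x. x \<epsilon> y \<longrightarrow> x \<in> M) \<and> ZFC M (\<epsilon>) \<and> (\<exists>h :: 'v \<Rightarrow> 'v. inj h \<and> M = range h)"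

lemma inner_UNIV: "inner UNIV"
  unfolding inner_def using zfc by (auto simp: dcls_def dpred_const intro!: exI[of _ id])

lemma inner_dcls: "inner M \<Longrightarrow> dcls (\<lambda>x. x \<in> M)" and inner_trans: "inner M \<Longrightarrow> y \<in> M \<Longrightarrow> x \<epsilon> y \<Longrightarrow> x \<in> M"
  and inner_zfc: "inner M \<Longrightarrow> ZFC M (\<epsilon>)"
  unfolding inner_def by blast+

lemma inner_ne: "inner M \<Longrightarrow> \<exists>x. x \<in> M" unfolding inner_def by auto

lemma inner_ext:
  assumes "inner M" "a \<in> M" "b \<in> M" "\<And>x. x \<in> M \<Longrightarrow> x \<epsilon> a \<longleftrightarrow> x \<epsilon> b" shows "a = b"
  by (rule ext) (use assms inner_trans in blast)

text \<open>A statement proved for every model of ZFC on the whole type reaches \<open>M\<close>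
  along a bijection; so constructions inside \<open>M\<close> are carried out in an arbitrary
  model.\<close>

lemma inner_thm:
  assumes M: "inner M" and Q: "fo Q" and t: "\<And>E' e. ZFC UNIV E' \<Longrightarrow> Q UNIV E' e" and e: "range e \<subseteq> M"
  shows "Q M (\<epsilon>) e"
proof -
  obtain h :: "'v \<Rightarrow> 'v" where h: "inj h" "M = range h" using M unfolding inner_def by blast
  have "\<forall>n. \<exists>x. e n = h x" using e h(2) by (auto simp: image_subset_iff image_iff)
  then obtain e' where e': "e = (\<lambda>n. h (e' n))" by metis
  have "ZFC UNIV (pull h (\<epsilon>))" by (rule ZFC_iso[OF h(1)]) (use inner_zfc[OF M] h(2) in simp)
  from t[OF this] show ?thesis using fo_iso[OF h(1) Q, of e' UNIV "(\<epsilon>)"] unfolding e' h(2) by simp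
qed

lemma inner_sep:
  assumes M: "inner M" and Q: "fo Q" and e: "range e \<subseteq> M" and a: "a \<in> M"
  obtains b where "b \<in> M" "\<And>x. x \<in> M \<Longrightarrow> x \<epsilon> b \<longleftrightarrow> x \<epsilon> a \<and> Q M (\<epsilon>) (e(0 := x))"
proof -
  obtain \<phi> where \<phi>: "\<forall>M E e. range e \<subseteq> M \<longrightarrow> (Q M E e \<longleftrightarrow> sat M E \<phi> e)"
    by (rule foE[OF Q])
  have "\<exists>b\<in>M. \<forall>x\<in>M. x \<epsilon> b \<longleftrightarrow> x \<epsilon> a \<and> sat M (\<epsilon>) \<phi> (e(0 := x))"
    by (rule inner_zfc[OF M, unfolded ZFC_def, THEN conjunct2, THEN conjunct2, THEN conjunct2, THEN conjunct2,
        THEN conjunct2, THEN conjunct2, THEN conjunct1, rule_format, OF e a])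
  then obtain b where b: "b \<in> M" "\<forall>x\<in>M. x \<epsilon> b \<longleftrightarrow> x \<epsilon> a \<and> sat M (\<epsilon>) \<phi> (e(0 := x))" ..
  have s: "Q M (\<epsilon>) (e(0 := x)) \<longleftrightarrow> sat M (\<epsilon>) \<phi> (e(0 := x))" if "x \<in> M" for x
    using \<phi> e that by (simp add: image_subset_iff)
  show thesis by (rule that[OF b(1)]) (simp only: s bspec[OF b(2)])
qed

text \<open>The guard \<open>P\<close> ensures that the terms denote elements of \<open>M\<close>,
  where \<open>Q\<close> is known to agree with a formula.\<close>

lemma dpred_fo:
  assumes Q: "fo Q" and M: "dcls (\<lambda>x. x \<in> M)" and t: "\<And>n. dterm (t n)" and P: "dpred P"
    and in_M: "\<And>e. P e \<Longrightarrow> range (\<lambda>n. t n e) \<subseteq> M"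
  shows "dpred (\<lambda>e. P e \<and> Q M (\<epsilon>) (\<lambda>n. t n e))"
proof -
  obtain \<phi> where \<phi>: "\<forall>M E e. range e \<subseteq> M \<longrightarrow> (Q M E e \<longleftrightarrow> sat M E \<phi> e)"
    by (rule foE[OF Q])
  have "(P e \<and> Q M (\<epsilon>) (\<lambda>n. t n e)) \<longleftrightarrow> (P e \<and> sat M (\<epsilon>) \<phi> (\<lambda>n. t n e))" for e
    using \<phi>[rule_format, OF in_M, of e] by (cases "P e") simp_all
  then show ?thesis using dpred_conj[OF P dpred_sat[OF M t]] by simp
qed

subsection \<open>Absoluteness\<close>

lemma opr_comp: assumes "inner M" "opr x y \<in> M" shows "x \<in> M" "y \<in> M"
proof -
  have "mk {z. z = x \<or> z = y} \<epsilon> opr x y" by (simp add: mem_opr)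
  then have "mk {z. z = x \<or> z = y} \<in> M" using inner_trans assms by blast
  then show "x \<in> M" "y \<in> M" using inner_trans[OF assms(1)] by auto
qed

lemma upair_in: assumes M: "inner M" "x \<in> M" "y \<in> M" shows "mk {z. z = x \<or> z = y} \<in> M"
proof -
  obtain c where c: "c \<in> M" "\<forall>z\<in>M. z \<epsilon> c \<longleftrightarrow> z = x \<or> z = y"
    using inner_zfc[OF M(1), unfolded ZFC_def, THEN conjunct2, THEN conjunct2, THEN conjunct1] M(2,3) by metis
  have "c = mk {z. z = x \<or> z = y}" by (rule ext) (use c inner_trans[OF M(1) c(1)] M in auto)
  with c show ?thesis by simp
qed

lemma opr_in: assumes M: "inner M" "x \<in> M" "y \<in> M" shows "opr x y \<in> M"
proof -
  have "mk {z. z = x} \<in> M" using upair_in[OF M(1) M(2) M(2)] by simp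
  then show ?thesis unfolding opr_def by (rule upair_in[OF M(1) _ upair_in[OF M]])
qed

lemma in_opair:
  assumes M: "inner M" "x \<in> M" "y \<in> M" "p \<in> M" shows "is_opair M (\<epsilon>) x y p \<longleftrightarrow> p = opr x y"
proof -
  have u: "is_upair M (\<epsilon>) a b c \<longleftrightarrow> c = mk {z. z = a \<or> z = b}" if "a \<in> M" "b \<in> M" "c \<in> M" for a b c
  proof
    assume "is_upair M (\<epsilon>) a b c"
    then show "c = mk {z. z = a \<or> z = b}" unfolding is_upair_def
      by (intro inner_ext[OF M(1)] upair_in[OF M(1)] that) auto
  qed (simp add: is_upair_def)
  have "mk {z. z = x} \<in> M" "mk {z. z = x \<or> z = y} \<in> M"
    using upair_in[OF M(1) M(2) M(2)] upair_in[OF M(1-3)] by simp_all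
  moreover have "{z. z = x} = {z. z = x \<or> z = x}" by simp
  ultimately show ?thesis unfolding is_opair_def opr_def using u M(2-4) by auto
qed

lemma in_maps:
  assumes M: "inner M" "x \<in> M" "y \<in> M" shows "maps_to M (\<epsilon>) f x y \<longleftrightarrow> opr x y \<epsilon> f"
  unfolding maps_to_def using in_opair[OF M] opr_in[OF M] by auto

lemma in_fun:
  assumes M: "inner M" "X \<in> M" "f \<in> M" shows "is_fun_on M (\<epsilon>) X f \<longleftrightarrow> fn X f"
proof -
  have p: "p \<epsilon> f \<Longrightarrow> p \<in> M" for p using inner_trans[OF M(1,3)] .
  have x: "x \<epsilon> X \<Longrightarrow> x \<in> M" for x using inner_trans[OF M(1,2)] .
  have 1: "(\<forall>q\<in>M. q \<epsilon> f \<longrightarrow> (\<exists>x\<in>M. \<exists>y\<in>M. x \<epsilon> X \<and> is_opair M (\<epsilon>) x y q)) \<longleftrightarrow> (\<forall>q. q \<epsilon> f \<longrightarrow> (\<exists>x y. x \<epsilon> X \<and> q = opr x y))"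
    (is "?L \<longleftrightarrow> ?R")
  proof
    assume ?L
    then show ?R using p in_opair[OF M(1)] by metis
  next
    assume R: ?R
    show ?L
    proof (intro ballI impI)
      fix q assume q: "q \<in> M" "q \<epsilon> f"
      then obtain x y where xy: "x \<epsilon> X" "q = opr x y" using R by blast
      then have "x \<in> M" "y \<in> M" using opr_comp[OF M(1)] q(1) by blast+
      then show "\<exists>x\<in>M. \<exists>y\<in>M. x \<epsilon> X \<and> is_opair M (\<epsilon>) x y q" using xy in_opair[OF M(1) _ _ q(1)] by blast
    qed
  qed
  have y: "opr x y \<epsilon> f \<Longrightarrow> y \<in> M" for x y using p opr_comp[OF M(1)] by blast
  have 2: "(\<exists>!y. y \<in> M \<and> maps_to M (\<epsilon>) f x y) \<longleftrightarrow> (\<exists>y. opr x y \<epsilon> f \<and> (\<forall>z. opr x z \<epsilon> f \<longrightarrow> z = y))"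
    if "x \<epsilon> X" for x
  proof -
    have "(y \<in> M \<and> maps_to M (\<epsilon>) f x y) \<longleftrightarrow> opr x y \<epsilon> f" for y
      using in_maps[OF M(1) x[OF that]] y by blast
    then show ?thesis by (simp add: Ex1_def)
  qed
  show ?thesis unfolding is_fun_on_def[of M] fn_iff 1 using 2 x by auto
qed

lemma in_subset: assumes M: "inner M" "A \<in> M" shows "is_subset M (\<epsilon>) A B \<longleftrightarrow> sub A B"
  unfolding is_subset_def sub_def using inner_trans[OF M] by blast

lemma app_in: assumes M: "inner M" "f \<in> M" "fn X f" "x \<epsilon> X" shows "app f x \<in> M"
proof -
  have "opr x (app f x) \<epsilon> f" using opr_mem_fn[OF M(3,4)] by simp
  then show ?thesis using inner_trans[OF M(1,2)] opr_comp[OF M(1)] by blast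
qed

subsection \<open>Elementary embeddings of inner models\<close>

lemma elem_fn:
  assumes "inner M" "inner N" "elem (\<epsilon>) M N j" "X \<in> M" "f \<in> M" "fn X f" shows "fn (j X) (j f)"
proof -
  have "is_fun_on N (\<epsilon>) (j X) (j f) \<longleftrightarrow> is_fun_on M (\<epsilon>) X f"
    by (rule elem_fo2[where Q = is_fun_on, OF assms(3) fo_is_fun_on assms(4,5)])
  then show ?thesis using in_fun[OF assms(1,4,5)] in_fun[OF assms(2)] elem_in[OF assms(3)] assms(4-6) by simp
qed

lemma elem_opr:
  assumes "inner M" "inner N" "elem (\<epsilon>) M N j" "x \<in> M" "y \<in> M" shows "j (opr x y) = opr (j x) (j y)"
proof -
  note o = opr_in[OF assms(1,4,5)]
  have "is_opair N (\<epsilon>) (j x) (j y) (j (opr x y)) \<longleftrightarrow> is_opair M (\<epsilon>) x y (opr x y)"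
    by (rule elem_fo3[where Q = is_opair, OF assms(3) fo_is_opair assms(4,5) o])
  then show ?thesis
    using in_opair[OF assms(1,4,5) o] in_opair[OF assms(2) elem_in[OF assms(3,4)] elem_in[OF assms(3,5)] elem_in[OF assms(3) o]]
    by simp
qed

lemma elem_maps:
  assumes "inner M" "inner N" "elem (\<epsilon>) M N j" "f \<in> M" "x \<in> M" "y \<in> M" "opr x y \<epsilon> f"
  shows "opr (j x) (j y) \<epsilon> j f"
  using elem_mem[OF assms(3) opr_in[OF assms(1,5,6)] assms(4)] assms(7) elem_opr[OF assms(1-3,5,6)] by simp

lemma elem_app:
  assumes "inner M" "inner N" "elem (\<epsilon>) M N j" "X \<in> M" "f \<in> M" "fn X f" "x \<epsilon> X"
  shows "j (app f x) = app (j f) (j x)"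
proof -
  have x: "x \<in> M" using inner_trans[OF assms(1,4,7)] .
  have "opr x (app f x) \<epsilon> f" using opr_mem_fn[OF assms(6,7)] by simp
  from elem_maps[OF assms(1-3,5) x app_in[OF assms(1,5,6,7)] this]
  have "opr (j x) (j (app f x)) \<epsilon> j f" .
  moreover have "j x \<epsilon> j X" using elem_mem[OF assms(3) x assms(4)] assms(7) by simp
  ultimately show ?thesis using opr_mem_fn[OF elem_fn[OF assms(1-6)]] by blast
qed

lemma elem_sub:
  assumes "inner M" "inner N" "elem (\<epsilon>) M N j" "A \<in> M" "B \<in> M" "sub A B" shows "sub (j A) (j B)"
proof -
  have "is_subset N (\<epsilon>) (j A) (j B) \<longleftrightarrow> is_subset M (\<epsilon>) A B"
    by (rule elem_fo2[where Q = is_subset, OF assms(3) fo_is_subset assms(4,5)])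
  then show ?thesis using assms in_subset elem_in by metis
qed

lemma generatedD:
  assumes "inner M" "inner N" "elem (\<epsilon>) M N j" "X \<in> M" "generated (\<epsilon>) M N j X s"
  shows "s \<in> N" "s \<epsilon> j X" and "y \<in> N \<Longrightarrow> \<exists>g\<in>M. fn X g \<and> y = app (j g) s"
proof -
  show s: "s \<in> N" "s \<epsilon> j X" using assms(5) unfolding generated_def by blast+
  assume y: "y \<in> N"
  then obtain g where g: "g \<in> M" "is_fun_on M (\<epsilon>) X g" "maps_to N (\<epsilon>) (j g) s y"
    using assms(5) unfolding generated_def by blast
  then have f: "fn X g" using in_fun[OF assms(1,4)] by simp
  have "opr s y \<epsilon> j g" using g(3) in_maps[OF assms(2) s(1) y] by simp
  then have "y = app (j g) s" using opr_mem_fn[OF elem_fn[OF assms(1-4) g(1) f] s(2)] by simp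
  with g f show "\<exists>g\<in>M. fn X g \<and> y = app (j g) s" by blast
qed

lemma generatedI:
  assumes "inner M" "inner N" "elem (\<epsilon>) M N j" "X \<in> M" "s \<in> N" "s \<epsilon> j X"
    "\<And>y. y \<in> N \<Longrightarrow> \<exists>g\<in>M. fn X g \<and> opr s y \<epsilon> j g"
  shows "generated (\<epsilon>) M N j X s"
  unfolding generated_def
  using assms(5-7) in_fun[OF assms(1,4)] in_maps[OF assms(2,5)] by metis

text \<open>Definability is meant over the universe with parameters; it permits the
  \<epsilon>-induction that identifies two ultrapowers.\<close>

definition demb :: "'v set \<Rightarrow> ('v \<Rightarrow> 'v) \<Rightarrow> bool" where
  "demb M j \<longleftrightarrow> drel (\<lambda>x y. x \<in> M \<and> j x = y)"

lemma fo_const: "fo (\<lambda>M E e. b)"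
  using fo_eq[of 0 0] fo_not[OF fo_eq[of 0 0]] by (cases b) simp_all

text \<open>\<open>A\<close> is the set of points of \<open>X\<close> where the values of
  \<open>f\<close> and \<open>g\<close> are equal, or in the membership relation, as the flag
  \<open>b\<close> selects. It is found independently of the embedding, so embeddings with the same
  derived ultrafilter compare \<open>app (j f) s\<close> with \<open>app (j g) s\<close> in the same
  way.\<close>

lemma seed_compare:
  assumes M: "inner M" and X: "X \<in> M" and f: "f \<in> M" "fn X f" and g: "g \<in> M" "fn X g"
  obtains A where "A \<in> M" "sub A X"
    "\<And>N j s. inner N \<Longrightarrow> elem (\<epsilon>) M N j \<Longrightarrow> s \<in> N \<Longrightarrow> s \<epsilon> j X \<Longrightarrow>
      s \<epsilon> j A \<longleftrightarrow> (b \<and> app (j f) s = app (j g) s) \<or> (\<not> b \<and> app (j f) s \<epsilon> app (j g) s)"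
proof -
  let ?R = "\<lambda>M E f g x. \<exists>y\<in>M. \<exists>z\<in>M. maps_to M E f x y \<and> maps_to M E g x z \<and> (b \<and> y = z \<or> \<not> b \<and> E y z)"
  have R: "fo (\<lambda>M E e. ?R M E (e 1) (e 2) (e 0))" by (intro fo_const fo_intros fo_maps_to)
  obtain a where "a \<in> M" using inner_ne[OF M] by blast
  have "range (case_nat a (case_nat f (\<lambda>_. g))) \<subseteq> M"
    using f(1) g(1) \<open>a \<in> M\<close> by (auto split: nat.split)
  from inner_sep[OF M R this X] obtain A where
    A: "A \<in> M" "\<And>x. x \<in> M \<Longrightarrow> x \<epsilon> A \<longleftrightarrow> x \<epsilon> X \<and> ?R M (\<epsilon>) f g x"
    by (auto simp: numeral_2_eq_2)
  have Q: "fo (\<lambda>M E e. \<forall>x\<in>M. E x (e 0) \<longleftrightarrow> E x (e 1) \<and> ?R M E (e 2) (e 3) x)"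
    by (intro fo_const fo_intros fo_maps_to)
  show thesis
  proof (rule that[OF A(1)])
    show "sub A X" unfolding sub_def using A inner_trans[OF M A(1)] by blast
    fix N j s assume N: "inner N" and j: "elem (\<epsilon>) M N j" and s: "s \<in> N" "s \<epsilon> j X"
    have "\<forall>x\<in>N. x \<epsilon> j A \<longleftrightarrow> x \<epsilon> j X \<and> ?R N (\<epsilon>) (j f) (j g) x"
      using elem_fo4[where Q = "\<lambda>M E A X f g. \<forall>x\<in>M. E x A \<longleftrightarrow> E x X \<and> ?R M E f g x", OF j Q A(1) X f(1) g(1)] A(2)
      by blast
    then have "s \<epsilon> j A \<longleftrightarrow> ?R N (\<epsilon>) (j f) (j g) s" using s by blast
    moreover have "maps_to N (\<epsilon>) (j f) s y \<longleftrightarrow> y = app (j f) s" if "y \<in> N" for y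
      using in_maps[OF N s(1) that] opr_mem_fn[OF elem_fn[OF M N j X f] s(2)] by simp
    moreover have "maps_to N (\<epsilon>) (j g) s y \<longleftrightarrow> y = app (j g) s" if "y \<in> N" for y
      using in_maps[OF N s(1) that] opr_mem_fn[OF elem_fn[OF M N j X g] s(2)] by simp
    moreover have "app (j f) s \<in> N" "app (j g) s \<in> N"
      using app_in[OF N elem_in[OF j] elem_fn[OF M N j X] s(2)] f g by blast+
    ultimately show "s \<epsilon> j A \<longleftrightarrow> (b \<and> app (j f) s = app (j g) s) \<or> (\<not> b \<and> app (j f) s \<epsilon> app (j g) s)"
      by auto
  qed
qed

lemma zfc_const: "ZFC UNIV E' \<Longrightarrow> \<exists>f\<in>UNIV. is_fun_on UNIV E' X f \<and> (\<forall>i\<in>UNIV. E' i X \<longrightarrow> maps_to UNIV E' f i x)"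
  and zfc_id: "ZFC UNIV E' \<Longrightarrow> \<exists>f\<in>UNIV. is_fun_on UNIV E' X f \<and> (\<forall>i\<in>UNIV. E' i X \<longrightarrow> maps_to UNIV E' f i i)"
  for E' :: "'v \<Rightarrow> 'v \<Rightarrow> bool"
proof -
  assume "ZFC UNIV E'"
  then interpret z: zfc E' by unfold_locales
  have c: "z.dfun (\<lambda>_. x)" "z.dfun (\<lambda>x. x)" unfolding z.dfun_def by (intro z.d_rules)+
  show "\<exists>f\<in>UNIV. is_fun_on UNIV E' X f \<and> (\<forall>i\<in>UNIV. E' i X \<longrightarrow> maps_to UNIV E' f i x)"
    by (rule bexI[of _ "z.lam X (\<lambda>_. x)"]) (simp_all add: z.fn_lam[OF c(1)] z.maps_to_iff z.mem_lam[OF c(1)])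
  show "\<exists>f\<in>UNIV. is_fun_on UNIV E' X f \<and> (\<forall>i\<in>UNIV. E' i X \<longrightarrow> maps_to UNIV E' f i i)"
    by (rule bexI[of _ "z.lam X (\<lambda>x. x)"]) (simp_all add: z.fn_lam[OF c(2)] z.maps_to_iff z.mem_lam[OF c(2)])
qed

lemma inner_const:
  assumes M: "inner M" "X \<in> M" "x \<in> M" shows "lam X (\<lambda>_. x) \<in> M"
proof -
  have Q: "fo (\<lambda>M E e. \<exists>f\<in>M. is_fun_on M E (e 0) f \<and> (\<forall>i\<in>M. E i (e 0) \<longrightarrow> maps_to M E f i (e 1)))"
    by (intro fo_intros fo_basic)
  have "\<exists>f\<in>M. is_fun_on M (\<epsilon>) X f \<and> (\<forall>i\<in>M. i \<epsilon> X \<longrightarrow> maps_to M (\<epsilon>) f i x)"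
  proof -
    have r: "range (case_nat X (\<lambda>_. x)) \<subseteq> M" using M(2,3) by (auto split: nat.split)
    show ?thesis using inner_thm[OF M(1) Q zfc_const r] by simp
  qed
  then obtain f where f: "f \<in> M" "is_fun_on M (\<epsilon>) X f" "\<forall>i\<in>M. i \<epsilon> X \<longrightarrow> maps_to M (\<epsilon>) f i x" by blast
  have 1: "fn X f" using f in_fun[OF M(1,2)] by simp
  have d: "dfun (\<lambda>_. x)" unfolding dfun_def by (intro d_rules)
  have "f = lam X (\<lambda>_. x)"
  proof (rule fn_ext[OF 1 fn_lam[OF d]])
    fix i assume i: "i \<epsilon> X"
    then have "i \<in> M" using inner_trans[OF M(1,2)] by blast
    then have "opr i x \<epsilon> f" using f(3) i in_maps[OF M(1) _ M(3)] by blast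
    then show "app f i = app (lam X (\<lambda>_. x)) i" using opr_mem_fn[OF 1 i] app_lam[OF d i] by simp
  qed
  with f(1) show ?thesis by simp
qed

lemma inner_id:
  assumes M: "inner M" "X \<in> M" shows "lam X (\<lambda>x. x) \<in> M"
proof -
  have Q: "fo (\<lambda>M E e. \<exists>f\<in>M. is_fun_on M E (e 0) f \<and> (\<forall>i\<in>M. E i (e 0) \<longrightarrow> maps_to M E f i i))"
    by (intro fo_intros fo_basic)
  have "\<exists>f\<in>M. is_fun_on M (\<epsilon>) X f \<and> (\<forall>i\<in>M. i \<epsilon> X \<longrightarrow> maps_to M (\<epsilon>) f i i)"
    using inner_thm[OF M(1) Q, of "\<lambda>_. X"] zfc_id M(2) by auto
  then obtain f where f: "f \<in> M" "is_fun_on M (\<epsilon>) X f" "\<forall>i\<in>M. i \<epsilon> X \<longrightarrow> maps_to M (\<epsilon>) f i i" by blast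
  have 1: "fn X f" using f in_fun[OF M(1,2)] by simp
  have d: "dfun (\<lambda>x. x)" unfolding dfun_def by (intro d_rules)
  have "f = lam X (\<lambda>x. x)"
  proof (rule fn_ext[OF 1 fn_lam[OF d]])
    fix i assume i: "i \<epsilon> X"
    then have "i \<in> M" using inner_trans[OF M(1,2)] by blast
    then have "opr i i \<epsilon> f" using f(3) i in_maps[OF M(1)] by blast
    then show "app f i = app (lam X (\<lambda>x. x)) i" using opr_mem_fn[OF 1 i] app_lam[OF d i] by simp
  qed
  with f(1) show ?thesis by simp
qed

lemma elem_const:
  assumes M: "inner M" and N: "inner N" and j: "elem (\<epsilon>) M N j" and X: "X \<in> M" and x: "x \<in> M" and s: "s \<in> N" "s \<epsilon> j X"
  shows "app (j (lam X (\<lambda>_. x))) s = j x"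
proof -
  let ?f = "lam X (\<lambda>_. x)"
  have d: "dfun (\<lambda>_. x)" unfolding dfun_def by (intro d_rules)
  note f = inner_const[OF M X x]
  have Q: "fo (\<lambda>M E e. \<forall>i\<in>M. E i (e 0) \<longrightarrow> maps_to M E (e 1) i (e 2))" by (intro fo_intros fo_basic)
  have "\<forall>i\<in>M. i \<epsilon> X \<longrightarrow> maps_to M (\<epsilon>) ?f i x"
    using in_maps[OF M _ x] by (simp add: mem_lam[OF d])
  then have "\<forall>i\<in>N. i \<epsilon> j X \<longrightarrow> maps_to N (\<epsilon>) (j ?f) i (j x)"
    using elem_fo3[where Q = "\<lambda>M E X f x. \<forall>i\<in>M. E i X \<longrightarrow> maps_to M E f i x", OF j Q X f x] by blast
  then have "opr s (j x) \<epsilon> j ?f" using s in_maps[OF N s(1) elem_in[OF j x]] by blast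
  then show ?thesis using opr_mem_fn[OF elem_fn[OF M N j X f fn_lam[OF d]] s(2)] by simp
qed

lemma elem_id:
  assumes M: "inner M" and N: "inner N" and j: "elem (\<epsilon>) M N j" and X: "X \<in> M" and s: "s \<in> N" "s \<epsilon> j X"
  shows "app (j (lam X (\<lambda>x. x))) s = s"
proof -
  let ?f = "lam X (\<lambda>x. x)"
  have d: "dfun (\<lambda>x. x)" unfolding dfun_def by (intro d_rules)
  note f = inner_id[OF M X]
  have Q: "fo (\<lambda>M E e. \<forall>i\<in>M. E i (e 0) \<longrightarrow> maps_to M E (e 1) i i)" by (intro fo_intros fo_basic)
  have "\<forall>i\<in>M. i \<epsilon> X \<longrightarrow> maps_to M (\<epsilon>) ?f i i"
    using in_maps[OF M] by (simp add: mem_lam[OF d])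
  then have "\<forall>i\<in>N. i \<epsilon> j X \<longrightarrow> maps_to N (\<epsilon>) (j ?f) i i"
    using elem_fo2[where Q = "\<lambda>M E X f. \<forall>i\<in>M. E i X \<longrightarrow> maps_to M E f i i", OF j Q X f] by blast
  then have "opr s s \<epsilon> j ?f" using s in_maps[OF N s(1) s(1)] by blast
  then show ?thesis using opr_mem_fn[OF elem_fn[OF M N j X f fn_lam[OF d]] s(2)] by simp
qed

lemma demb_app: assumes "demb M j" "dterm t" "dterm s" shows "dpred (\<lambda>e. t e \<in> M \<and> j (t e) = s e)"
  using dpred_rel[OF assms(1)[unfolded demb_def] assms(2,3)] .

text \<open>The only \<epsilon>-isomorphism between transitive classes is the identity. The
  correspondence is a relation whose single-valuedness comes out of the induction; its definability
  permits the induction.\<close>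

lemma iso_identity:
  assumes q: "drel q" and NN: "inner N" "inner N'"
    and tot: "\<And>y. y \<in> N \<Longrightarrow> \<exists>y'. q y y'" and sur: "\<And>y'. y' \<in> N' \<Longrightarrow> \<exists>y. q y y'"
    and dom: "\<And>y y'. q y y' \<Longrightarrow> y \<in> N \<and> y' \<in> N'"
    and mem: "\<And>y y' z z'. q y y' \<Longrightarrow> q z z' \<Longrightarrow> y \<epsilon> z \<longleftrightarrow> y' \<epsilon> z'"
  shows "(\<forall>y y'. q y y' \<longrightarrow> y = y') \<and> N = N'"
proof -
  have main: "\<forall>y'. q y y' \<longrightarrow> y = y'" for y
  proof (rule eps_induct[of "\<lambda>y. \<forall>y'. q y y' \<longrightarrow> y = y'"])
    show "dcls (\<lambda>y. \<forall>y'. q y y' \<longrightarrow> y = y')" unfolding dcls_def by (intro d_rules dpred_rel[OF q])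
    fix y assume IH: "\<And>z. z \<epsilon> y \<Longrightarrow> \<forall>z'. q z z' \<longrightarrow> z = z'"
    show "\<forall>y'. q y y' \<longrightarrow> y = y'"
    proof (intro allI impI ext iffI)
      fix y' z assume y: "q y y'" and z: "z \<epsilon> y"
      have "z \<in> N" using inner_trans[OF NN(1) _ z] dom[OF y] by blast
      then obtain z' where z': "q z z'" using tot by blast
      with IH[OF z] mem[OF z' y] z show "z \<epsilon> y'" by auto
    next
      fix y' z' assume y: "q y y'" and z': "z' \<epsilon> y'"
      have "z' \<in> N'" using inner_trans[OF NN(2) _ z'] dom[OF y] by blast
      then obtain z where z: "q z z'" using sur by blast
      then have "z \<epsilon> y" using mem[OF z y] z' by simp
      with IH[OF this] z show "z' \<epsilon> y" by auto
    qed
  qed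
  moreover have "N = N'" using main tot sur dom by blast
  ultimately show ?thesis by blast
qed

text \<open>The values of one function at the two seeds correspond. By \<open>seed_compare\<close>
  this correspondence preserves membership, so it is the identity; constant functions then give
  equality of the embeddings, and the identity function gives equality of the seeds.\<close>

theorem ultrapower_unique:
  assumes M: "inner M" and N: "inner N" and N': "inner N'"
    and j: "elem (\<epsilon>) M N j" "demb M j" and j': "elem (\<epsilon>) M N' j'" "demb M j'"
    and X: "X \<in> M" and g: "generated (\<epsilon>) M N j X s" and g': "generated (\<epsilon>) M N' j' X s'"
    and U: "\<And>A. A \<in> M \<Longrightarrow> sub A X \<Longrightarrow> s \<epsilon> j A \<longleftrightarrow> s' \<epsilon> j' A"
  shows "N = N'" "x \<in> M \<Longrightarrow> j x = j' x" "s = s'"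
proof -
  note G = generatedD[OF M N j(1) X g] and G' = generatedD[OF M N' j'(1) X g']
  define q where "q y y' \<longleftrightarrow> (\<exists>f. f \<in> M \<and> fn X f \<and> y = app (j f) s \<and> y' = app (j' f) s')" for y y'
  have q_eq: "q y y' \<longleftrightarrow> (\<exists>f a b. (f \<in> M \<and> j f = a) \<and> (f \<in> M \<and> j' f = b) \<and> fn X f \<and> y = app a s \<and> y' = app b s')" for y y'
    unfolding q_def by auto
  have dq: "drel q" unfolding drel_def q_eq
    by (intro d_rules demb_app[OF j(2)] demb_app[OF j'(2)])
  have cmp: "app (j f) s \<epsilon> app (j g) s \<longleftrightarrow> app (j' f) s' \<epsilon> app (j' g) s'"
    if fg: "f \<in> M" "fn X f" "g \<in> M" "fn X g" for f g
  proof -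
    obtain A where A: "A \<in> M" "sub A X"
      "\<And>N j s. inner N \<Longrightarrow> elem (\<epsilon>) M N j \<Longrightarrow> s \<in> N \<Longrightarrow> s \<epsilon> j X \<Longrightarrow>
        s \<epsilon> j A \<longleftrightarrow> (False \<and> app (j f) s = app (j g) s) \<or> (\<not> False \<and> app (j f) s \<epsilon> app (j g) s)"
      using seed_compare[OF M X fg] by metis
    show ?thesis using A(3)[OF N j(1) G(1,2)] A(3)[OF N' j'(1) G'(1,2)] U[OF A(1,2)] by simp
  qed
  have "(\<forall>y y'. q y y' \<longrightarrow> y = y') \<and> N = N'"
  proof (rule iso_identity[OF dq N N'])
    show "\<exists>y'. q y y'" if "y \<in> N" for y using G(3)[OF that] unfolding q_def by blast
    show "\<exists>y. q y y'" if "y' \<in> N'" for y' using G'(3)[OF that] unfolding q_def by blast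
    show "y \<in> N \<and> y' \<in> N'" if "q y y'" for y y'
      using that app_in[OF N elem_in[OF j(1)] elem_fn[OF M N j(1) X] G(2)]
        app_in[OF N' elem_in[OF j'(1)] elem_fn[OF M N' j'(1) X] G'(2)] unfolding q_def by blast
    show "y \<epsilon> z \<longleftrightarrow> y' \<epsilon> z'" if "q y y'" "q z z'" for y y' z z'
      using that cmp unfolding q_def by blast
  qed
  then have 1: "q y y' \<Longrightarrow> y = y'" and 2: "N = N'" for y y' by blast+
  show "N = N'" by (rule 2)
  have d: "dfun (\<lambda>_. c)" "dfun (\<lambda>x. x)" for c unfolding dfun_def by (intro d_rules)+
  show "s = s'"
    by (rule 1) (unfold q_def, use inner_id[OF M X] fn_lam[OF d(2)] elem_id[OF M N j(1) X G(1,2)] elem_id[OF M N' j'(1) X G'(1,2)] in metis)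
  show "j x = j' x" if x: "x \<in> M"
    by (rule 1) (unfold q_def, use inner_const[OF M X x] fn_lam[OF d(1)] elem_const[OF M N j(1) X x G(1,2)] elem_const[OF M N' j'(1) X x G'(1,2)] in metis)
qed

section \<open>Ultrapowers formed inside inner models\<close>

abbreviation Ult :: "'v set \<Rightarrow> 'v \<Rightarrow> 'v set" where "Ult M Z \<equiv> ult M (\<epsilon>) Z"
abbreviation Emb :: "'v set \<Rightarrow> 'v \<Rightarrow> 'v \<Rightarrow> 'v" where "Emb M Z \<equiv> ult_emb M (\<epsilon>) Z"
abbreviation ccuf :: "'v set \<Rightarrow> 'v \<Rightarrow> bool" where "ccuf M Z \<equiv> cc_ultrafilter M (\<epsilon>) Z"

lemma ccuf_in: "ccuf M Z \<Longrightarrow> Z \<in> M"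
  unfolding cc_ultrafilter_def by simp

lemma inner_copy:
  assumes M: "inner M" and Z: "ccuf M Z"
  obtains h Z' where "copy (\<epsilon>) h M Z'" "Z = h Z'" "M = range h"
proof -
  obtain h :: "'v \<Rightarrow> 'v" where h: "inj h" "M = range h" using M unfolding inner_def by blast
  obtain Z' where Z': "Z = h Z'" using ccuf_in[OF Z] h(2) by auto
  have "copy (\<epsilon>) h M Z'" by unfold_locales (use h Z Z' inner_zfc[OF M] in simp_all)
  with Z' h(2) show thesis by (intro that)
qed

lemma inner_ultrapower:
  assumes M: "inner M" and Z: "ccuf M Z"
  obtains X s where "is_ultrapower (\<epsilon>) M Z (Ult M Z) (Emb M Z) X s"
proof -
  obtain h Z' where h: "copy (\<epsilon>) h M Z'" "Z = h Z'" by (rule inner_copy[OF M Z])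
  interpret c: copy "(\<epsilon>)" h M Z' by (rule h(1))
  show thesis using that c.is_ultrapower_h h(2) by simp
qed

text \<open>Links the embedding defined by description with its formula, through which properties of
  ultrapower embeddings of \<open>M\<close> become transferable.\<close>

lemma uemb_in:
  assumes M: "inner M" and Z: "ccuf M Z" and x: "x \<in> M" "y \<in> M"
  shows "uemb M (\<epsilon>) Z x y \<longleftrightarrow> Emb M Z x = y"
proof -
  obtain h Z' where h: "copy (\<epsilon>) h M Z'" "Z = h Z'" "M = range h" by (rule inner_copy[OF M Z])
  interpret c: copy "(\<epsilon>)" h M Z' by (rule h(1))
  obtain x' y' where "x = h x'" "y = h y'" using x h(3) by auto
  then show ?thesis using c.uemb_h h(2) by simp
qed

lemma umem_in:
  assumes M: "inner M" and Z: "ccuf M Z" and y: "y \<in> M"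
  shows "umem M (\<epsilon>) Z y \<longleftrightarrow> y \<in> Ult M Z"
proof -
  obtain h Z' where h: "copy (\<epsilon>) h M Z'" "Z = h Z'" "M = range h" by (rule inner_copy[OF M Z])
  interpret c: copy "(\<epsilon>)" h M Z' by (rule h(1))
  obtain y' where "y = h y'" using y h(3) by auto
  then show ?thesis using c.umem_h h(2) by simp
qed

lemma is_ultrapowerD:
  assumes "is_ultrapower (\<epsilon>) M Z N j X s"
  shows "N \<subseteq> M" "y \<in> N \<Longrightarrow> x \<in> M \<Longrightarrow> x \<epsilon> y \<Longrightarrow> x \<in> N" "elem (\<epsilon>) M N j" "j \<in> extensional M" "X \<in> M"
    "ultrafilter_on M (\<epsilon>) X Z" "generated (\<epsilon>) M N j X s"
    "A \<in> M \<Longrightarrow> A \<epsilon> Z \<longleftrightarrow> is_subset M (\<epsilon>) A X \<and> s \<epsilon> j A" "omega_fixed (\<epsilon>) M N j"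
  using assms unfolding is_ultrapower_def by auto

lemma demb_Emb:
  assumes M: "inner M" and Z: "ccuf M Z" shows "demb M (Emb M Z)"
proof -
  define t :: "nat \<Rightarrow> (nat \<Rightarrow> 'v) \<Rightarrow> 'v"
    where "t n = (if n = 0 then (\<lambda>e. Z) else if n = 1 then (\<lambda>e. e 0) else (\<lambda>e. e 1))" for n
  have t: "dterm (t n)" for n unfolding t_def by (simp add: dterm_var dterm_const)
  obtain X s where "is_ultrapower (\<epsilon>) M Z (Ult M Z) (Emb M Z) X s" by (rule inner_ultrapower[OF M Z])
  note I = is_ultrapowerD[OF this]
  have "dpred (\<lambda>e. (e 0 \<in> M \<and> e 1 \<in> M) \<and> uemb M (\<epsilon>) (t 0 e) (t 1 e) (t 2 e))"
    by (rule dpred_fo[OF fo_uemb[of 0 1 2] inner_dcls[OF M] t])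
       (intro d_rules dpred_cls[OF inner_dcls[OF M]], auto simp: t_def ccuf_in[OF Z])
  then have "dpred (\<lambda>e. (e 0 \<in> M \<and> e 1 \<in> M) \<and> uemb M (\<epsilon>) Z (e 0) (e 1))" by (simp add: t_def)
  moreover have "((e 0 \<in> M \<and> e 1 \<in> M) \<and> uemb M (\<epsilon>) Z (e 0) (e 1)) \<longleftrightarrow> e 0 \<in> M \<and> Emb M Z (e 0) = e 1" for e :: "nat \<Rightarrow> 'v"
    using uemb_in[OF M Z, of "e 0" "e 1"] I(1) elem_in[OF I(3), of "e 0"] by auto
  ultimately show ?thesis unfolding demb_def drel_def by simp
qed

lemma inner_Ult:
  assumes M: "inner M" and Z: "ccuf M Z" shows "inner (Ult M Z)"
proof -
  obtain X s where "is_ultrapower (\<epsilon>) M Z (Ult M Z) (Emb M Z) X s" by (rule inner_ultrapower[OF M Z])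
  note I = is_ultrapowerD[OF this]
  obtain h :: "'v \<Rightarrow> 'v" where h: "inj h" "M = range h" using M unfolding inner_def by blast
  have "inj (\<lambda>x. Emb M Z (h x))"
    by (rule injI) (use elem_inj[OF I(3)] h in \<open>auto simp: inj_eq\<close>)
  moreover have "range (\<lambda>x. Emb M Z (h x)) \<subseteq> Ult M Z" using elem_in[OF I(3)] h(2) by auto
  \<comment> \<open>The embedding injects \<open>M\<close> into its ultrapower, which is part of the
    type; by Schroeder and Bernstein the ultrapower is again equinumerous with the type.\<close>
  ultimately obtain k where "bij_betw k (UNIV :: 'v set) (Ult M Z)"
    using Schroeder_Bernstein[of "\<lambda>x. Emb M Z (h x)" UNIV "Ult M Z" "\<lambda>x. x"] by auto
  then have k: "inj k" "Ult M Z = range k" unfolding bij_betw_def by auto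
  define t :: "nat \<Rightarrow> (nat \<Rightarrow> 'v) \<Rightarrow> 'v" where "t n = (if n = 0 then (\<lambda>e. Z) else (\<lambda>e. e 0))" for n
  have t: "dterm (t n)" for n unfolding t_def by (simp add: dterm_var dterm_const)
  have "dpred (\<lambda>e. e 0 \<in> M \<and> umem M (\<epsilon>) (t 0 e) (t 1 e))"
    by (rule dpred_fo[OF fo_umem[of 0 1] inner_dcls[OF M] t])
       (intro d_rules dpred_cls[OF inner_dcls[OF M]], auto simp: t_def ccuf_in[OF Z])
  then have "dpred (\<lambda>e. e 0 \<in> M \<and> umem M (\<epsilon>) Z (e 0))" by (simp add: t_def)
  moreover have "(e 0 \<in> M \<and> umem M (\<epsilon>) Z (e 0)) \<longleftrightarrow> e 0 \<in> Ult M Z" for e :: "nat \<Rightarrow> 'v"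
    using umem_in[OF M Z, of "e 0"] I(1) by auto
  ultimately have "dcls (\<lambda>y. y \<in> Ult M Z)" unfolding dcls_def by simp
  moreover have "\<forall>y\<in>Ult M Z. \<forall>x. x \<epsilon> y \<longrightarrow> x \<in> Ult M Z"
    using I(1,2) inner_trans[OF M] by blast
  moreover have "ZFC (Ult M Z) (\<epsilon>)"
    by (rule ZFC_elem[OF I(3) _ inner_zfc[OF M]]) (use inner_ne[OF M] in blast)
  ultimately show ?thesis unfolding inner_def using k by blast
qed

lemma inner_sep3:
  assumes M: "inner M" and Q: "fo (\<lambda>M E e. Q M E (e 0) (e 1) (e 2))" and pq: "p \<in> M" "q \<in> M" and a: "a \<in> M"
  obtains b where "b \<in> M" "\<forall>x\<in>M. x \<epsilon> b \<longleftrightarrow> x \<epsilon> a \<and> Q M (\<epsilon>) x p q"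
proof -
  have "range (case_nat a (case_nat p (\<lambda>_. q))) \<subseteq> M" using pq a by (auto split: nat.split)
  from inner_sep[OF M Q this a] obtain b where "b \<in> M"
    "\<And>x. x \<in> M \<Longrightarrow> x \<epsilon> b \<longleftrightarrow> x \<epsilon> a \<and> Q M (\<epsilon>) x p q" by (auto simp: numeral_2_eq_2)
  then show thesis by (intro that) auto
qed

lemma inner_Pow:
  assumes M: "inner M" "X \<in> M" obtains b where "b \<in> M" "\<forall>x\<in>M. x \<epsilon> b \<longleftrightarrow> sub x X"
proof -
  obtain b where b: "b \<in> M" "\<forall>x\<in>M. x \<epsilon> b \<longleftrightarrow> is_subset M (\<epsilon>) x X"
    using inner_zfc[OF M(1), unfolded ZFC_def, THEN conjunct2, THEN conjunct2, THEN conjunct2, THEN conjunct2, THEN conjunct1] M(2) by blast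
  show thesis by (rule that[OF b(1)]) (use b(2) in_subset[OF M(1)] in blast)
qed

subsection \<open>Recognising ultrapowers\<close>

text \<open>The ultrafilter laws are inherited from truth at the seed. Given a countable family in
  \<open>Z\<close>, every set of the image family is the image of a set of the family, because
  \<open>k\<close> adds nothing to omega; so the seed lies in all of them.\<close>

lemma recognize_cc:
  assumes M: "inner M" and N: "inner N" and k: "elem (\<epsilon>) M N k" and X: "X \<in> M"
    and s: "s \<in> N" "s \<epsilon> k X" and om: "omega_fixed (\<epsilon>) M N k"
    and Z: "Z \<in> M" "\<And>A. A \<in> M \<Longrightarrow> A \<epsilon> Z \<longleftrightarrow> sub A X \<and> s \<epsilon> k A"
  shows "ultrafilter_on M (\<epsilon>) X Z" "ccuf M Z"
proof -
  show uf: "ultrafilter_on M (\<epsilon>) X Z"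
    unfolding ultrafilter_on_def
  proof (intro conjI ballI impI)
    show "X \<epsilon> Z" using Z(2)[OF X] s unfolding sub_def by simp
    fix A assume A: "A \<in> M"
    { assume "A \<epsilon> Z" then show "is_subset M (\<epsilon>) A X" using Z(2)[OF A] in_subset[OF M A] by simp }
    { assume "A \<epsilon> Z"
      then have "\<not> is_empty N (\<epsilon>) (k A)" using Z(2)[OF A] s(1) unfolding is_empty_def by blast
      then show "\<not> is_empty M (\<epsilon>) A" using elem_fo1[where Q = is_empty, OF k fo_is_empty A] by simp }
    fix B assume B: "B \<in> M"
    { assume "A \<epsilon> Z \<and> is_subset M (\<epsilon>) A B \<and> is_subset M (\<epsilon>) B X"
      then show "B \<epsilon> Z" using Z(2)[OF A] Z(2)[OF B] in_subset[OF M A] in_subset[OF M B] elem_sub[OF M N k A B]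
        unfolding sub_def by blast }
    { assume H: "is_subset M (\<epsilon>) A X \<and> (\<forall>x\<in>M. x \<epsilon> B \<longleftrightarrow> x \<epsilon> X \<and> \<not> x \<epsilon> A)"
      have Q: "fo (\<lambda>M E e. \<forall>x\<in>M. E x (e 0) \<longleftrightarrow> E x (e 1) \<and> \<not> E x (e 2))" by (intro fo_intros)
      have "\<forall>x\<in>N. x \<epsilon> k B \<longleftrightarrow> x \<epsilon> k X \<and> \<not> x \<epsilon> k A"
        using elem_fo3[where Q = "\<lambda>M E B X A. \<forall>x\<in>M. E x B \<longleftrightarrow> E x X \<and> \<not> E x A", OF k Q B X A] H by blast
      moreover have "sub B X" unfolding sub_def using H inner_trans[OF M B] by blast
      ultimately show "A \<epsilon> Z \<or> B \<epsilon> Z" using Z(2)[OF A] Z(2)[OF B] H in_subset[OF M A] s by blast }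
    fix C assume C: "C \<in> M" and H: "A \<epsilon> Z \<and> B \<epsilon> Z \<and> (\<forall>x\<in>M. x \<epsilon> C \<longleftrightarrow> x \<epsilon> A \<and> x \<epsilon> B)"
    have Q: "fo (\<lambda>M E e. \<forall>x\<in>M. E x (e 0) \<longleftrightarrow> E x (e 1) \<and> E x (e 2))" by (intro fo_intros)
    have "\<forall>x\<in>N. x \<epsilon> k C \<longleftrightarrow> x \<epsilon> k A \<and> x \<epsilon> k B"
      using elem_fo3[where Q = "\<lambda>M E C A B. \<forall>x\<in>M. E x C \<longleftrightarrow> E x A \<and> E x B", OF k Q C A B] H by blast
    moreover have "sub C X" using H inner_trans[OF M C] Z(2)[OF A] unfolding sub_def by blast
    ultimately show "C \<epsilon> Z" using Z(2)[OF A] Z(2)[OF B] Z(2)[OF C] H s by blast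
  qed
  have "countably_complete M (\<epsilon>) X Z"
    unfolding countably_complete_def
  proof (intro ballI impI)
    fix w F assume w: "w \<in> M" and F: "F \<in> M"
      and "is_omega M (\<epsilon>) w \<and> is_fun_on M (\<epsilon>) w F \<and> (\<forall>n\<in>M. \<forall>A\<in>M. maps_to M (\<epsilon>) F n A \<longrightarrow> A \<epsilon> Z)"
    then have wo: "is_omega M (\<epsilon>) w" and Ff: "fn w F" and FZ: "\<And>n A. n \<in> M \<Longrightarrow> A \<in> M \<Longrightarrow> maps_to M (\<epsilon>) F n A \<Longrightarrow> A \<epsilon> Z"
      using in_fun[OF M w F] by simp_all
    let ?R = "\<lambda>M E x F. \<forall>n\<in>M. \<forall>A\<in>M. maps_to M E F n A \<longrightarrow> E x A"
    have R: "fo (\<lambda>M E e. ?R M E (e 0) (e 1))" by (intro fo_intros fo_basic)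
    obtain B where B: "B \<in> M" "\<forall>x\<in>M. x \<epsilon> B \<longleftrightarrow> x \<epsilon> X \<and> ?R M (\<epsilon>) x F"
      by (rule inner_sep3[where Q = "\<lambda>M E x F _. ?R M E x F", OF M R F F X])
    have Q: "fo (\<lambda>M E e. \<forall>x\<in>M. E x (e 0) \<longleftrightarrow> E x (e 1) \<and> ?R M E x (e 2))" by (intro fo_intros fo_basic)
    have kB: "\<forall>x\<in>N. x \<epsilon> k B \<longleftrightarrow> x \<epsilon> k X \<and> ?R N (\<epsilon>) x (k F)"
      using elem_fo3[where Q = "\<lambda>M E B X F. \<forall>x\<in>M. E x B \<longleftrightarrow> E x X \<and> ?R M E x F", OF k Q B(1) X F] B(2) by blast
    have "?R N (\<epsilon>) s (k F)"
    proof (intro ballI impI)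
      fix n A assume n: "n \<in> N" and A: "A \<in> N" and m: "maps_to N (\<epsilon>) (k F) n A"
      note kF = elem_fn[OF M N k w F Ff]
      have o: "opr n A \<epsilon> k F" using m in_maps[OF N n A] by simp
      have nw: "n \<epsilon> k w" by (rule fn_dom[OF kF o])
      then obtain i where i: "i \<in> M" "i \<epsilon> w" "n = k i" using om wo w n unfolding omega_fixed_def by blast
      have "A = k (app F i)" using opr_mem_fn[OF kF nw] o elem_app[OF M N k w F Ff i(2)] i(3) by simp
      moreover have a: "app F i \<in> M" by (rule app_in[OF M F Ff i(2)])
      moreover have "app F i \<epsilon> Z"
        by (rule FZ[OF i(1) a]) (use in_maps[OF M i(1) a] opr_mem_fn[OF Ff i(2)] in simp)
      ultimately show "s \<epsilon> A" using Z(2)[OF a] by simp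
    qed
    then have "s \<epsilon> k B" using kB s by blast
    moreover have "sub B X" unfolding sub_def using B inner_trans[OF M B(1)] by blast
    ultimately have "B \<epsilon> Z" using Z(2)[OF B(1)] by simp
    then show "\<exists>B\<in>M. B \<epsilon> Z \<and> (\<forall>x\<in>M. x \<epsilon> B \<longleftrightarrow> x \<epsilon> X \<and> (\<forall>n\<in>M. \<forall>A\<in>M. maps_to M (\<epsilon>) F n A \<longrightarrow> x \<epsilon> A))"
      using B by blast
  qed
  with uf show "ccuf M Z" unfolding cc_ultrafilter_def using Z(1) X by blast
qed

text \<open>Uniqueness turned into a criterion: \<open>k\<close> and the ultrapower embedding by
  \<open>Z\<close> have the same derived ultrafilter, so they coincide. The crux in its applications
  is that this ultrafilter belongs to \<open>M\<close>.\<close>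

theorem recognize:
  assumes M: "inner M" and N: "inner N" and k: "elem (\<epsilon>) M N k" "demb M k" "k \<in> extensional M" and X: "X \<in> M"
    and gen: "generated (\<epsilon>) M N k X s" and om: "omega_fixed (\<epsilon>) M N k"
    and Z: "Z \<in> M" "\<And>A. A \<in> M \<Longrightarrow> A \<epsilon> Z \<longleftrightarrow> sub A X \<and> s \<epsilon> k A"
  shows "ccuf M Z" "Ult M Z = N" "Emb M Z = k"
proof -
  note s = generatedD(1,2)[OF M N k(1) X gen]
  show cc: "ccuf M Z" by (rule recognize_cc(2)[OF M N k(1) X s om Z])
  obtain X' s' where "is_ultrapower (\<epsilon>) M Z (Ult M Z) (Emb M Z) X' s'" by (rule inner_ultrapower[OF M cc])
  note I = is_ultrapowerD[OF this]
  note N' = inner_Ult[OF M cc]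
  have s': "s' \<epsilon> Emb M Z X'" by (rule generatedD(2)[OF M N' I(3,5,7)])
  have "X \<epsilon> Z" "X' \<epsilon> Z"
    using Z(2)[OF X] s I(8)[OF I(5)] s' in_subset[OF M I(5)] unfolding sub_def by auto
  then have "sub X X'" "sub X' X"
    using Z(2)[OF I(5)] I(8)[OF X] in_subset[OF M X] by auto
  then have XX: "X' = X" unfolding sub_def by (intro ext) blast
  have U: "s' \<epsilon> Emb M Z A \<longleftrightarrow> s \<epsilon> k A" if "A \<in> M" "sub A X" for A
    using that Z(2)[OF that(1)] I(8)[OF that(1)] in_subset[OF M that(1)] unfolding XX by simp
  note u = ultrapower_unique[OF M N' N I(3) demb_Emb[OF M cc] k(1,2) X I(7)[unfolded XX] gen U]
  show "Ult M Z = N" by (rule u(1))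
  show "Emb M Z = k" by (rule extensionalityI[OF I(4) k(3)]) (rule u(2))
qed

subsection \<open>Compositions of ultrapowers\<close>

lemma app_eqI: "opr x y \<epsilon> f \<Longrightarrow> (\<And>z. opr x z \<epsilon> f \<Longrightarrow> z = y) \<Longrightarrow> app f x = y"
  unfolding app_def by (rule the_or_junk_eq)

end

text \<open>
  First-order rendering of constructions that have to be carried out inside an inner model.
\<close>

definition prod_prop :: "'v set \<Rightarrow> ('v \<Rightarrow> 'v \<Rightarrow> bool) \<Rightarrow> 'v \<Rightarrow> 'v \<Rightarrow> 'v \<Rightarrow> bool" where
  "prod_prop M E F Y X \<longleftrightarrow> (\<forall>i\<in>M. \<forall>y\<in>M. \<forall>z\<in>M. E i Y \<longrightarrow> maps_to M E F i y \<longrightarrow> E z y \<longrightarrow>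
     (\<exists>p\<in>M. is_opair M E i z p \<and> E p X))"

text \<open>\<open>g\<close> sends the pair of \<open>i\<close> and \<open>z\<close> to
  \<open>H(i)(z)\<close>. Values are mentioned only where they are unique, so that such a
  \<open>g\<close> exists for every set \<open>H\<close>.\<close>

definition comp_prop :: "'v set \<Rightarrow> ('v \<Rightarrow> 'v \<Rightarrow> bool) \<Rightarrow> 'v \<Rightarrow> 'v \<Rightarrow> 'v \<Rightarrow> bool" where
  "comp_prop M E H X g \<longleftrightarrow> (\<forall>p\<in>M. \<forall>i\<in>M. \<forall>z\<in>M. \<forall>h\<in>M. \<forall>y\<in>M. E p X \<longrightarrow> is_opair M E i z p \<longrightarrow>
     maps_to M E H i h \<longrightarrow> (\<forall>h'\<in>M. maps_to M E H i h' \<longrightarrow> h' = h) \<longrightarrow>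
     maps_to M E h z y \<longrightarrow> (\<forall>y'\<in>M. maps_to M E h z y' \<longrightarrow> y' = y) \<longrightarrow> maps_to M E g p y)"

text \<open>\<open>g\<close> sends \<open>p\<close> to \<open>H(p)(t)\<close>, with the same
  precaution about unique values.\<close>

definition eval_prop :: "'v set \<Rightarrow> ('v \<Rightarrow> 'v \<Rightarrow> bool) \<Rightarrow> 'v \<Rightarrow> 'v \<Rightarrow> 'v \<Rightarrow> 'v \<Rightarrow> bool" where
  "eval_prop M E H X t g \<longleftrightarrow> (\<forall>p\<in>M. \<forall>h\<in>M. \<forall>y\<in>M. E p X \<longrightarrow>
     maps_to M E H p h \<longrightarrow> (\<forall>h'\<in>M. maps_to M E H p h' \<longrightarrow> h' = h) \<longrightarrow>
     maps_to M E h t y \<longrightarrow> (\<forall>y'\<in>M. maps_to M E h t y' \<longrightarrow> y' = y) \<longrightarrow> maps_to M E g p y)"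

lemma fo_prod_prop: "fo (\<lambda>M E e. prod_prop M E (e a) (e b) (e c))"
  unfolding prod_prop_def by (intro fo_intros fo_basic)

lemma fo_comp_prop: "fo (\<lambda>M E e. comp_prop M E (e a) (e b) (e c))"
  unfolding comp_prop_def by (intro fo_intros fo_basic)

lemma fo_eval_prop: "fo (\<lambda>M E e. eval_prop M E (e a) (e b) (e c) (e d))"
  unfolding eval_prop_def by (intro fo_intros fo_basic)

lemma zfc_prod: assumes "ZFC UNIV E" shows "\<exists>X\<in>UNIV. prod_prop UNIV E F Y X"
proof -
  interpret z: zfc E by unfold_locales fact
  \<comment> \<open>A transitive set containing \<open>F\<close> contains all members of the values
    of \<open>F\<close>, so its product with \<open>Y\<close> serves as the index set.\<close>
  obtain T where T: "z.trans T" "E F T" by (rule z.trcl)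
  have 1: "E z T" if "E (z.opr i y) F" "E z y" for i y z
  proof -
    have "E (z.opr i y) T" using T that unfolding z.trans_def by blast
    moreover have "E (z.mk {x. x = i \<or> x = y}) (z.opr i y)" by (simp add: z.mem_opr)
    ultimately have "E (z.mk {x. x = i \<or> x = y}) T" using T unfolding z.trans_def by blast
    then have "E y T" using T(1) z.mem_upair unfolding z.trans_def by blast
    then show ?thesis using T(1) that(2) unfolding z.trans_def by blast
  qed
  define X where "X = z.mk {p. \<exists>x y. E x Y \<and> E y T \<and> p = z.opr x y}"
  have "E p X \<longleftrightarrow> (\<exists>x y. E x Y \<and> E y T \<and> p = z.opr x y)" for p
    unfolding X_def by (simp only: z.mem_mk[OF z.small_prod] mem_Collect_eq)
  then show ?thesis
    unfolding prod_prop_def z.maps_to_iff z.is_opair_iff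
    by (intro bexI[of _ X]) (auto dest: 1)
qed

lemma zfc_comp: assumes "ZFC UNIV E" shows "\<exists>g\<in>UNIV. is_fun_on UNIV E X g \<and> comp_prop UNIV E H X g"
proof -
  interpret z: zfc E by unfold_locales fact
  define G where "G p = the_or_junk (\<lambda>y. \<exists>i z. p = z.opr i z \<and> y = z.app (z.app H i) z)" for p
  have dG: "z.dfun G" unfolding G_def z.dfun_def by (intro z.d_rules z.dterm_the)
  have G: "G (z.opr i z) = z.app (z.app H i) z" for i z
    unfolding G_def by (rule the_or_junk_eq) auto
  show ?thesis
    unfolding comp_prop_def z.maps_to_iff z.is_opair_iff
  proof (intro bexI[of _ "z.lam X G"] conjI ballI impI)
    fix p i z h y
    assume p: "E p X" "p = z.opr i z" and h: "E (z.opr i h) H" "\<forall>h'\<in>UNIV. E (z.opr i h') H \<longrightarrow> h' = h"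
      and y: "E (z.opr z y) h" "\<forall>y'\<in>UNIV. E (z.opr z y') h \<longrightarrow> y' = y"
    have "z.app H i = h" by (rule z.app_eqI[OF h(1)]) (use h(2) in blast)
    moreover have "z.app h z = y" by (rule z.app_eqI[OF y(1)]) (use y(2) in blast)
    ultimately have "G p = y" using G p(2) by simp
    then show "E (z.opr p y) (z.lam X G)" using p(1) by (auto simp: z.mem_lam[OF dG])
  qed (simp_all add: z.fn_lam[OF dG])
qed

lemma zfc_eval: assumes "ZFC UNIV E" shows "\<exists>g\<in>UNIV. is_fun_on UNIV E X g \<and> eval_prop UNIV E H X t g"
proof -
  interpret z: zfc E by unfold_locales fact
  have dG: "z.dfun (\<lambda>p. z.app (z.app H p) t)" unfolding z.dfun_def by (intro z.d_rules)
  show ?thesis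
    unfolding eval_prop_def z.maps_to_iff
  proof (intro bexI[of _ "z.lam X (\<lambda>p. z.app (z.app H p) t)"] conjI ballI impI)
    fix p h y
    assume p: "E p X" and h: "E (z.opr p h) H" "\<forall>h'\<in>UNIV. E (z.opr p h') H \<longrightarrow> h' = h"
      and y: "E (z.opr t y) h" "\<forall>y'\<in>UNIV. E (z.opr t y') h \<longrightarrow> y' = y"
    have "z.app H p = h" by (rule z.app_eqI[OF h(1)]) (use h(2) in blast)
    moreover have "z.app h t = y" by (rule z.app_eqI[OF y(1)]) (use y(2) in blast)
    ultimately show "E (z.opr p y) (z.lam X (\<lambda>p. z.app (z.app H p) t))" using p by (auto simp: z.mem_lam[OF dG])
  qed (simp_all add: z.fn_lam[OF dG])
qed

context zfc
begin

text \<open>An iteration of two ultrapowers is a single one, by the ultrafilter derived from the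
  pair of the seeds \<open>k t\<close> and \<open>s'\<close>. With the universe as \<open>M\<close>,
  it makes the Ultrapower Axiom applicable to the targets of iterations.\<close>

theorem compose:
  assumes M: "inner M" and W: "ccuf M W" and Q: "ccuf (Ult M W) Q"
  obtains D where "ccuf M D" "Ult M D = Ult (Ult M W) Q"
    "\<And>x. x \<in> M \<Longrightarrow> Emb M D x = Emb (Ult M W) Q (Emb M W x)"
proof -
  define N where "N = Ult M W"
  define P where "P = Ult N Q"
  define j where "j = Emb M W"
  define k where "k = Emb N Q"
  note QN = Q[folded N_def]
  obtain Y t where "is_ultrapower (\<epsilon>) M W N j Y t" unfolding N_def j_def by (rule inner_ultrapower[OF M W])
  note J = is_ultrapowerD[OF this]
  have N: "inner N" unfolding N_def by (rule inner_Ult[OF M W])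
  obtain X' s' where "is_ultrapower (\<epsilon>) N Q P k X' s'" unfolding P_def k_def by (rule inner_ultrapower[OF N QN])
  note K = is_ultrapowerD[OF this]
  have P: "inner P" unfolding P_def by (rule inner_Ult[OF N QN])
  have dj: "demb M j" unfolding j_def by (rule demb_Emb[OF M W])
  have dk: "demb N k" unfolding k_def by (rule demb_Emb[OF N QN])
  define l where "l = restrict (\<lambda>x. k (j x)) M"
  have l: "l x = k (j x)" if "x \<in> M" for x using that by (simp add: l_def)
  have el: "elem (\<epsilon>) M P l" by (rule elem_cong[OF elem_comp[OF J(3) K(3)] l])
  have jN: "x \<in> M \<Longrightarrow> j x \<in> N" for x by (rule elem_in[OF J(3)])
  have dl: "demb M l"
  proof -
    have "(x \<in> M \<and> l x = y) \<longleftrightarrow> (\<exists>z. (x \<in> M \<and> j x = z) \<and> (z \<in> N \<and> k z = y))" for x y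
      using l jN by auto
    then show ?thesis unfolding demb_def drel_def
      by (simp only:) (intro d_rules demb_app[OF dj] demb_app[OF dk])
  qed
  note t = generatedD(1,2)[OF M N J(3,5,7)]
  note s' = generatedD(1,2)[OF N P K(3,5,7)]
  \<comment> \<open>\<open>F\<close> represents the underlying set \<open>X'\<close> of
    \<open>Q\<close>; the new index set \<open>X\<close> contains the disjoint sum of the values of
    \<open>F\<close>.\<close>
  obtain F where F: "F \<in> M" "fn Y F" "X' = app (j F) t" using generatedD(3)[OF M N J(3,5,7) K(5)] by blast
  have rF: "range (case_nat F (\<lambda>_. Y)) \<subseteq> M" using F(1) J(5) by (auto split: nat.split)
  have Q1: "fo (\<lambda>M E e. \<exists>X\<in>M. prod_prop M E (e 0) (e 1) X)" by (intro fo_intros fo_prod_prop)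
  have "\<exists>X\<in>M. prod_prop M (\<epsilon>) F Y X"
    using inner_thm[OF M Q1 zfc_prod rF] by simp
  then obtain X where X: "X \<in> M" "prod_prop M (\<epsilon>) F Y X" ..
  have lX: "prod_prop P (\<epsilon>) (l F) (l Y) (l X)"
    using elem_fo3[where Q = prod_prop, OF el fo_prod_prop F(1) J(5) X(1)] X(2) by simp
  note jF = elem_fn[OF M N J(3,5) F(1,2)]
  have kt: "k t \<in> P" "k t \<epsilon> l Y" using elem_in[OF K(3) t(1)] elem_mem[OF K(3) t(1) jN[OF J(5)]] t(2) l[OF J(5)] by simp_all
  have "opr t X' \<epsilon> j F" using opr_mem_fn[OF jF t(2)] F(3) by simp
  then have "opr (k t) (k X') \<epsilon> l F" unfolding l[OF F(1)] by (rule elem_maps[OF N P K(3) jN[OF F(1)] t(1) K(5)])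
  then have "maps_to P (\<epsilon>) (l F) (k t) (k X')" using in_maps[OF P kt(1) elem_in[OF K(3,5)]] by simp
  then obtain s where s: "s \<in> P" "is_opair P (\<epsilon>) (k t) s' s" "s \<epsilon> l X"
    using lX[unfolded prod_prop_def, rule_format, OF kt(1) elem_in[OF K(3,5)] s'(1) kt(2) _ s'(2)] by blast
  have s_eq: "s = opr (k t) s'" using s(2) in_opair[OF P kt(1) s'(1) s(1)] by simp
  have gen: "generated (\<epsilon>) M P l X s"
  proof (rule generatedI[OF M P el X(1) s(1,3)])
    fix y assume y: "y \<in> P"
    \<comment> \<open>Here \<open>y = k(G)(s')\<close> and \<open>G = j(H)(t)\<close>, so
      \<open>y\<close> arises from \<open>l(H)\<close> by evaluation first at \<open>k(t)\<close>
      and then at \<open>s'\<close>; the function \<open>g\<close> below performs both evaluations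
      on a pair.\<close>
    obtain G where G: "G \<in> N" "fn X' G" "y = app (k G) s'" using generatedD(3)[OF N P K(3,5,7) y] by blast
    obtain H where H: "H \<in> M" "fn Y H" "G = app (j H) t" using generatedD(3)[OF M N J(3,5,7) G(1)] by blast
    have r: "range (case_nat H (\<lambda>_. X)) \<subseteq> M" using H(1) X(1) by (auto split: nat.split)
    have Q2: "fo (\<lambda>M E e. \<exists>g\<in>M. is_fun_on M E (e 1) g \<and> comp_prop M E (e 0) (e 1) g)"
      by (intro fo_intros fo_comp_prop fo_basic)
    have "\<exists>g\<in>M. is_fun_on M (\<epsilon>) X g \<and> comp_prop M (\<epsilon>) H X g"
      using inner_thm[OF M Q2 zfc_comp r] by simp
    then obtain g where g: "g \<in> M" "is_fun_on M (\<epsilon>) X g" "comp_prop M (\<epsilon>) H X g" by blast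
    have lg: "comp_prop P (\<epsilon>) (l H) (l X) (l g)"
      using elem_fo3[where Q = comp_prop, OF el fo_comp_prop H(1) X(1) g(1)] g(3) by simp
    have kG: "k G \<in> P" by (rule elem_in[OF K(3) G(1)])
    note fH = elem_fn[OF M P el J(5) H(1,2)] and fG = elem_fn[OF N P K(3,5) G(1,2)]
    have "app (l H) (k t) = k G"
      using elem_app[OF N P K(3) jN[OF J(5)] jN[OF H(1)] elem_fn[OF M N J(3,5) H(1,2)] t(2)] l[OF H(1)] H(3) by simp
    then have 1: "maps_to P (\<epsilon>) (l H) (k t) v \<longleftrightarrow> v = k G" if "v \<in> P" for v
      using in_maps[OF P kt(1) that] opr_mem_fn[OF fH kt(2)] by simp
    have 2: "maps_to P (\<epsilon>) (k G) s' v \<longleftrightarrow> v = y" if "v \<in> P" for v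
      using in_maps[OF P s'(1) that] opr_mem_fn[OF fG s'(2)] G(3) by simp
    have "maps_to P (\<epsilon>) (l g) s y"
      by (rule lg[unfolded comp_prop_def, rule_format, OF s(1) kt(1) s'(1) kG y s(3,2)])
         (simp_all add: 1 2 kG y)
    then have "opr s y \<epsilon> l g" using in_maps[OF P s(1) y] by simp
    moreover have "fn X g" using in_fun[OF M X(1) g(1)] g(2) by simp
    ultimately show "\<exists>g\<in>M. fn X g \<and> opr s y \<epsilon> l g" using g(1) by blast
  qed
  have om: "omega_fixed (\<epsilon>) M P l"
    unfolding omega_fixed_def
  proof (intro ballI impI)
    fix w n assume w: "w \<in> M" "is_omega M (\<epsilon>) w" and n: "n \<in> P" "n \<epsilon> l w"
    have jw: "is_omega N (\<epsilon>) (j w)" using elem_fo1[where Q = is_omega, OF J(3) fo_is_omega w(1)] w(2) by simp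
    obtain m where m: "m \<in> N" "m \<epsilon> j w" "n = k m"
      using K(9)[unfolded omega_fixed_def, rule_format, OF jN[OF w(1)] jw n(1)] n(2) l[OF w(1)] by auto
    obtain i where i: "i \<in> M" "i \<epsilon> w" "m = j i"
      using J(9)[unfolded omega_fixed_def, rule_format, OF w m(1,2)] by blast
    show "\<exists>m\<in>M. m \<epsilon> w \<and> n = l m" by (rule bexI[OF _ i(1)]) (simp add: m(3) i l)
  qed
  obtain PX where PX: "PX \<in> M" "\<forall>A\<in>M. A \<epsilon> PX \<longleftrightarrow> sub A X" by (rule inner_Pow[OF M X(1)])
  have sN: "s \<in> N" using s(1) K(1) by blast
  have Q3: "fo (\<lambda>M E e. \<exists>C\<in>M. uemb M E (e 1) (e 0) C \<and> E (e 2) C)" by (intro fo_intros fo_uemb)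
  \<comment> \<open>The derived ultrafilter is placed in \<open>M\<close> in two stages:
    \<open>k\<close> is expressible by a formula inside \<open>N\<close>, and \<open>j\<close> by
    one inside \<open>M\<close>.\<close>
  obtain D1 where D1: "D1 \<in> N" "\<forall>B\<in>N. B \<epsilon> D1 \<longleftrightarrow> B \<epsilon> j PX \<and> (\<exists>C\<in>N. uemb N (\<epsilon>) Q B C \<and> s \<epsilon> C)"
    by (rule inner_sep3[where Q = "\<lambda>M E B q s. \<exists>C\<in>M. uemb M E q B C \<and> E s C",
          OF N Q3 ccuf_in[OF QN] sN jN[OF PX(1)]])
  have Q4: "fo (\<lambda>M E e. \<exists>C\<in>M. uemb M E (e 1) (e 0) C \<and> E C (e 2))" by (intro fo_intros fo_uemb)
  have D1M: "D1 \<in> M" using D1(1) J(1) by blast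
  obtain D where D: "D \<in> M" "\<forall>A\<in>M. A \<epsilon> D \<longleftrightarrow> A \<epsilon> PX \<and> (\<exists>C\<in>M. uemb M (\<epsilon>) W A C \<and> C \<epsilon> D1)"
    by (rule inner_sep3[where Q = "\<lambda>M E B q s. \<exists>C\<in>M. uemb M E q B C \<and> E C s",
          OF M Q4 ccuf_in[OF W] D1M PX(1)])
  have DZ: "A \<epsilon> D \<longleftrightarrow> sub A X \<and> s \<epsilon> l A" if A: "A \<in> M" for A
  proof -
    have jA: "j A \<in> N" "j A \<in> M" using jN[OF A] J(1) by auto
    have "(\<exists>C\<in>M. uemb M (\<epsilon>) W A C \<and> C \<epsilon> D1) \<longleftrightarrow> j A \<epsilon> D1"
      using uemb_in[OF M W A] jA(2) unfolding j_def by auto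
    moreover have "(\<exists>C\<in>N. uemb N (\<epsilon>) Q (j A) C \<and> s \<epsilon> C) \<longleftrightarrow> s \<epsilon> l A"
      using uemb_in[OF N QN jA(1)] elem_in[OF K(3) jA(1)] K(1) l[OF A] unfolding k_def by auto
    moreover have "j A \<epsilon> j PX \<longleftrightarrow> A \<epsilon> PX" by (rule elem_mem[OF J(3) A PX(1)])
    ultimately show ?thesis using D(2)[rule_format, OF A] D1(2)[rule_format, OF jA(1)] PX(2)[rule_format, OF A] by simp
  qed
  have "l \<in> extensional M" by (simp add: l_def)
  note R = recognize[OF M P el dl this X(1) gen om D(1) DZ]
  show thesis by (rule that[OF R(1)]) (use R(2,3) l in \<open>simp_all add: P_def N_def j_def k_def\<close>)
qed

end

subsection \<open>Agreement of internal ultrapower embeddings\<close>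

text \<open>All pairs of ultrafilters are quantified over, not one given pair, so that the set of
  these points is definable from \<open>c\<close> and \<open>X\<close> alone.\<close>

definition disagree :: "'v set \<Rightarrow> ('v \<Rightarrow> 'v \<Rightarrow> bool) \<Rightarrow> 'v \<Rightarrow> 'v \<Rightarrow> 'v \<Rightarrow> bool" where
  "disagree M E c X x \<longleftrightarrow> E x X \<and> (\<exists>Z\<in>M. \<exists>Z'\<in>M. ccu M E Z \<and> ccu M E Z' \<and>
     (\<forall>y\<in>M. umem M E Z y \<longleftrightarrow> umem M E Z' y) \<and>
     (\<exists>y\<in>M. uemb M E Z c y \<and> uemb M E Z' c y) \<and> (\<exists>y\<in>M. uemb M E Z X y \<and> uemb M E Z' X y) \<and>
     (\<exists>y\<in>M. \<exists>y'\<in>M. uemb M E Z x y \<and> uemb M E Z' x y' \<and> y \<noteq> y'))"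

definition chosen :: "'v set \<Rightarrow> ('v \<Rightarrow> 'v \<Rightarrow> bool) \<Rightarrow> 'v \<Rightarrow> 'v \<Rightarrow> 'v \<Rightarrow> bool" where
  "chosen M E c X x \<longleftrightarrow> (\<exists>S\<in>M. (\<forall>z\<in>M. E z S \<longleftrightarrow> disagree M E c X z) \<and>
     maps_to M E c S x \<and> (\<forall>x'\<in>M. maps_to M E c S x' \<longrightarrow> x' = x))"

definition chooses :: "'v set \<Rightarrow> ('v \<Rightarrow> 'v \<Rightarrow> bool) \<Rightarrow> 'v \<Rightarrow> 'v \<Rightarrow> bool" where
  "chooses M E c X \<longleftrightarrow> (\<forall>S\<in>M. is_subset M E S X \<longrightarrow> (\<exists>x\<in>M. E x S) \<longrightarrow>
     (\<exists>x\<in>M. E x S \<and> maps_to M E c S x \<and> (\<forall>x'\<in>M. maps_to M E c S x' \<longrightarrow> x' = x)))"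

lemma fo_disagree: "fo (\<lambda>M E e. disagree M E (e a) (e b) (e c))"
  unfolding disagree_def by (intro fo_intros fo_ccu fo_umem fo_uemb)

lemma fo_chosen: "fo (\<lambda>M E e. chosen M E (e a) (e b) (e c))"
  unfolding chosen_def by (intro fo_intros fo_disagree fo_maps_to)

lemma fo_chooses: "fo (\<lambda>M E e. chooses M E (e a) (e b))"
  unfolding chooses_def by (intro fo_intros fo_basic)

text \<open>Truth in an ultrapower as a formula about the ultrafilter; moving it by an embedding
  gives elementarity of that embedding restricted to the ultrapower.\<close>

lemma fo_relativized:
  "fo (\<lambda>M E e. sat {y \<in> M. umem M E (e a) y} E \<phi> (\<lambda>n. e (f n)))"
proof (induction \<phi> arbitrary: a f)
  case (Ex k \<phi>)
  have "(\<lambda>n. e (Suc (f n)))(k := e 0) = (\<lambda>n. e (if n = k then 0 else Suc (f n)))" for e :: "nat \<Rightarrow> 'a"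
    by auto
  then have 1: "fo (\<lambda>M E e :: nat \<Rightarrow> 'a. sat {y \<in> M. umem M E (e (Suc a)) y} E \<phi> ((\<lambda>n. e (Suc (f n)))(k := e 0)))"
    using Ex.IH[of "Suc a" "\<lambda>n. if n = k then 0 else Suc (f n)"] by (simp only:)
  have "fo (\<lambda>M E e :: nat \<Rightarrow> 'a. \<exists>x\<in>M. umem M E (e a) x \<and> sat {y \<in> M. umem M E (e a) y} E \<phi> ((\<lambda>n. e (f n))(k := x)))"
    by (intro fo_intros fo_umem 1)
  moreover have "(\<exists>x\<in>M. umem M E (e a) x \<and> sat {y \<in> M. umem M E (e a) y} E \<phi> ((\<lambda>n. e (f n))(k := x))) \<longleftrightarrow>
      sat {y \<in> M. umem M E (e a) y} E (Ex k \<phi>) (\<lambda>n. e (f n))" for M E and e :: "nat \<Rightarrow> 'a"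
    by auto
  ultimately show ?case by (simp only:)
qed (simp_all add: fo_mem fo_eq fo_not fo_conj)

context zfc
begin

text \<open>The contradiction arises at the selected point \<open>y\<close>, not at
  \<open>x\<close>: \<open>y\<close> has its own pair of witnesses, both of which send it to the
  unique element chosen in their common target from the common images of \<open>c\<close> and
  \<open>X\<close>.\<close>

lemma agree:
  assumes M: "inner M" and Z: "ccuf M Z" and Z': "ccuf M Z'" and eq: "Ult M Z = Ult M Z'"
    and cX: "c \<in> M" "X \<in> M" "chooses M (\<epsilon>) c X"
    and c: "Emb M Z c = Emb M Z' c" and X: "Emb M Z X = Emb M Z' X" and x: "x \<epsilon> X"
  shows "Emb M Z x = Emb M Z' x"
proof (rule ccontr)
  assume ne: "Emb M Z x \<noteq> Emb M Z' x"
  have cc: "ccu M (\<epsilon>) Z \<longleftrightarrow> ccuf M Z" if "Z \<in> M" for Z by (rule ccu_iff[OF that])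
  have EM: "y \<in> M \<Longrightarrow> Emb M Z y \<in> M" if Z: "ccuf M Z" for Z y
  proof -
    obtain X s where "is_ultrapower (\<epsilon>) M Z (Ult M Z) (Emb M Z) X s" by (rule inner_ultrapower[OF M Z])
    note I = is_ultrapowerD[OF this]
    show "y \<in> M \<Longrightarrow> Emb M Z y \<in> M" using elem_in[OF I(3), of y] I(1) by blast
  qed
  have dis: "disagree M (\<epsilon>) c X z \<longleftrightarrow> z \<epsilon> X \<and> (\<exists>Z Z'. ccuf M Z \<and> ccuf M Z' \<and> Ult M Z = Ult M Z' \<and>
      Emb M Z c = Emb M Z' c \<and> Emb M Z X = Emb M Z' X \<and> Emb M Z z \<noteq> Emb M Z' z)" if z: "z \<in> M" for z
  proof -
    have u: "(\<forall>y\<in>M. umem M (\<epsilon>) Z y \<longleftrightarrow> umem M (\<epsilon>) Z' y) \<longleftrightarrow> Ult M Z = Ult M Z'"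
      if ZZ: "ccuf M Z" "ccuf M Z'" for Z Z'
    proof -
      have "Ult M Z \<subseteq> M" if Zc: "ccuf M Z" for Z
      proof -
        obtain X s where "is_ultrapower (\<epsilon>) M Z (Ult M Z) (Emb M Z) X s" by (rule inner_ultrapower[OF M Zc])
        from is_ultrapowerD(1)[OF this] show ?thesis .
      qed
      from this[OF ZZ(1)] this[OF ZZ(2)] show ?thesis
        using umem_in[OF M ZZ(1)] umem_in[OF M ZZ(2)] by auto
    qed
    have e: "(\<exists>y\<in>M. uemb M (\<epsilon>) Z a y \<and> uemb M (\<epsilon>) Z' a y) \<longleftrightarrow> Emb M Z a = Emb M Z' a"
      "(\<exists>y\<in>M. \<exists>y'\<in>M. uemb M (\<epsilon>) Z a y \<and> uemb M (\<epsilon>) Z' a y' \<and> y \<noteq> y') \<longleftrightarrow> Emb M Z a \<noteq> Emb M Z' a"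
      if ZZ: "ccuf M Z" "ccuf M Z'" and a: "a \<in> M" for Z Z' a
      using uemb_in[OF M ZZ(1) a] uemb_in[OF M ZZ(2) a] EM[OF ZZ(1) a] EM[OF ZZ(2) a] by auto
    have "(ccu M (\<epsilon>) Z \<and> ccu M (\<epsilon>) Z' \<and> (\<forall>y\<in>M. umem M (\<epsilon>) Z y \<longleftrightarrow> umem M (\<epsilon>) Z' y) \<and>
        (\<exists>y\<in>M. uemb M (\<epsilon>) Z c y \<and> uemb M (\<epsilon>) Z' c y) \<and> (\<exists>y\<in>M. uemb M (\<epsilon>) Z X y \<and> uemb M (\<epsilon>) Z' X y) \<and>
        (\<exists>y\<in>M. \<exists>y'\<in>M. uemb M (\<epsilon>) Z z y \<and> uemb M (\<epsilon>) Z' z y' \<and> y \<noteq> y')) \<longleftrightarrow>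
        (ccuf M Z \<and> ccuf M Z' \<and> Ult M Z = Ult M Z' \<and>
          Emb M Z c = Emb M Z' c \<and> Emb M Z X = Emb M Z' X \<and> Emb M Z z \<noteq> Emb M Z' z)"
      if ZM: "Z \<in> M" "Z' \<in> M" for Z Z'
    proof (cases "ccuf M Z \<and> ccuf M Z'")
      case True
      then have ZZ: "ccuf M Z" "ccuf M Z'" by auto
      show ?thesis using ZZ u[OF ZZ] e(1)[OF ZZ cX(1)] e(1)[OF ZZ cX(2)] e(2)[OF ZZ z] cc[OF ZM(1)] cc[OF ZM(2)] by simp
    next
      case False
      then show ?thesis using cc[OF ZM(1)] cc[OF ZM(2)] by blast
    qed
    then have "disagree M (\<epsilon>) c X z \<longleftrightarrow> z \<epsilon> X \<and> (\<exists>Z\<in>M. \<exists>Z'\<in>M. ccuf M Z \<and> ccuf M Z' \<and> Ult M Z = Ult M Z' \<and>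
      Emb M Z c = Emb M Z' c \<and> Emb M Z X = Emb M Z' X \<and> Emb M Z z \<noteq> Emb M Z' z)"
      unfolding disagree_def by (simp cong: bex_cong)
    then show ?thesis using ccuf_in by blast
  qed
  have xM: "x \<in> M" using inner_trans[OF M cX(2) x] .
  obtain S where S: "S \<in> M" "\<forall>z\<in>M. z \<epsilon> S \<longleftrightarrow> z \<epsilon> X \<and> disagree M (\<epsilon>) c X z"
    by (rule inner_sep3[where Q = "\<lambda>M E z c X. disagree M E c X z", OF M fo_disagree cX(1,2,2)])
  have S': "\<forall>z\<in>M. z \<epsilon> S \<longleftrightarrow> disagree M (\<epsilon>) c X z" using S(2) unfolding disagree_def by blast
  have "disagree M (\<epsilon>) c X x" using dis[OF xM] x Z Z' eq c X ne by blast
  then have "x \<epsilon> S" using S' xM by blast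
  moreover have "is_subset M (\<epsilon>) S X" unfolding is_subset_def using S(2) by blast
  ultimately obtain y where y: "y \<in> M" "y \<epsilon> S" "maps_to M (\<epsilon>) c S y" "\<forall>x'\<in>M. maps_to M (\<epsilon>) c S x' \<longrightarrow> x' = y"
    using cX(3)[unfolded chooses_def, rule_format, OF S(1)] xM by blast
  have ch: "chosen M (\<epsilon>) c X y" unfolding chosen_def using S(1) S' y by blast
  have "disagree M (\<epsilon>) c X y" using S' y(1,2) by blast
  then obtain Z1 Z2 where Z1: "ccuf M Z1" and Z2: "ccuf M Z2" and UU: "Ult M Z1 = Ult M Z2"
    and cc: "Emb M Z1 c = Emb M Z2 c" "Emb M Z1 X = Emb M Z2 X" "Emb M Z1 y \<noteq> Emb M Z2 y"
    unfolding dis[OF y(1)] by blast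
  obtain X1 s1 where "is_ultrapower (\<epsilon>) M Z1 (Ult M Z1) (Emb M Z1) X1 s1" by (rule inner_ultrapower[OF M Z1])
  note I1 = is_ultrapowerD[OF this]
  obtain X2 s2 where "is_ultrapower (\<epsilon>) M Z2 (Ult M Z2) (Emb M Z2) X2 s2" by (rule inner_ultrapower[OF M Z2])
  note I2 = is_ultrapowerD[OF this]
  let ?P = "Ult M Z2"
  note P = inner_Ult[OF M Z2]
  have "chosen ?P (\<epsilon>) (Emb M Z2 c) (Emb M Z2 X) (Emb M Z1 y)"
    using elem_fo3[where Q = chosen, OF I1(3) fo_chosen cX(1,2) y(1)] ch unfolding UU cc by simp
  moreover have "chosen ?P (\<epsilon>) (Emb M Z2 c) (Emb M Z2 X) (Emb M Z2 y)"
    using elem_fo3[where Q = chosen, OF I2(3) fo_chosen cX(1,2) y(1)] ch by simp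
  moreover have "a = b" if ab: "chosen ?P (\<epsilon>) c X a" "chosen ?P (\<epsilon>) c X b" "a \<in> ?P" for a b c X
  proof -
    obtain S where S: "S \<in> ?P" "\<forall>z\<in>?P. z \<epsilon> S \<longleftrightarrow> disagree ?P (\<epsilon>) c X z" "maps_to ?P (\<epsilon>) c S a"
      using ab(1) unfolding chosen_def by blast
    obtain T where T: "T \<in> ?P" "\<forall>z\<in>?P. z \<epsilon> T \<longleftrightarrow> disagree ?P (\<epsilon>) c X z"
      "\<forall>x'\<in>?P. maps_to ?P (\<epsilon>) c T x' \<longrightarrow> x' = b"
      using ab(2) unfolding chosen_def by blast
    have "S = T" by (rule inner_ext[OF P S(1) T(1)]) (use S(2) T(2) in blast)
    then show ?thesis using T(3) S(3) ab(3) by blast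
  qed
  moreover have "Emb M Z1 y \<in> ?P" using elem_in[OF I1(3) y(1)] UU by simp
  ultimately show False using cc(3) by blast
qed

end

lemma zfc_chooses: assumes "ZFC UNIV E" shows "\<exists>c\<in>UNIV. chooses UNIV E c X"
proof -
  interpret z: zfc E by unfold_locales fact
  define PX where "PX = z.mk {S. \<forall>x. E x S \<longrightarrow> E x X}"
  have PX: "E S PX \<longleftrightarrow> (\<forall>x. E x S \<longrightarrow> E x X)" for S
    unfolding PX_def by (simp only: z.mem_mk[OF z.small_Pow] mem_Collect_eq)
  have d: "z.dfun (\<lambda>S. S)" unfolding z.dfun_def by (intro z.d_rules)
  obtain c where c: "z.fn PX c" "\<And>S. E S PX \<Longrightarrow> \<exists>y. E y S \<Longrightarrow> E (z.app c S) S"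
    using z.choice[OF d] by metis
  have "chooses UNIV E c X"
    unfolding chooses_def is_subset_def z.maps_to_iff
  proof (intro ballI impI)
    fix S assume "\<forall>x\<in>UNIV. E x S \<longrightarrow> E x X" "\<exists>x\<in>UNIV. E x S"
    then have S: "E S PX" "\<exists>y. E y S" using PX by auto
    show "\<exists>x\<in>UNIV. E x S \<and> E (z.opr S x) c \<and> (\<forall>x'\<in>UNIV. E (z.opr S x') c \<longrightarrow> x' = x)"
      by (rule bexI[of _ "z.app c S"]) (use c(2)[OF S] z.opr_mem_fn[OF c(1) S(1)] in simp_all)
  qed
  then show ?thesis by blast
qed

text \<open>The formula version of \<open>is_restriction\<close>, by which restrictions of an
  embedding are produced inside an inner model.\<close>

definition emb_set :: "'v set \<Rightarrow> ('v \<Rightarrow> 'v \<Rightarrow> bool) \<Rightarrow> 'v \<Rightarrow> 'v \<Rightarrow> 'v \<Rightarrow> bool" where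
  "emb_set M E Z x f \<longleftrightarrow> (\<forall>p\<in>M. E p f \<longleftrightarrow> (\<exists>y\<in>M. E y x \<and> (\<exists>v\<in>M. uemb M E Z y v \<and> is_opair M E y v p)))"

lemma fo_emb_set: "fo (\<lambda>M E e. emb_set M E (e a) (e b) (e c))"
  unfolding emb_set_def by (intro fo_intros fo_uemb fo_basic)

lemma zfc_emb_set: assumes "ZFC UNIV E" shows "ccu UNIV E Z \<longrightarrow> (\<exists>f\<in>UNIV. emb_set UNIV E Z x f)"
proof
  assume "ccu UNIV E Z"
  then have "cc_ultrafilter UNIV E Z" by (simp add: ccu_iff)
  then interpret u: ultra E Z using assms by (simp add: ultra_def zfc_def ultra_axioms_def)
  have d: "u.dfun u.emb" unfolding u.dfun_def u.emb_def
    using u.demb_Emb[OF u.inner_UNIV u.cc] unfolding u.demb_def u.ult_emb_eq u.drel_def u.emb_def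
    unfolding u.dterm_def by (drule_tac u.dpred_rename[where f = "case_nat 1 (\<lambda>_. 0)"]) simp
  show "\<exists>f\<in>UNIV. emb_set UNIV E Z x f"
    unfolding emb_set_def u.uemb_iff u.is_opair_iff
    by (rule bexI[of _ "u.lam x u.emb"]) (auto simp: u.mem_lam[OF d])
qed

section \<open>Images of ultrapowers of the universe under another embedding\<close>

context zfc
begin

lemma inner_chooses_elem:
  assumes "elem (\<epsilon>) UNIV M j" obtains c where "chooses M (\<epsilon>) (j c) (j X)"
proof -
  obtain c where "chooses UNIV (\<epsilon>) c X" using zfc_chooses[OF zfc] by blast
  then have "chooses M (\<epsilon>) (j c) (j X)"
    using elem_fo2[where Q = chooses, OF assms fo_chooses] by simp
  then show thesis by (rule that)
qed

lemma ultrapower_V: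
  assumes U: "ccuf UNIV U"
  obtains X s where "is_ultrapower (\<epsilon>) UNIV U (Ult UNIV U) (Emb UNIV U) X s"
  by (rule inner_ultrapower[OF inner_UNIV U])

text \<open>\<open>agree\<close> is applied to a single point, the seed of \<open>U\<close>, which
  lies in the image of the underlying set; every other element is the value at the seed of a
  function in the range of the embedding.\<close>

lemma agree_all:
  assumes U: "ccuf UNIV U" and Z: "ccuf (Ult UNIV U) Z" and Z': "ccuf (Ult UNIV U) Z'"
    and eq: "Ult (Ult UNIV U) Z = Ult (Ult UNIV U) Z'"
    and ag: "\<And>x. Emb (Ult UNIV U) Z (Emb UNIV U x) = Emb (Ult UNIV U) Z' (Emb UNIV U x)"
    and y: "y \<in> Ult UNIV U"
  shows "Emb (Ult UNIV U) Z y = Emb (Ult UNIV U) Z' y"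
proof -
  let ?M = "Ult UNIV U" and ?j = "Emb UNIV U"
  obtain X s where "is_ultrapower (\<epsilon>) UNIV U ?M ?j X s" by (rule ultrapower_V[OF U])
  note I = is_ultrapowerD[OF this]
  note M = inner_Ult[OF inner_UNIV U]
  note s = generatedD(1,2)[OF inner_UNIV M I(3,5,7)]
  obtain c where c: "chooses ?M (\<epsilon>) (?j c) (?j X)" by (rule inner_chooses_elem[OF I(3)])
  have jM: "?j x \<in> ?M" for x using elem_in[OF I(3)] by simp
  have es: "Emb ?M Z s = Emb ?M Z' s"
    by (rule agree[OF M Z Z' eq jM jM c ag ag s(2)])
  obtain g where g: "fn X g" "y = app (?j g) s" using generatedD(3)[OF inner_UNIV M I(3,5,7) y] by blast
  note jg = elem_fn[OF inner_UNIV M I(3,5) UNIV_I g(1)]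
  have *: "Emb ?M Z y = app (Emb ?M Z (?j g)) (Emb ?M Z s)" if Z: "ccuf ?M Z" for Z
  proof -
    obtain X' s' where "is_ultrapower (\<epsilon>) ?M Z (Ult ?M Z) (Emb ?M Z) X' s'" by (rule inner_ultrapower[OF M Z])
    note K = is_ultrapowerD[OF this]
    show ?thesis unfolding g(2) by (rule elem_app[OF M inner_Ult[OF M Z] K(3) jM jM jg s(2)])
  qed
  show ?thesis using *[OF Z] *[OF Z'] es ag by simp
qed

lemma image_ccuf:
  assumes U: "ccuf UNIV U" and W: "ccuf UNIV W" shows "ccuf (Ult UNIV U) (Emb UNIV U W)"
proof -
  obtain X s where "is_ultrapower (\<epsilon>) UNIV U (Ult UNIV U) (Emb UNIV U) X s" by (rule ultrapower_V[OF U])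
  note I = is_ultrapowerD[OF this]
  have "ccu (Ult UNIV U) (\<epsilon>) (Emb UNIV U W) \<longleftrightarrow> ccu UNIV (\<epsilon>) W"
    by (rule elem_fo1[where Q = ccu, OF I(3) fo_ccu]) simp
  then show ?thesis using ccu_iff[of W UNIV "(\<epsilon>)"] W ccu_iff[of "Emb UNIV U W" "Ult UNIV U"] elem_in[OF I(3)] by simp
qed

text \<open>That \<open>\<phi>\<close> defines the embedding of \<open>W\<close> is itself a formula
  in \<open>W\<close> and the parameters, thanks to \<open>uemb\<close>; its image says that
  \<open>\<phi>\<close> defines the ultrapower embedding by the image of \<open>W\<close>. Since
  some defining formula exists, the description in \<open>image_fun\<close> has a unique
  solution.\<close>

lemma image_fun_Emb:
  assumes U: "ccuf UNIV U" and W: "ccuf UNIV W"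
  shows "image_fun (\<epsilon>) UNIV (Ult UNIV U) (Emb UNIV U) (Emb UNIV W) = Emb (Ult UNIV U) (Emb UNIV U W)"
proof -
  let ?M = "Ult UNIV U" and ?j = "Emb UNIV U" and ?i = "Emb (Ult UNIV U) (Emb UNIV U W)"
  obtain X s where "is_ultrapower (\<epsilon>) UNIV U ?M ?j X s" by (rule ultrapower_V[OF U])
  note I = is_ultrapowerD[OF this]
  note M = inner_Ult[OF inner_UNIV U]
  note jW = image_ccuf[OF U W]
  obtain X' s' where "is_ultrapower (\<epsilon>) ?M (?j W) (Ult ?M (?j W)) ?i X' s'" by (rule inner_ultrapower[OF M jW])
  note K = is_ultrapowerD[OF this]
  have iM: "?i x \<in> ?M" if "x \<in> ?M" for x using elem_in[OF K(3) that] K(1) by blast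
  have ok: "defines_fun ?M (\<epsilon>) \<phi> (?j \<circ> e) ?M ?i" if d: "defines_fun UNIV (\<epsilon>) \<phi> e UNIV (Emb UNIV W)" for \<phi> e
  proof -
    \<comment> \<open>Slot 0 holds \<open>W\<close>, and the parameters of \<open>\<phi>\<close> are
      shifted up by one.\<close>
    let ?Q = "\<lambda>(M :: 'v set) E e. \<forall>x\<in>M. \<forall>y\<in>M. sat M E \<phi> ((\<lambda>n. e (Suc n))(0 := x, 1 := y)) \<longleftrightarrow> uemb M E (e 0) x y"
    have 1: "fo (\<lambda>M E e :: nat \<Rightarrow> 'v. sat M E \<phi> ((\<lambda>n. e (f n))(0 := e k, 1 := e l)))" for f k l
    proof -
      have "(\<lambda>n. e (f n))(0 := e k, 1 := e l) = (\<lambda>n. e (if n = 1 then l else if n = 0 then k else f n))" for e :: "nat \<Rightarrow> 'v"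
        by auto
      then show ?thesis by (simp only: fo_sat)
    qed
    have Q: "fo ?Q" by (intro fo_intros fo_uemb 1)
    have "?Q UNIV (\<epsilon>) (case_nat W e)"
      using d uemb_in[OF inner_UNIV W] unfolding defines_fun_def by simp
    then have "?Q ?M (\<epsilon>) (\<lambda>n. ?j (case_nat W e n))"
      using elem_fo[OF I(3) Q, of "case_nat W e"] by blast
    then have "\<forall>x\<in>?M. \<forall>y\<in>?M. sat ?M (\<epsilon>) \<phi> ((?j \<circ> e)(0 := x, 1 := y)) \<longleftrightarrow> ?i x = y"
      using uemb_in[OF M jW] by (simp add: comp_def)
    then show ?thesis unfolding defines_fun_def using elem_in[OF I(3)] by auto
  qed
  obtain \<phi> e where de: "\<forall>x y. sat UNIV (\<epsilon>) \<phi> (e(0 := x, 1 := y)) \<longleftrightarrow> x \<in> UNIV \<and> Emb UNIV W x = y"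
    by (rule drel_definesE[OF demb_Emb[OF inner_UNIV W, unfolded demb_def]])
  then have d: "defines_fun UNIV (\<epsilon>) \<phi> e UNIV (Emb UNIV W)" unfolding defines_fun_def by simp
  show ?thesis
    unfolding image_fun_def
  proof (rule the_equality)
    show "?i \<in> ?M \<rightarrow>\<^sub>E ?M \<and> (\<forall>\<phi> e. defines_fun UNIV (\<epsilon>) \<phi> e UNIV (Emb UNIV W) \<longrightarrow> defines_fun ?M (\<epsilon>) \<phi> (?j \<circ> e) ?M ?i)"
      using ok iM K(4) by (auto simp: PiE_def)
    fix k assume k: "k \<in> ?M \<rightarrow>\<^sub>E ?M \<and> (\<forall>\<phi> e. defines_fun UNIV (\<epsilon>) \<phi> e UNIV (Emb UNIV W) \<longrightarrow> defines_fun ?M (\<epsilon>) \<phi> (?j \<circ> e) ?M k)"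
    then have "defines_fun ?M (\<epsilon>) \<phi> (?j \<circ> e) ?M k" using d by blast
    with ok[OF d] have "k x = y \<longleftrightarrow> ?i x = y" if "x \<in> ?M" "y \<in> ?M" for x y
      using that unfolding defines_fun_def by metis
    then have "k x = ?i x" if "x \<in> ?M" for x using that iM by blast
    then show "k = ?i" using k K(4) by (intro extensionalityI[of _ ?M]) (auto simp: PiE_def)
  qed
qed

lemma commute:
  assumes U: "ccuf UNIV U" and W: "ccuf UNIV W"
  shows "Emb (Ult UNIV U) (Emb UNIV U W) (Emb UNIV U x) = Emb UNIV U (Emb UNIV W x)"
proof -
  obtain X s where "is_ultrapower (\<epsilon>) UNIV U (Ult UNIV U) (Emb UNIV U) X s" by (rule ultrapower_V[OF U])
  note I = is_ultrapowerD[OF this]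
  note M = inner_Ult[OF inner_UNIV U]
  have "uemb UNIV (\<epsilon>) W x (Emb UNIV W x)" using uemb_in[OF inner_UNIV W] by simp
  then have "uemb (Ult UNIV U) (\<epsilon>) (Emb UNIV U W) (Emb UNIV U x) (Emb UNIV U (Emb UNIV W x))"
    using elem_fo3[where Q = uemb, OF I(3) fo_uemb UNIV_I UNIV_I UNIV_I] by simp
  then show ?thesis using uemb_in[OF M image_ccuf[OF U W]] elem_in[OF I(3)] by simp
qed

text \<open>Truth in \<open>Ult UNIV W\<close> is a formula over the universe with parameter
  \<open>W\<close>; its image is truth in the ultrapower of \<open>Ult UNIV U\<close> by the image
  of \<open>W\<close>.\<close>

lemma elem_shift:
  assumes U: "ccuf UNIV U" and W: "ccuf UNIV W"
  shows "elem (\<epsilon>) (Ult UNIV W) (Ult (Ult UNIV U) (Emb UNIV U W)) (Emb UNIV U)"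
proof -
  let ?M = "Ult UNIV U" and ?j = "Emb UNIV U"
  obtain X s where "is_ultrapower (\<epsilon>) UNIV U ?M ?j X s" by (rule ultrapower_V[OF U])
  note I = is_ultrapowerD[OF this]
  note M = inner_Ult[OF inner_UNIV U]
  note jW = image_ccuf[OF U W]
  obtain X' s' where "is_ultrapower (\<epsilon>) ?M (?j W) (Ult ?M (?j W)) (Emb ?M (?j W)) X' s'" by (rule inner_ultrapower[OF M jW])
  note K = is_ultrapowerD[OF this]
  have W1: "{y \<in> UNIV. umem UNIV (\<epsilon>) W y} = Ult UNIV W" using umem_in[OF inner_UNIV W] by auto
  have W2: "{y \<in> ?M. umem ?M (\<epsilon>) (?j W) y} = Ult ?M (?j W)" using umem_in[OF M jW] K(1) by auto
  show ?thesis unfolding elem_def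
  proof (intro conjI ballI allI impI)
    fix x assume "x \<in> Ult UNIV W"
    then have "umem UNIV (\<epsilon>) W x" using W1 by blast
    then have "umem ?M (\<epsilon>) (?j W) (?j x)"
      using elem_fo2[where Q = umem, OF I(3) fo_umem UNIV_I UNIV_I] by simp
    then show "?j x \<in> Ult ?M (?j W)" using W2 elem_in[OF I(3)] by blast
  next
    fix \<phi> :: fm and e :: "nat \<Rightarrow> 'v"
    have "(\<lambda>n. case_nat W e (Suc n)) = e" "(\<lambda>n. ?j (case_nat W e (Suc n))) = (\<lambda>n. ?j (e n))" by simp_all
    then show "sat (Ult ?M (?j W)) (\<epsilon>) \<phi> (\<lambda>n. ?j (e n)) \<longleftrightarrow> sat (Ult UNIV W) (\<epsilon>) \<phi> e"
      using elem_fo[OF I(3) fo_relativized[of 0 \<phi> Suc], of "case_nat W e"] W1 W2 by simp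
  qed
qed

text \<open>Generation of \<open>Ult UNIV W\<close> by its seed is a formula in \<open>W\<close>,
  \<open>X\<close> and \<open>s\<close>, and this is its image under the embedding of
  \<open>U\<close>. It concerns generation over \<open>Ult UNIV U\<close>; generation over
  \<open>Ult UNIV W\<close>, by the image of the other seed, is established in
  \<open>internal_ultrapower\<close>.\<close>

lemma generated_shift:
  assumes U: "ccuf UNIV U" and W: "ccuf UNIV W"
    and IW: "is_ultrapower (\<epsilon>) UNIV W (Ult UNIV W) (Emb UNIV W) X s"
  shows "generated (\<epsilon>) (Ult UNIV U) (Ult (Ult UNIV U) (Emb UNIV U W)) (Emb (Ult UNIV U) (Emb UNIV U W))
    (Emb UNIV U X) (Emb UNIV U s)"
proof -
  let ?M = "Ult UNIV U" and ?j = "Emb UNIV U" and ?N = "Ult (Ult UNIV U) (Emb UNIV U W)"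
    and ?i = "Emb (Ult UNIV U) (Emb UNIV U W)"
  obtain X0 s0 where "is_ultrapower (\<epsilon>) UNIV U ?M ?j X0 s0" by (rule ultrapower_V[OF U])
  note I = is_ultrapowerD[OF this]
  note M = inner_Ult[OF inner_UNIV U]
  note jW = image_ccuf[OF U W]
  note N = inner_Ult[OF M jW]
  obtain X' s' where "is_ultrapower (\<epsilon>) ?M (?j W) ?N ?i X' s'" by (rule inner_ultrapower[OF M jW])
  note K = is_ultrapowerD[OF this]
  note J = is_ultrapowerD[OF IW]
  note W' = inner_Ult[OF inner_UNIV W]
  note s = generatedD[OF inner_UNIV W' J(3,5,7)]
  have jM: "?j x \<in> ?M" for x using elem_in[OF I(3)] by simp
  have jN: "?j x \<in> ?N" if "x \<in> Ult UNIV W" for x by (rule elem_in[OF elem_shift[OF U W] that])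
  let ?Q = "\<lambda>(M :: 'v set) E Z X s. \<forall>y\<in>M. umem M E Z y \<longrightarrow> (\<exists>g\<in>M. is_fun_on M E X g \<and> (\<exists>G\<in>M. uemb M E Z g G \<and> maps_to M E G s y))"
  have Q: "fo (\<lambda>M E e. ?Q M E (e 0) (e 1) (e 2))" by (intro fo_intros fo_umem fo_uemb fo_basic)
  have "?Q UNIV (\<epsilon>) W X s"
  proof (intro ballI impI)
    fix y assume "umem UNIV (\<epsilon>) W y"
    then have y: "y \<in> Ult UNIV W" using umem_in[OF inner_UNIV W] by simp
    obtain g where g: "fn X g" "y = app (Emb UNIV W g) s" using s(3)[OF y] by blast
    have "opr s y \<epsilon> Emb UNIV W g"
      using opr_mem_fn[OF elem_fn[OF inner_UNIV W' J(3,5) UNIV_I g(1)] s(2)] g(2) by simp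
    then show "\<exists>g\<in>UNIV. fn X g \<and> (\<exists>G\<in>UNIV. uemb UNIV (\<epsilon>) W g G \<and> maps_to UNIV (\<epsilon>) G s y)"
      using g(1) uemb_in[OF inner_UNIV W] maps_to_iff by auto
  qed
  then have Q': "?Q ?M (\<epsilon>) (?j W) (?j X) (?j s)"
    using elem_fo3[where Q = ?Q, OF I(3) Q UNIV_I UNIV_I UNIV_I] by blast
  show ?thesis
  proof (rule generatedI[OF M N K(3) jM])
    show "?j s \<in> ?N" by (rule jN[OF s(1)])
    show "?j s \<epsilon> ?i (?j X)" unfolding commute[OF U W] using elem_mem[OF I(3) UNIV_I UNIV_I] s(2) by simp
    fix y assume y: "y \<in> ?N"
    then have yM: "y \<in> ?M" using K(1) by blast
    then obtain g G where g: "g \<in> ?M" "is_fun_on ?M (\<epsilon>) (?j X) g" "G \<in> ?M" "uemb ?M (\<epsilon>) (?j W) g G"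
      "maps_to ?M (\<epsilon>) G (?j s) y"
      using Q' umem_in[OF M jW yM] y by blast
    have "G = ?i g" using uemb_in[OF M jW g(1,3)] g(4) by simp
    then have "opr (?j s) y \<epsilon> ?i g" using g(5) in_maps[OF M jM yM] by simp
    moreover have "fn (?j X) g" using g(2) in_fun[OF M jM g(1)] by simp
    ultimately show "\<exists>g\<in>?M. fn (?j X) g \<and> opr (?j s) y \<epsilon> ?i g" using g(1) by blast
  qed
qed

lemma omega_unique:
  assumes "inner M" "w \<in> M" "w' \<in> M" "is_omega M (\<epsilon>) w" "is_omega M (\<epsilon>) w'" shows "w = w'"
proof -
  have "is_subset M (\<epsilon>) w w'" "is_subset M (\<epsilon>) w' w"
    using assms(2-5) unfolding is_omega_def by blast+
  then show ?thesis unfolding is_subset_def by (intro inner_ext[OF assms(1-3)]) blast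
qed

lemma internal_ultrapower:
  assumes U: "ccuf UNIV U" and W: "ccuf UNIV W" and int: "internal_rel (\<epsilon>) U W"
  obtains Z where "ccuf (Ult UNIV W) Z" "Ult (Ult UNIV W) Z = Ult (Ult UNIV U) (Emb UNIV U W)"
    "Emb (Ult UNIV W) Z = restrict (Emb UNIV U) (Ult UNIV W)"
proof -
  let ?M = "Ult UNIV U" and ?j = "Emb UNIV U" and ?N = "Ult (Ult UNIV U) (Emb UNIV U W)"
    and ?i = "Emb (Ult UNIV U) (Emb UNIV U W)" and ?MW = "Ult UNIV W" and ?w = "Emb UNIV W"
  obtain XU sU where "is_ultrapower (\<epsilon>) UNIV U ?M ?j XU sU" by (rule ultrapower_V[OF U])
  note I = is_ultrapowerD[OF this]
  obtain XW sW where IW: "is_ultrapower (\<epsilon>) UNIV W ?MW ?w XW sW" by (rule ultrapower_V[OF W])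
  note J = is_ultrapowerD[OF IW]
  note M = inner_Ult[OF inner_UNIV U] and MW = inner_Ult[OF inner_UNIV W]
  note jW = image_ccuf[OF U W]
  note N = inner_Ult[OF M jW]
  obtain X' s' where "is_ultrapower (\<epsilon>) ?M (?j W) ?N ?i X' s'" by (rule inner_ultrapower[OF M jW])
  note K = is_ultrapowerD[OF this]
  note sU = generatedD[OF inner_UNIV M I(3,5,7)] and sW = generatedD[OF inner_UNIV MW J(3,5,7)]
  note gs = generated_shift[OF U W IW]
  have jM: "?j x \<in> ?M" for x using elem_in[OF I(3)] by simp
  have wM: "?w x \<in> ?MW" for x using elem_in[OF J(3)] by simp
  note gN = generatedD[OF M N K(3) jM gs]
  define k where "k = restrict ?j ?MW"
  have k: "k x = ?j x" if "x \<in> ?MW" for x using that by (simp add: k_def)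
  have ek: "elem (\<epsilon>) ?MW ?N k" by (rule elem_cong[OF elem_shift[OF U W] k])
  have dk: "demb ?MW k"
  proof -
    have "(x \<in> ?MW \<and> k x = y) \<longleftrightarrow> x \<in> ?MW \<and> (x \<in> UNIV \<and> ?j x = y)" for x y using k by auto
    then show ?thesis unfolding demb_def drel_def
      by (simp only:) (intro d_rules dpred_cls[OF inner_dcls[OF MW]] demb_app[OF demb_Emb[OF inner_UNIV U]])
  qed
  define X where "X = ?w XU"
  define s where "s = ?i sU"
  have X: "X \<in> ?MW" unfolding X_def by (rule wM)
  have kX: "k X = ?i (?j XU)" unfolding X_def k[OF wM] commute[OF U W] ..
  have s: "s \<in> ?N" "s \<epsilon> k X"
    unfolding s_def kX using elem_in[OF K(3) sU(1)] elem_mem[OF K(3) sU(1) jM] sU(2) by simp_all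
  have gen: "generated (\<epsilon>) ?MW ?N k X s"
  proof (rule generatedI[OF MW N ek X s])
    fix y assume y: "y \<in> ?N"
    \<comment> \<open>Unravelling both seeds, \<open>y\<close> is \<open>?i (?j H)\<close> evaluated
      at \<open>s\<close> and then at \<open>?j sW\<close>, and \<open>?i (?j H) = k (?w H)\<close>.
      So \<open>y\<close> is the value at \<open>s\<close> of the image under \<open>k\<close> of
      the function sending \<open>p\<close> to \<open>?w H\<close> evaluated at \<open>p\<close> and
      then at \<open>sW\<close>, and this function lies in \<open>?MW\<close>.\<close>
    obtain G where G: "G \<in> ?M" "fn (?j XW) G" "y = app (?i G) (?j sW)" using gN(3)[OF y] by blast
    obtain H where H: "fn XU H" "G = app (?j H) sU" using sU(3)[OF G(1)] by blast
    note jH = elem_fn[OF inner_UNIV M I(3,5) UNIV_I H(1)]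
    have r: "range (case_nat (?w H) (case_nat X (\<lambda>_. sW))) \<subseteq> ?MW"
      using wM X sW(1) by (auto split: nat.split)
    have Q: "fo (\<lambda>M E e. \<exists>g\<in>M. is_fun_on M E (e 1) g \<and> eval_prop M E (e 0) (e 1) (e 2) g)"
      by (intro fo_intros fo_eval_prop fo_basic)
    have "\<exists>g\<in>?MW. is_fun_on ?MW (\<epsilon>) X g \<and> eval_prop ?MW (\<epsilon>) (?w H) X sW g"
      using inner_thm[OF MW Q zfc_eval r] by (simp add: numeral_2_eq_2)
    then obtain g where g: "g \<in> ?MW" "is_fun_on ?MW (\<epsilon>) X g" "eval_prop ?MW (\<epsilon>) (?w H) X sW g" by blast
    have kg: "eval_prop ?N (\<epsilon>) (k (?w H)) (k X) (k sW) (k g)"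
      using elem_fo4[where Q = eval_prop, OF ek fo_eval_prop wM X sW(1) g(1)] g(3) by simp
    have kH: "k (?w H) = ?i (?j H)" unfolding k[OF wM] commute[OF U W] ..
    have ks: "k sW = ?j sW" by (rule k[OF sW(1)])
    have iG: "?i G \<in> ?N" by (rule elem_in[OF K(3) G(1)])
    note fH = elem_fn[OF M N K(3) jM jM jH] and fG = elem_fn[OF M N K(3) jM G(1,2)]
    have sk: "s \<epsilon> ?i (?j XU)" using s(2) kX by simp
    have "app (?i (?j H)) s = ?i G"
      unfolding s_def using elem_app[OF M N K(3) jM jM jH sU(2)] H(2) by simp
    then have 1: "maps_to ?N (\<epsilon>) (k (?w H)) s v \<longleftrightarrow> v = ?i G" if "v \<in> ?N" for v
      unfolding kH using in_maps[OF N s(1) that] opr_mem_fn[OF fH sk] by simp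
    have 2: "maps_to ?N (\<epsilon>) (?i G) (k sW) v \<longleftrightarrow> v = y" if "v \<in> ?N" for v
      unfolding ks using in_maps[OF N gN(1) that] opr_mem_fn[OF fG gN(2)] G(3) by simp
    have "maps_to ?N (\<epsilon>) (k g) s y"
      by (rule kg[unfolded eval_prop_def, rule_format, OF s(1) iG y s(2)]) (simp_all add: 1 2 iG y)
    then have "opr s y \<epsilon> k g" using in_maps[OF N s(1) y] by simp
    moreover have "fn X g" using in_fun[OF MW X g(1)] g(2) by simp
    ultimately show "\<exists>g\<in>?MW. fn X g \<and> opr s y \<epsilon> k g" using g(1) by blast
  qed
  have om: "omega_fixed (\<epsilon>) ?MW ?N k"
    unfolding omega_fixed_def
  proof (intro ballI impI)
    fix w n assume w: "w \<in> ?MW" "is_omega ?MW (\<epsilon>) w" and n: "n \<in> ?N" "n \<epsilon> k w"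
    have o: "is_omega UNIV (\<epsilon>) om" by (simp add: is_omega_iff)
    have "is_omega ?MW (\<epsilon>) (?w om)" using elem_fo1[where Q = is_omega, OF J(3) fo_is_omega UNIV_I] o by simp
    then have ww: "w = ?w om" by (rule omega_unique[OF MW w(1) wM w(2)])
    have jo: "is_omega ?M (\<epsilon>) (?j om)" using elem_fo1[where Q = is_omega, OF I(3) fo_is_omega UNIV_I] o by simp
    \<comment> \<open>By commutation the image of omega is reached through \<open>?j\<close> and
      \<open>?i\<close>, neither of which adds a member to omega.\<close>
    have "n \<epsilon> ?i (?j om)" using n(2) unfolding ww k[OF wM] commute[OF U W] .
    then obtain m where m: "m \<in> ?M" "m \<epsilon> ?j om" "n = ?i m"
      using K(9)[unfolded omega_fixed_def, rule_format, OF jM jo n(1)] by blast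
    obtain i where i: "i \<epsilon> om" "m = ?j i"
      using I(9)[unfolded omega_fixed_def, rule_format, OF UNIV_I o m(1,2)] by blast
    show "\<exists>m\<in>?MW. m \<epsilon> w \<and> n = k m"
      by (rule bexI[OF _ wM[of i]])
         (simp add: ww m(3) i(2) commute[OF U W] k[OF wM] elem_mem[OF J(3) UNIV_I UNIV_I] i(1))
  qed
  obtain PX where PX: "PX \<in> ?MW" "\<forall>A\<in>?MW. A \<epsilon> PX \<longleftrightarrow> sub A X" by (rule inner_Pow[OF MW X])
  \<comment> \<open>Internality enters here, for one set: the restriction to the power set of
    \<open>X\<close> in \<open>?MW\<close> belongs to \<open>?MW\<close>, and with its help the
    ultrafilter derived from \<open>s\<close> can be separated there.\<close>
  obtain f where f: "f \<in> ?MW" "is_restriction UNIV (\<epsilon>) ?j PX f" using int PX(1) unfolding internal_rel_def by blast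
  have fm: "opr A v \<epsilon> f \<longleftrightarrow> A \<epsilon> PX \<and> v = ?j A" for A v
    using f(2) unfolding is_restriction_def is_opair_iff by auto
  have "X \<epsilon> PX" using PX(2) X unfolding sub_def by blast
  then have "opr X (?j X) \<in> ?MW" using fm inner_trans[OF MW f(1)] by blast
  \<comment> \<open>The value at \<open>X\<close> itself belongs to the model, and with it its
    member \<open>s\<close>, the parameter of the separation below.\<close>
  then have jX: "?j X \<in> ?MW" by (rule opr_comp(2)[OF MW])
  have sM: "s \<in> ?MW" using inner_trans[OF MW jX] s(2) k[OF X] by simp
  have Q: "fo (\<lambda>M E e. \<exists>C\<in>M. maps_to M E (e 1) (e 0) C \<and> E (e 2) C)" by (intro fo_intros fo_basic)
  obtain Z where Z: "Z \<in> ?MW" "\<forall>A\<in>?MW. A \<epsilon> Z \<longleftrightarrow> A \<epsilon> PX \<and> (\<exists>C\<in>?MW. maps_to ?MW (\<epsilon>) f A C \<and> s \<epsilon> C)"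
    by (rule inner_sep3[where Q = "\<lambda>M E A f s. \<exists>C\<in>M. maps_to M E f A C \<and> E s C", OF MW Q f(1) sM PX(1)])
  have ZA: "A \<epsilon> Z \<longleftrightarrow> sub A X \<and> s \<epsilon> k A" if A: "A \<in> ?MW" for A
  proof (cases "A \<epsilon> PX")
    case True
    then have o: "opr A (?j A) \<epsilon> f" using fm by simp
    then have jA: "?j A \<in> ?MW" using inner_trans[OF MW f(1)] opr_comp(2)[OF MW] by blast
    have "(\<exists>C\<in>?MW. maps_to ?MW (\<epsilon>) f A C \<and> s \<epsilon> C) \<longleftrightarrow> s \<epsilon> ?j A"
      using in_maps[OF MW A] fm True jA by auto
    then show ?thesis using Z(2) A True PX(2) k[OF A] by simp
  next
    case False
    then show ?thesis using Z(2) A PX(2) by simp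
  qed
  have ext: "k \<in> extensional ?MW" by (simp add: k_def)
  note R = recognize[OF MW N ek dk ext X gen om Z(1) ZA]
  show thesis by (rule that[OF R(1,2) R(3)[unfolded k_def]])
qed

lemma internal_if_image:
  assumes U: "ccuf UNIV U" and W: "ccuf UNIV W"
    and eq: "Emb (Ult UNIV W) (Emb UNIV W U) = restrict (Emb UNIV U) (Ult UNIV W)"
  shows "internal_rel (\<epsilon>) U W"
  unfolding internal_rel_def
proof
  let ?M = "Ult UNIV W" and ?Z = "Emb UNIV W U" and ?j = "Emb UNIV U"
  fix x assume x: "x \<in> ?M"
  note M = inner_Ult[OF inner_UNIV W] and Z = image_ccuf[OF W U]
  obtain X s where "is_ultrapower (\<epsilon>) ?M ?Z (Ult ?M ?Z) (Emb ?M ?Z) X s" by (rule inner_ultrapower[OF M Z])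
  note K = is_ultrapowerD[OF this]
  have j: "Emb ?M ?Z y = ?j y" "?j y \<in> ?M" if y: "y \<in> ?M" for y
    using eq y elem_in[OF K(3) y] K(1) by auto
  have r: "range (case_nat ?Z (\<lambda>_. x)) \<subseteq> ?M" using ccuf_in[OF Z] x by (auto split: nat.split)
  have Q: "fo (\<lambda>M E e. ccu M E (e 0) \<longrightarrow> (\<exists>f\<in>M. emb_set M E (e 0) (e 1) f))"
    by (intro fo_intros fo_ccu fo_emb_set)
  have "ccu ?M (\<epsilon>) ?Z \<longrightarrow> (\<exists>f\<in>?M. emb_set ?M (\<epsilon>) ?Z x f)" using inner_thm[OF M Q zfc_emb_set r] by simp
  then obtain f where f: "f \<in> ?M" "emb_set ?M (\<epsilon>) ?Z x f" using Z ccu_iff[OF ccuf_in[OF Z]] by blast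
  have "p \<epsilon> f \<longleftrightarrow> (\<exists>y. y \<epsilon> x \<and> p = opr y (?j y))" for p
  proof (cases "p \<in> ?M")
    case True
    have "(\<exists>v\<in>?M. uemb ?M (\<epsilon>) ?Z y v \<and> is_opair ?M (\<epsilon>) y v p) \<longleftrightarrow> p = opr y (?j y)" if y: "y \<in> ?M" for y
      using uemb_in[OF M Z y] j[OF y] in_opair[OF M y _ True] by auto
    then show ?thesis using f(2) True inner_trans[OF M x] unfolding emb_set_def by blast
  next
    case False
    then show ?thesis using inner_trans[OF M f(1)] inner_trans[OF M x] j(2) opr_in[OF M] by blast
  qed
  then show "\<exists>f\<in>?M. is_restriction UNIV (\<epsilon>) ?j x f"
    using f(1) unfolding is_restriction_def is_opair_iff by auto
qed

lemma image_eq_restriction: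
  assumes UA: "UA (\<epsilon>)" and U: "ccuf UNIV U" and W: "ccuf UNIV W"
    and UW: "internal_rel (\<epsilon>) U W" and WU: "internal_rel (\<epsilon>) W U"
  shows "Emb (Ult UNIV U) (Emb UNIV U W) = restrict (Emb UNIV W) (Ult UNIV U)"
proof -
  let ?u = "Emb UNIV U" and ?w = "Emb UNIV W"
  define MU MW where "MU = Ult UNIV U" and "MW = Ult UNIV W"
  define N N' where "N = Ult MU (?u W)" and "N' = Ult MW (?w U)"
  define i i' where "i = Emb MU (?u W)" and "i' = Emb MW (?w U)"
  note MU = inner_Ult[OF inner_UNIV U, folded MU_def] and MW = inner_Ult[OF inner_UNIV W, folded MW_def]
  note uW = image_ccuf[OF U W, folded MU_def] and wU = image_ccuf[OF W U, folded MW_def]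
  note N = inner_Ult[OF MU uW, folded N_def] and N' = inner_Ult[OF MW wU, folded N'_def]
  note com = commute[OF U W, folded MU_def, folded i_def] and com' = commute[OF W U, folded MW_def, folded i'_def]
  obtain XU sU where IU: "is_ultrapower (\<epsilon>) UNIV U (Ult UNIV U) ?u XU sU" by (rule ultrapower_V[OF U])
  note I = is_ultrapowerD[OF IU, folded MU_def]
  obtain XW sW where IW: "is_ultrapower (\<epsilon>) UNIV W (Ult UNIV W) ?w XW sW" by (rule ultrapower_V[OF W])
  note J = is_ultrapowerD[OF IW, folded MW_def]
  obtain Xi si where Ii: "is_ultrapower (\<epsilon>) MU (?u W) N i Xi si"
    unfolding N_def i_def by (rule inner_ultrapower[OF MU uW])
  note Ki = is_ultrapowerD[OF Ii]
  obtain Xi' si' where Ii': "is_ultrapower (\<epsilon>) MW (?w U) N' i' Xi' si'"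
    unfolding N'_def i'_def by (rule inner_ultrapower[OF MW wU])
  note Ki' = is_ultrapowerD[OF Ii']
  note g = generated_shift[OF U W IW, folded MU_def, folded N_def i_def]
    and g' = generated_shift[OF W U IU, folded MW_def, folded N'_def i'_def]
  obtain Z1 where Z1: "ccuf MW Z1" "Ult MW Z1 = N" "Emb MW Z1 = restrict ?u MW"
    using internal_ultrapower[OF U W UW] unfolding MU_def MW_def N_def by blast
  obtain Z2 where Z2: "ccuf MU Z2" "Ult MU Z2 = N'" "Emb MU Z2 = restrict ?w MU"
    using internal_ultrapower[OF W U WU] unfolding MU_def MW_def N'_def by blast
  have eU: "elem (\<epsilon>) MW N ?u" and eW: "elem (\<epsilon>) MU N' ?w"
    using elem_shift[OF U W] elem_shift[OF W U] unfolding MU_def MW_def N_def N'_def by simp_all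
  have uM: "?u x \<in> MU" and wM: "?w x \<in> MW" for x using elem_in[OF I(3)] elem_in[OF J(3)] by simp_all
  \<comment> \<open>The axiom compares ultrapowers of the universe, so both iterations are first
    rewritten as single ultrapowers.\<close>
  obtain D where D: "ccuf UNIV D" "Ult UNIV D = N" "\<forall>x. Emb UNIV D x = i (?u x)"
    using compose[OF inner_UNIV U, folded MU_def, OF uW] unfolding N_def i_def by (metis UNIV_I)
  obtain D' where D': "ccuf UNIV D'" "Ult UNIV D' = N'" "\<forall>x. Emb UNIV D' x = i' (?w x)"
    using compose[OF inner_UNIV W, folded MW_def, OF wU] unfolding N'_def i'_def by (metis UNIV_I)
  obtain k k' P where "comparison (\<epsilon>) (Emb UNIV D) N (Emb UNIV D') N' k k' P"
    using UA D(1,2) D'(1,2) unfolding UA_def by metis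
  then have kP: "internal_ult_emb N (\<epsilon>) k P" "internal_ult_emb N' (\<epsilon>) k' P" and kk: "k \<circ> Emb UNIV D = k' \<circ> Emb UNIV D'"
    unfolding comparison_def by simp_all
  obtain Q where Q: "ccuf N Q" "k = Emb N Q" "P = Ult N Q" using kP(1) unfolding internal_ult_emb_def by blast
  obtain Q' where Q': "ccuf N' Q'" "k' = Emb N' Q'" "P = Ult N' Q'" using kP(2) unfolding internal_ult_emb_def by blast
  have P: "inner P" unfolding Q(3) by (rule inner_Ult[OF N Q(1)])
  obtain X1 s1 where "is_ultrapower (\<epsilon>) N Q P k X1 s1" unfolding Q(2,3) by (rule inner_ultrapower[OF N Q(1)])
  note ek = is_ultrapowerD(3)[OF this]
  obtain X2 s2 where "is_ultrapower (\<epsilon>) N' Q' P k' X2 s2" unfolding Q'(2,3) by (rule inner_ultrapower[OF N' Q'(1)])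
  note ek' = is_ultrapowerD(3)[OF this]
  \<comment> \<open>The comparison yields agreement on images of elements of the universe;
    \<open>agU\<close> and \<open>agW\<close> extend it to all of \<open>MU\<close> and all of
    \<open>MW\<close>.\<close>
  have base: "k (i (?u x)) = k' (i' (?w x))" for x
    using fun_cong[OF kk, of x] D(3) D'(3) by simp
  have agU: "k (i x) = k' (?w x)" if x: "x \<in> MU" for x
  proof -
    \<comment> \<open>\<open>A\<close> represents \<open>k\<close> after \<open>i\<close>, and
      \<open>B\<close> below represents \<open>k'\<close> after the restricted embedding of
      \<open>W\<close>; both are ultrafilters of \<open>MU\<close> with the same target, as
      \<open>agree_all\<close> demands.\<close>
    obtain A where A: "ccuf MU A" "Ult MU A = P" "\<forall>x\<in>MU. Emb MU A x = k (i x)"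
      using compose[OF MU uW, folded N_def, OF Q(1)] unfolding Q i_def by metis
    have QZ: "ccuf (Ult MU Z2) Q'" unfolding Z2(2) by (rule Q'(1))
    obtain B where B: "ccuf MU B" "Ult MU B = P" "\<forall>x\<in>MU. Emb MU B x = k' (?w x)"
      using compose[OF MU Z2(1) QZ, unfolded Z2(2,3)] unfolding Q' by (metis restrict_apply')
    have "Emb MU A (?u x) = Emb MU B (?u x)" for x
      using A(3) B(3) uM base com' by simp
    from agree_all[OF U, folded MU_def, OF A(1) B(1) _ this x] A B x show ?thesis by simp
  qed
  have agW: "k (?u x) = k' (i' x)" if x: "x \<in> MW" for x
  proof -
    obtain A where A: "ccuf MW A" "Ult MW A = P" "\<forall>x\<in>MW. Emb MW A x = k' (i' x)"
      using compose[OF MW wU, folded N'_def, OF Q'(1)] unfolding Q' i'_def by metis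
    have QZ: "ccuf (Ult MW Z1) Q" unfolding Z1(2) by (rule Q(1))
    obtain B where B: "ccuf MW B" "Ult MW B = P" "\<forall>x\<in>MW. Emb MW B x = k (?u x)"
      using compose[OF MW Z1(1) QZ, unfolded Z1(2,3)] unfolding Q by (metis restrict_apply')
    have "Emb MW B (?w x) = Emb MW A (?w x)" for x
      using A(3) B(3) wM base com by simp
    from agree_all[OF W, folded MW_def, OF B(1) A(1) _ this x] A B x show ?thesis by simp
  qed
  note sW = generatedD(1,2)[OF inner_UNIV MW J(3,5,7)] and sU = generatedD(1,2)[OF inner_UNIV MU I(3,5,7)]
  note gg = generatedD[OF MU N Ki(3) uM g] and gg' = generatedD[OF MW N' Ki'(3) wM g']
  have kN: "\<exists>y'\<in>N'. k y = k' y'" if y: "y \<in> N" for y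
  proof -
    \<comment> \<open>\<open>y\<close> is the value of \<open>i G\<close> at \<open>?u sW\<close>.
      Its counterpart in \<open>N'\<close> is the value of \<open>?w G\<close> at
      \<open>i' sW\<close>: \<open>agU\<close> matches the functions and \<open>agW\<close> the
      points.\<close>
    obtain G where G: "G \<in> MU" "fn (?u XW) G" "y = app (i G) (?u sW)" using gg(3)[OF y] by blast
    note iG = elem_fn[OF MU N Ki(3) uM G(1,2)] and wG = elem_fn[OF MU N' eW uM G(1,2)]
    have s': "i' sW \<epsilon> ?w (?u XW)"
      using elem_mem[OF Ki'(3) sW(1) wM] sW(2) com' by simp
    have "k y = app (k (i G)) (k (?u sW))"
      unfolding G(3) by (rule elem_app[OF N P ek elem_in[OF Ki(3) uM] elem_in[OF Ki(3) G(1)] iG gg(2)])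
    also have "\<dots> = app (k' (?w G)) (k' (i' sW))" using agU[OF G(1)] agW[OF sW(1)] by simp
    also have "\<dots> = k' (app (?w G) (i' sW))"
      by (rule elem_app[OF N' P ek' elem_in[OF eW uM] elem_in[OF eW G(1)] wG s', symmetric])
    finally show ?thesis using app_in[OF N' elem_in[OF eW G(1)] wG s'] by blast
  qed
  have kN': "\<exists>y\<in>N. k y = k' y'" if y: "y' \<in> N'" for y'
  proof -
    obtain G where G: "G \<in> MW" "fn (?w XU) G" "y' = app (i' G) (?w sU)" using gg'(3)[OF y] by blast
    note iG = elem_fn[OF MW N' Ki'(3) wM G(1,2)] and uG = elem_fn[OF MW N eU wM G(1,2)]
    have s': "i sU \<epsilon> ?u (?w XU)"
      using elem_mem[OF Ki(3) sU(1) uM] sU(2) com by simp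
    have "k' y' = app (k' (i' G)) (k' (?w sU))"
      unfolding G(3) by (rule elem_app[OF N' P ek' elem_in[OF Ki'(3) wM] elem_in[OF Ki'(3) G(1)] iG gg'(2)])
    also have "\<dots> = app (k (?u G)) (k (i sU))" using agW[OF G(1)] agU[OF sU(1)] by simp
    also have "\<dots> = k (app (?u G) (i sU))"
      by (rule elem_app[OF N P ek elem_in[OF eU wM] elem_in[OF eU G(1)] uG s', symmetric])
    finally show ?thesis using app_in[OF N elem_in[OF eU G(1)] uG s'] by metis
  qed
  \<comment> \<open>Both maps into \<open>P\<close> are elementary, so having the same image in
    \<open>P\<close> is a definable \<epsilon>-isomorphism between the transitive classes
    \<open>N\<close> and \<open>N'\<close>.\<close>
  define q where "q y y' \<longleftrightarrow> (\<exists>z. (y \<in> N \<and> k y = z) \<and> (y' \<in> N' \<and> k' y' = z))" for y y'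
  have dq: "drel q" unfolding drel_def q_def
    by (intro d_rules demb_app[OF demb_Emb[OF N Q(1), folded Q(2)]] demb_app[OF demb_Emb[OF N' Q'(1), folded Q'(2)]])
  have "(\<forall>y y'. q y y' \<longrightarrow> y = y') \<and> N = N'"
  proof (rule iso_identity[OF dq N N'])
    show "\<exists>y'. q y y'" if "y \<in> N" for y using kN[OF that] that unfolding q_def by auto
    show "\<exists>y. q y y'" if "y' \<in> N'" for y' using kN'[OF that] that unfolding q_def by auto
    show "y \<in> N \<and> y' \<in> N'" if "q y y'" for y y' using that unfolding q_def by blast
    show "y \<epsilon> z \<longleftrightarrow> y' \<epsilon> z'" if "q y y'" "q z z'" for y y' z z'
      using that elem_mem[OF ek, of y z] elem_mem[OF ek', of y' z'] unfolding q_def by auto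
  qed
  then have q: "q y y' \<Longrightarrow> y = y'" for y y' by blast
  \<comment> \<open>By \<open>agU\<close> the points \<open>i x\<close> and \<open>?w x\<close> have
    the same image in \<open>P\<close>, so they correspond under \<open>q\<close>.\<close>
  have "i x = ?w x" if x: "x \<in> MU" for x
    by (rule q) (use agU[OF x] elem_in[OF Ki(3) x] elem_in[OF eW x] in \<open>simp add: q_def\<close>)
  then have "i = restrict ?w MU" using Ki(4) by (intro extensionalityI[of _ MU]) simp_all
  then show ?thesis unfolding i_def MU_def .
qed

end

theorem mainTheorem4:
  fixes E :: "'v \<Rightarrow> 'v \<Rightarrow> bool" and U W :: 'v
  assumes "ZFC UNIV E"
    and "UA E"
    and "cc_ultrafilter UNIV E U"
    and "cc_ultrafilter UNIV E W"
  shows "internal_rel E U W \<and> internal_rel E W U \<longleftrightarrow>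
    image_fun E UNIV (ult UNIV E U) (ult_emb UNIV E U) (ult_emb UNIV E W)
      = restrict (ult_emb UNIV E W) (ult UNIV E U) \<and>
    image_fun E UNIV (ult UNIV E W) (ult_emb UNIV E W) (ult_emb UNIV E U)
      = restrict (ult_emb UNIV E U) (ult UNIV E W)"
proof -
  interpret zfc E by unfold_locales fact
  show ?thesis
    unfolding image_fun_Emb[OF assms(3,4)] image_fun_Emb[OF assms(4,3)]
    using image_eq_restriction[OF assms(2,3,4)] image_eq_restriction[OF assms(2,4,3)]
      internal_if_image[OF assms(3,4)] internal_if_image[OF assms(4,3)] by blast
qed

end
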